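(* Let $G$ be a finite group, $M$ a covariant coefficient system for $G$, and let $X_\alpha$, $\alpha\in\Lambda$, be an arbitrary family of well-pointed $G$-spaces. Then for every $q$ there is an isomorphism $$\bigoplus_{\alpha\in\Lambda}\widetilde H^G_q(X_\alpha;M)\cong\widetilde H^G_q\Bigl(\bigvee_{\alpha\in\Lambda}X_\alpha;M\Bigr)$$ induced by the canonical inclusions $X_\alpha\hookrightarrow\bigvee_{\alpha}X_\alpha$, where $\widetilde H^G_*(-;M)$ is reduced Bredon-Illman $G$-equivariant homology with coefficients in $M$.
   Context: Spaces are k-spaces ($X$ is a k-space if $W\subset X$ is closed whenever $f^{-1}(W)$ is closed for every continuous $f:Z\to X$, $Z$ compact Hausdorff). Pointed $G$-spaces and pointed $G$-sets have a $G$-fixed base point $x_0$; a pointed $G$-space is well-pointed if the inclusion of its base point is a $G$-cofibration (has the $G$-homotopy extension property). $G_x$ is the isotropy group of $x$. A covariant coefficient system is a covariant functor $M$ from the orbit category $\mathcal O(G)$ (objects $G/H$; morphisms $G$-functions) to $R$-modules, $R$ a commutative ring; $M_*(\alpha)$ is the homomorphism induced by $\alpha$. For a pointed $G$-set $S$, $F(S,M)$ is the $R$-module of functions $u:S\to\bigcup_{H\subset G}M(G/H)$ with $u(x)\in M(G/G_x)$, $u(x_0)=0$ and $u(x)=0$ for all but finitely many $x$; $lx$ ($l\in M(G/G_x)$) is the function with value $l$ at $x$ and $0$ elsewhere ($lx_0=0$). $G$ acts by $g\cdot(lx)=M_*(R_{g^{-1}})(l)(gx)$, where $R_{g^{-1}}:G/G_x\to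 G/G_{gx}$, $aG_x\mapsto ag^{-1}G_{gx}$. The fixed submodule $F(S,M)^G$ is generated by the elements $\gamma^G_x(l)=\sum_{[g]\in G/G_x}M_*(R_{g^{-1}})(l)(gx)$. $F^G(S,M)$ denotes $F(S,M)^G$ made functorial in pointed $G$-functions $f:S\to T$ by $f^G_*(\gamma^G_x(l))=\gamma^G_{f(x)}(M_*(\widehat f_x)(l))$, with $\widehat f_x:G/G_x\to G/G_{f(x)}$ the canonical projection. Let $\mathcal S(X)$ be the singular simplicial pointed $G$-set of a pointed $G$-space $X$ ($\mathcal S_q(X)$ = continuous maps $\Delta^q\to X$, based at the constant simplex). $\widetilde H^G_q(X;M)$ is the $q$th homology of the chain complex $F^G(\mathcal S_q(X),M)$ with differential $\sum_{i=0}^q(-1)^i(d_i)^G_*$; this complex is isomorphic to Illman's equivariant singular chain complex of $(X,x_0)$ with coefficients in $M$. *)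

theory Defs
  imports "HOL-Homology.Homology" "HOL-Analysis.Abstract_Topological_Spaces"
    "HOL-Analysis.Sum_Topology" "HOL-Algebra.Module" "HOL-Algebra.Group_Action" "HOL-Algebra.Left_Coset"
begin

section \<open>Modules\<close>

text \<open>HOL-Algebra modules are ring records with a scalar multiplication; the locale
  \<^locale>\<open>module\<close> ignores the fields \<open>mult\<close> and \<open>one\<close>, which are left undefined in the
  modules constructed below.\<close>

definition mod_hom ::
    "('r, 'k) ring_scheme \<Rightarrow> ('r, 'm) module \<Rightarrow> ('r, 'n) module \<Rightarrow> ('m \<Rightarrow> 'n) set" where
  "mod_hom R M N =
     {h \<in> carrier M \<rightarrow> carrier N.
        (\<forall>x\<in>carrier M. \<forall>y\<in>carrier M. h (x \<oplus>\<^bsub>M\<^esub> y) = h x \<oplus>\<^bsub>N\<^esub> h y) \<and>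
        (\<forall>r\<in>carrier R. \<forall>x\<in>carrier M. h (r \<odot>\<^bsub>M\<^esub> x) = r \<odot>\<^bsub>N\<^esub> h x)}"

definition mod_iso ::
    "('r, 'k) ring_scheme \<Rightarrow> ('r, 'm) module \<Rightarrow> ('r, 'n) module \<Rightarrow> ('m \<Rightarrow> 'n) set" where
  "mod_iso R M N = {h \<in> mod_hom R M N. bij_betw h (carrier M) (carrier N)}"

definition quotient_module :: "('r, 'm) module \<Rightarrow> 'm set \<Rightarrow> ('r, 'm set) module" where
  "quotient_module M B =
     \<lparr>carrier = a_rcosets\<^bsub>M\<^esub> B, monoid.mult = undefined, one = undefined,
      zero = B, add = set_add M,
      smult = (\<lambda>r c. \<Union>x\<in>c. B +>\<^bsub>M\<^esub> (r \<odot>\<^bsub>M\<^esub> x))\<rparr>"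

definition direct_sum_module :: "'i set \<Rightarrow> ('i \<Rightarrow> ('r, 'm) module) \<Rightarrow> ('r, 'i \<Rightarrow> 'm) module" where
  "direct_sum_module I M =
     \<lparr>carrier = {u \<in> \<Pi>\<^sub>E i\<in>I. carrier (M i). finite {i \<in> I. u i \<noteq> \<zero>\<^bsub>M i\<^esub>}},
      monoid.mult = undefined, one = undefined,
      zero = (\<lambda>i\<in>I. \<zero>\<^bsub>M i\<^esub>), add = (\<lambda>u v. \<lambda>i\<in>I. u i \<oplus>\<^bsub>M i\<^esub> v i),
      smult = (\<lambda>r u. \<lambda>i\<in>I. r \<odot>\<^bsub>M i\<^esub> u i)\<rparr>"

definition direct_sum_incl :: "'i set \<Rightarrow> ('i \<Rightarrow> ('r, 'm) module) \<Rightarrow> 'i \<Rightarrow> 'm \<Rightarrow> 'i \<Rightarrow> 'm" where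
  "direct_sum_incl I M j x = (\<lambda>i\<in>I. if i = j then x else \<zero>\<^bsub>M i\<^esub>)"

section \<open>Covariant coefficient systems\<close>

text \<open>The object \<open>G/H\<close> of the orbit category is the set \<open>lcosets\<^bsub>G\<^esub> H\<close> of left cosets.
  Morphisms are extensional, so that equal \<open>G\<close>-functions are equal in HOL.\<close>

definition orbit_hom :: "('g, 'k) monoid_scheme \<Rightarrow> 'g set \<Rightarrow> 'g set \<Rightarrow> ('g set \<Rightarrow> 'g set) set" where
  "orbit_hom G H K =
     {\<alpha> \<in> lcosets\<^bsub>G\<^esub> H \<rightarrow>\<^sub>E lcosets\<^bsub>G\<^esub> K.
        \<forall>g\<in>carrier G. \<forall>c\<in>lcosets\<^bsub>G\<^esub> H. \<alpha> (g <#\<^bsub>G\<^esub> c) = g <#\<^bsub>G\<^esub> \<alpha> c}"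

text \<open>The \<open>G\<close>-function \<open>G/H \<rightarrow> G/K\<close>, \<open>aH \<mapsto> abK\<close>. It is well defined if \<open>b\<^sup>-\<^sup>1Hb \<subseteq> K\<close>; the union
  is then one of equal cosets. The case \<open>b = g\<^sup>-\<^sup>1\<close> is \<open>R\<close> with index \<open>g\<^sup>-\<^sup>1\<close>, and the case
  \<open>b = 1\<close> is the canonical projection.\<close>

definition orbit_map :: "('g, 'k) monoid_scheme \<Rightarrow> 'g set \<Rightarrow> 'g set \<Rightarrow> 'g \<Rightarrow> 'g set \<Rightarrow> 'g set" where
  "orbit_map G H K b = (\<lambda>c\<in>lcosets\<^bsub>G\<^esub> H. \<Union>a\<in>c. (a \<otimes>\<^bsub>G\<^esub> b) <#\<^bsub>G\<^esub> K)"

text \<open>\<open>mod_at M H\<close> is \<open>M(G/H)\<close>, and \<open>map_at M H K \<alpha>\<close> is \<open>M\<^sub>*(\<alpha>)\<close> for \<open>\<alpha> : G/H \<rightarrow> G/K\<close>.\<close>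

record ('g, 'r, 'm) coeff_system =
  mod_at :: "'g set \<Rightarrow> ('r, 'm) module"
  map_at :: "'g set \<Rightarrow> 'g set \<Rightarrow> ('g set \<Rightarrow> 'g set) \<Rightarrow> 'm \<Rightarrow> 'm"

definition covariant_coeff_system ::
    "('g, 'k) monoid_scheme \<Rightarrow> ('r, 'l) ring_scheme \<Rightarrow> ('g, 'r, 'm) coeff_system \<Rightarrow> bool" where
  "covariant_coeff_system G R M \<longleftrightarrow>
     (\<forall>H. subgroup H G \<longrightarrow> module R (mod_at M H)) \<and>
     (\<forall>H K. subgroup H G \<longrightarrow> subgroup K G \<longrightarrow>
        (\<forall>\<alpha>\<in>orbit_hom G H K. map_at M H K \<alpha> \<in> mod_hom R (mod_at M H) (mod_at M K))) \<and>
     (\<forall>H. subgroup H G \<longrightarrow>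
        (\<forall>l\<in>carrier (mod_at M H). map_at M H H (\<lambda>c\<in>lcosets\<^bsub>G\<^esub> H. c) l = l)) \<and>
     (\<forall>H K L. subgroup H G \<longrightarrow> subgroup K G \<longrightarrow> subgroup L G \<longrightarrow>
        (\<forall>\<alpha>\<in>orbit_hom G H K. \<forall>\<beta>\<in>orbit_hom G K L. \<forall>l\<in>carrier (mod_at M H).
           map_at M H L (compose (lcosets\<^bsub>G\<^esub> H) \<beta> \<alpha>) l = map_at M K L \<beta> (map_at M H K \<alpha> l)))"

section \<open>The functor of invariant chains on pointed G-sets\<close>

record ('g, 's) pgset =
  points :: "'s set"
  act :: "'g \<Rightarrow> 's \<Rightarrow> 's"
  basept :: 's

definition pointed_gset :: "('g, 'k) monoid_scheme \<Rightarrow> ('g, 's) pgset \<Rightarrow> bool" where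
  "pointed_gset G S \<longleftrightarrow>
     group_action G (points S) (act S) \<and> basept S \<in> points S \<and>
     (\<forall>g\<in>carrier G. act S g (basept S) = basept S)"

abbreviation isotropy :: "('g, 'k) monoid_scheme \<Rightarrow> ('g, 's) pgset \<Rightarrow> 's \<Rightarrow> 'g set" where
  "isotropy G S x \<equiv> stabilizer G (act S) x"

abbreviation coeff_at ::
    "('g, 'k) monoid_scheme \<Rightarrow> ('g, 'r, 'm) coeff_system \<Rightarrow> ('g, 's) pgset \<Rightarrow> 's \<Rightarrow> ('r, 'm) module"
  where "coeff_at G M S x \<equiv> mod_at M (isotropy G S x)"

definition fun_module ::
    "('g, 'k) monoid_scheme \<Rightarrow> ('g, 'r, 'm) coeff_system \<Rightarrow> ('g, 's) pgset \<Rightarrow> ('r, 's \<Rightarrow> 'm) module"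
  where
  "fun_module G M S =
     \<lparr>carrier = {u \<in> \<Pi>\<^sub>E x\<in>points S. carrier (coeff_at G M S x).
                   u (basept S) = \<zero>\<^bsub>coeff_at G M S (basept S)\<^esub> \<and>
                   finite {x \<in> points S. u x \<noteq> \<zero>\<^bsub>coeff_at G M S x\<^esub>}},
      monoid.mult = undefined, one = undefined,
      zero = (\<lambda>x\<in>points S. \<zero>\<^bsub>coeff_at G M S x\<^esub>),
      add = (\<lambda>u v. \<lambda>x\<in>points S. u x \<oplus>\<^bsub>coeff_at G M S x\<^esub> v x),
      smult = (\<lambda>r u. \<lambda>x\<in>points S. r \<odot>\<^bsub>coeff_at G M S x\<^esub> u x)\<rparr>"

text \<open>The element \<open>lx\<close>.\<close>

definition elem ::
    "('g, 'k) monoid_scheme \<Rightarrow> ('g, 'r, 'm) coeff_system \<Rightarrow> ('g, 's) pgset \<Rightarrow> 'm \<Rightarrow> 's \<Rightarrow> 's \<Rightarrow> 'm"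
  where
  "elem G M S l x =
     (\<lambda>y\<in>points S. if y = x \<and> x \<noteq> basept S then l else \<zero>\<^bsub>coeff_at G M S y\<^esub>)"

text \<open>\<open>M\<^sub>*(R)\<close> for \<open>R\<close> the function \<open>G/G\<^sub>x \<rightarrow> G/G\<^sub>g\<^sub>x\<close> with index \<open>g\<^sup>-\<^sup>1\<close>.\<close>

definition transl ::
    "('g, 'k) monoid_scheme \<Rightarrow> ('g, 'r, 'm) coeff_system \<Rightarrow> ('g, 's) pgset \<Rightarrow> 'g \<Rightarrow> 's \<Rightarrow> 'm \<Rightarrow> 'm"
  where
  "transl G M S g x =
     map_at M (isotropy G S x) (isotropy G S (act S g x))
       (orbit_map G (isotropy G S x) (isotropy G S (act S g x)) (inv\<^bsub>G\<^esub> g))"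

text \<open>The linear extension of \<open>g\<cdot>(lx) = M\<^sub>*(R)(l)(gx)\<close>: the value of \<open>g\<cdot>u\<close> at \<open>y\<close> comes from the
  value of \<open>u\<close> at \<open>x = g\<^sup>-\<^sup>1y\<close>.\<close>

definition fun_act ::
    "('g, 'k) monoid_scheme \<Rightarrow> ('g, 'r, 'm) coeff_system \<Rightarrow> ('g, 's) pgset \<Rightarrow>
      'g \<Rightarrow> ('s \<Rightarrow> 'm) \<Rightarrow> 's \<Rightarrow> 'm" where
  "fun_act G M S g u =
     (\<lambda>y\<in>points S. let x = act S (inv\<^bsub>G\<^esub> g) y in transl G M S g x (u x))"

definition fixed_module ::
    "('g, 'k) monoid_scheme \<Rightarrow> ('g, 'r, 'm) coeff_system \<Rightarrow> ('g, 's) pgset \<Rightarrow> ('r, 's \<Rightarrow> 'm) module"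
  where
  "fixed_module G M S =
     (fun_module G M S)\<lparr>carrier :=
        {u \<in> carrier (fun_module G M S). \<forall>g\<in>carrier G. fun_act G M S g u = u}\<rparr>"

text \<open>The summand does not depend on the representative \<open>g\<close> of the coset \<open>c\<close>.\<close>

definition gamma ::
    "('g, 'k) monoid_scheme \<Rightarrow> ('g, 'r, 'm) coeff_system \<Rightarrow> ('g, 's) pgset \<Rightarrow> 's \<Rightarrow> 'm \<Rightarrow> 's \<Rightarrow> 'm"
  where
  "gamma G M S x l =
     (\<Oplus>\<^bsub>fun_module G M S\<^esub>c\<in>lcosets\<^bsub>G\<^esub> (isotropy G S x).
        let g = (SOME g. g \<in> c) in elem G M S (transl G M S g x l) (act S g x))"

text \<open>The homomorphism induced by a pointed \<open>G\<close>-function \<open>f : S \<rightarrow> T\<close>. As the elements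
  \<open>\<gamma>\<close> generate, at most one homomorphism satisfies the defining equation. It is not the
  restriction of the push-forward of functions: that one multiplies by the index of \<open>G\<^sub>x\<close> in
  the isotropy group of \<open>f(x)\<close>.\<close>

definition fixed_map ::
    "('g, 'k) monoid_scheme \<Rightarrow> ('r, 'l) ring_scheme \<Rightarrow> ('g, 'r, 'm) coeff_system \<Rightarrow>
      ('g, 's) pgset \<Rightarrow> ('g, 't) pgset \<Rightarrow> ('s \<Rightarrow> 't) \<Rightarrow> ('s \<Rightarrow> 'm) \<Rightarrow> 't \<Rightarrow> 'm" where
  "fixed_map G R M S T f =
     (THE h. h \<in> mod_hom R (fixed_module G M S) (fixed_module G M T) \<and>
        h \<in> extensional (carrier (fixed_module G M S)) \<and>
        (\<forall>x\<in>points S. \<forall>l\<in>carrier (coeff_at G M S x).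
           h (gamma G M S x l) =
           gamma G M T (f x)
             (map_at M (isotropy G S x) (isotropy G T (f x))
                (orbit_map G (isotropy G S x) (isotropy G T (f x)) \<one>\<^bsub>G\<^esub>) l)))"

section \<open>G-spaces\<close>

text \<open>A space is a k-space if closedness of its subsets is detected by maps from all compact
  Hausdorff spaces. HOL cannot quantify over types inside a definition, so the test
  spaces are those with points in \<open>'z\<close>. The property gets weaker as \<open>'z\<close> gets larger, and for
  every k-space a set of test spaces, hence one type \<open>'z\<close>, suffices. A space is therefore a k-space
  iff this holds for some type \<open>'z\<close>, and a theorem in which the type \<open>'z\<close> is arbitrary covers all
  k-spaces. The notion \<^const>\<open>k_space\<close>, which tests on compact subsets instead, differs from this
  one on non-Hausdorff spaces.\<close>

definition k_space_over :: "'z itself \<Rightarrow> 'a topology \<Rightarrow> bool" where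
  "k_space_over z X \<longleftrightarrow>
     (\<forall>W. W \<subseteq> topspace X \<longrightarrow>
        (\<forall>(Z :: 'z topology) f.
           compact_space Z \<longrightarrow> Hausdorff_space Z \<longrightarrow> continuous_map Z X f \<longrightarrow>
           closedin Z {t \<in> topspace Z. f t \<in> W}) \<longrightarrow>
        closedin X W)"

text \<open>The group is discrete (finite in the application), so continuity of the action is continuity
  of each translation. By the library's convention for \<^locale>\<open>group_action\<close>, translations are
  extensional.\<close>

definition gspace ::
    "'z itself \<Rightarrow> ('g, 'k) monoid_scheme \<Rightarrow> 'a topology \<Rightarrow> ('g \<Rightarrow> 'a \<Rightarrow> 'a) \<Rightarrow> bool" where
  "gspace z G X \<phi> \<longleftrightarrow>
     k_space_over z X \<and> group_action G (topspace X) \<phi> \<and>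
     (\<forall>g\<in>carrier G. continuous_map X X (\<phi> g))"

definition gmap ::
    "('g, 'k) monoid_scheme \<Rightarrow> 'a topology \<Rightarrow> ('g \<Rightarrow> 'a \<Rightarrow> 'a) \<Rightarrow>
      'b topology \<Rightarrow> ('g \<Rightarrow> 'b \<Rightarrow> 'b) \<Rightarrow> ('a \<Rightarrow> 'b) \<Rightarrow> bool" where
  "gmap G X \<phi> Y \<psi> f \<longleftrightarrow>
     continuous_map X Y f \<and> (\<forall>g\<in>carrier G. \<forall>x\<in>topspace X. f (\<phi> g x) = \<psi> g (f x))"

definition ghomotopy ::
    "('g, 'k) monoid_scheme \<Rightarrow> 'a topology \<Rightarrow> ('g \<Rightarrow> 'a \<Rightarrow> 'a) \<Rightarrow>
      'b topology \<Rightarrow> ('g \<Rightarrow> 'b \<Rightarrow> 'b) \<Rightarrow> ('a \<times> real \<Rightarrow> 'b) \<Rightarrow> bool" where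
  "ghomotopy G X \<phi> Y \<psi> h \<longleftrightarrow>
     gmap G (prod_topology X (top_of_set {0..1})) (\<lambda>g (x, t). (\<phi> g x, t)) Y \<psi> h"

text \<open>The \<open>G\<close>-homotopy extension property of the inclusion of \<open>A\<close>. The target \<open>Y\<close> ranges over the
  \<open>G\<close>-spaces with points in \<open>'a \<times> real\<close>. This is no restriction, since the mapping cylinder of the
  inclusion, which is the universal target and a k-space if \<open>X\<close> is, lives on \<open>X \<times> {0} \<union> A \<times> [0,1]\<close>.\<close>

definition gcofibration ::
    "'z itself \<Rightarrow> ('g, 'k) monoid_scheme \<Rightarrow> 'a topology \<Rightarrow> ('g \<Rightarrow> 'a \<Rightarrow> 'a) \<Rightarrow> 'a set \<Rightarrow> bool" where
  "gcofibration z G X \<phi> A \<longleftrightarrow>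
     (\<forall>(Y :: ('a \<times> real) topology) \<psi> f h.
        gspace z G Y \<psi> \<longrightarrow> gmap G X \<phi> Y \<psi> f \<longrightarrow> ghomotopy G (subtopology X A) \<phi> Y \<psi> h \<longrightarrow>
        (\<forall>a\<in>A. h (a, 0) = f a) \<longrightarrow>
        (\<exists>H. ghomotopy G X \<phi> Y \<psi> H \<and> (\<forall>x\<in>topspace X. H (x, 0) = f x) \<and>
           (\<forall>a\<in>A. \<forall>t\<in>{0..1}. H (a, t) = h (a, t))))"

record ('g, 'a) pgspace =
  spc :: "'a topology"
  sact :: "'g \<Rightarrow> 'a \<Rightarrow> 'a"
  spt :: 'a

definition pointed_gspace :: "'z itself \<Rightarrow> ('g, 'k) monoid_scheme \<Rightarrow> ('g, 'a) pgspace \<Rightarrow> bool" where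
  "pointed_gspace z G X \<longleftrightarrow>
     gspace z G (spc X) (sact X) \<and> spt X \<in> topspace (spc X) \<and>
     (\<forall>g\<in>carrier G. sact X g (spt X) = spt X)"

definition well_pointed :: "'z itself \<Rightarrow> ('g, 'k) monoid_scheme \<Rightarrow> ('g, 'a) pgspace \<Rightarrow> bool" where
  "well_pointed z G X \<longleftrightarrow>
     pointed_gspace z G X \<and> gcofibration z G (spc X) (sact X) {spt X}"

section \<open>Wedges\<close>

text \<open>The points of the wedge are the common base point \<open>None\<close> and the points \<open>Some (\<alpha>, x)\<close> with
  \<open>x\<close> not the base point of \<open>X \<alpha>\<close>. The wedge of the empty family is a point.\<close>

definition wedge_incl :: "('i \<Rightarrow> ('g, 'a) pgspace) \<Rightarrow> 'i \<Rightarrow> 'a \<Rightarrow> ('i \<times> 'a) option" where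
  "wedge_incl X \<alpha> x = (if x = spt (X \<alpha>) then None else Some (\<alpha>, x))"

definition wedge_points :: "('i \<Rightarrow> ('g, 'a) pgspace) \<Rightarrow> 'i set \<Rightarrow> ('i \<times> 'a) option set" where
  "wedge_points X I = insert None (\<Union>\<alpha>\<in>I. wedge_incl X \<alpha> ` topspace (spc (X \<alpha>)))"

definition wedge_topology :: "('i \<Rightarrow> ('g, 'a) pgspace) \<Rightarrow> 'i set \<Rightarrow> ('i \<times> 'a) option topology" where
  "wedge_topology X I =
     topology (\<lambda>U. U \<subseteq> wedge_points X I \<and>
       (\<forall>\<alpha>\<in>I. openin (spc (X \<alpha>)) {x \<in> topspace (spc (X \<alpha>)). wedge_incl X \<alpha> x \<in> U}))"

definition wedge :: "('i \<Rightarrow> ('g, 'a) pgspace) \<Rightarrow> 'i set \<Rightarrow> ('g, ('i \<times> 'a) option) pgspace" where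
  "wedge X I =
     \<lparr>spc = wedge_topology X I,
      sact = (\<lambda>g. \<lambda>p\<in>wedge_points X I. map_option (\<lambda>(\<alpha>, x). (\<alpha>, sact (X \<alpha>) g x)) p),
      spt = None\<rparr>"

lemma openin_wedge_topology:
  "openin (wedge_topology X I) U \<longleftrightarrow>
     U \<subseteq> wedge_points X I \<and>
     (\<forall>\<alpha>\<in>I. openin (spc (X \<alpha>)) {x \<in> topspace (spc (X \<alpha>)). wedge_incl X \<alpha> x \<in> U})"
proof -
  have Int: "{x \<in> topspace (spc (X \<alpha>)). wedge_incl X \<alpha> x \<in> S \<inter> T} =
      {x \<in> topspace (spc (X \<alpha>)). wedge_incl X \<alpha> x \<in> S} \<inter>
      {x \<in> topspace (spc (X \<alpha>)). wedge_incl X \<alpha> x \<in> T}" for S T \<alpha>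
    by auto
  have Un: "{x \<in> topspace (spc (X \<alpha>)). wedge_incl X \<alpha> x \<in> \<Union>\<K>} =
      (\<Union>K\<in>\<K>. {x \<in> topspace (spc (X \<alpha>)). wedge_incl X \<alpha> x \<in> K})" for \<K> \<alpha>
    by auto
  have "istopology (\<lambda>U. U \<subseteq> wedge_points X I \<and>
       (\<forall>\<alpha>\<in>I. openin (spc (X \<alpha>)) {x \<in> topspace (spc (X \<alpha>)). wedge_incl X \<alpha> x \<in> U}))"
    unfolding istopology_def Int Un by blast
  then show ?thesis
    by (simp add: wedge_topology_def)
qed

lemma topspace_wedge_topology [simp]: "topspace (wedge_topology X I) = wedge_points X I"
proof -
  have "{x \<in> topspace (spc (X \<alpha>)). wedge_incl X \<alpha> x \<in> wedge_points X I} = topspace (spc (X \<alpha>))"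
    if "\<alpha> \<in> I" for \<alpha>
    using that by (auto simp: wedge_points_def)
  then have "openin (wedge_topology X I) (wedge_points X I)"
    by (simp add: openin_wedge_topology)
  then show ?thesis
    by (metis openin_subset openin_topspace openin_wedge_topology subset_antisym)
qed

lemma quotient_map_wedge:
  assumes "I \<noteq> {}" and "\<And>\<alpha>. \<alpha> \<in> I \<Longrightarrow> spt (X \<alpha>) \<in> topspace (spc (X \<alpha>))"
  shows "quotient_map (sum_topology (\<lambda>\<alpha>. spc (X \<alpha>)) I) (wedge_topology X I)
           (\<lambda>(\<alpha>, x). wedge_incl X \<alpha> x)"
proof -
  obtain \<beta> where \<beta>: "\<beta> \<in> I" using assms(1) by blast
  then have "wedge_incl X \<beta> (spt (X \<beta>)) = None" by (simp add: wedge_incl_def)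
  then have "(\<lambda>(\<alpha>, x). wedge_incl X \<alpha> x) ` Sigma I (\<lambda>\<alpha>. topspace (spc (X \<alpha>))) = wedge_points X I"
    using assms(2)[OF \<beta>] \<beta> unfolding wedge_points_def by (force simp: image_iff)
  moreover have "{x. \<alpha> \<in> I \<and> x \<in> topspace (spc (X \<alpha>)) \<and> wedge_incl X \<alpha> x \<in> U} =
      {x \<in> topspace (spc (X \<alpha>)). wedge_incl X \<alpha> x \<in> U}" if "\<alpha> \<in> I" for \<alpha> U
    using that by auto
  ultimately show ?thesis
    by (auto simp: quotient_map_def openin_wedge_topology openin_sum_topology o_def)
qed

section \<open>Reduced Bredon-Illman homology\<close>

definition singular_gset :: "nat \<Rightarrow> ('g, 'a) pgspace \<Rightarrow> ('g, (nat \<Rightarrow> real) \<Rightarrow> 'a) pgset" where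
  "singular_gset q X =
     \<lparr>points = singular_simplex_set q (spc X),
      act = (\<lambda>g. \<lambda>\<sigma>\<in>singular_simplex_set q (spc X). simplex_map q (sact X g) \<sigma>),
      basept = (\<lambda>t\<in>standard_simplex q. spt X)\<rparr>"

definition gchains ::
    "('g, 'k) monoid_scheme \<Rightarrow> ('g, 'r, 'm) coeff_system \<Rightarrow> ('g, 'a) pgspace \<Rightarrow> nat \<Rightarrow>
      ('r, ((nat \<Rightarrow> real) \<Rightarrow> 'a) \<Rightarrow> 'm) module" where
  "gchains G M X q = fixed_module G M (singular_gset q X)"

definition gboundary ::
    "('g, 'k) monoid_scheme \<Rightarrow> ('r, 'l) ring_scheme \<Rightarrow> ('g, 'r, 'm) coeff_system \<Rightarrow>
      ('g, 'a) pgspace \<Rightarrow> nat \<Rightarrow> (((nat \<Rightarrow> real) \<Rightarrow> 'a) \<Rightarrow> 'm) \<Rightarrow> ((nat \<Rightarrow> real) \<Rightarrow> 'a) \<Rightarrow> 'm" where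
  "gboundary G R M X q u =
     (if q = 0 then \<zero>\<^bsub>gchains G M X (q - 1)\<^esub>
      else \<Oplus>\<^bsub>gchains G M X (q - 1)\<^esub>i\<in>{0..q}.
        ((\<ominus>\<^bsub>R\<^esub> \<one>\<^bsub>R\<^esub>) [^]\<^bsub>R\<^esub> i) \<odot>\<^bsub>gchains G M X (q - 1)\<^esub>
          fixed_map G R M (singular_gset q X) (singular_gset (q - 1) X) (singular_face q i) u)"

definition gcycles ::
    "('g, 'k) monoid_scheme \<Rightarrow> ('r, 'l) ring_scheme \<Rightarrow> ('g, 'r, 'm) coeff_system \<Rightarrow>
      ('g, 'a) pgspace \<Rightarrow> nat \<Rightarrow> (((nat \<Rightarrow> real) \<Rightarrow> 'a) \<Rightarrow> 'm) set" where
  "gcycles G R M X q =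
     {u \<in> carrier (gchains G M X q). gboundary G R M X q u = \<zero>\<^bsub>gchains G M X (q - 1)\<^esub>}"

definition gboundaries ::
    "('g, 'k) monoid_scheme \<Rightarrow> ('r, 'l) ring_scheme \<Rightarrow> ('g, 'r, 'm) coeff_system \<Rightarrow>
      ('g, 'a) pgspace \<Rightarrow> nat \<Rightarrow> (((nat \<Rightarrow> real) \<Rightarrow> 'a) \<Rightarrow> 'm) set" where
  "gboundaries G R M X q = gboundary G R M X (q + 1) ` carrier (gchains G M X (q + 1))"

definition bredon_illman_homology ::
    "('g, 'k) monoid_scheme \<Rightarrow> ('r, 'l) ring_scheme \<Rightarrow> ('g, 'r, 'm) coeff_system \<Rightarrow> nat \<Rightarrow>
      ('g, 'a) pgspace \<Rightarrow> ('r, (((nat \<Rightarrow> real) \<Rightarrow> 'a) \<Rightarrow> 'm) set) module" where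
  "bredon_illman_homology G R M q X =
     quotient_module ((gchains G M X q)\<lparr>carrier := gcycles G R M X q\<rparr>) (gboundaries G R M X q)"

text \<open>The homomorphism induced by a pointed \<open>G\<close>-map \<open>f : X \<rightarrow> Y\<close>. The union over the cycles \<open>u\<close> in
  the homology class \<open>c\<close> is one of equal cosets.\<close>

definition homology_map ::
    "('g, 'k) monoid_scheme \<Rightarrow> ('r, 'l) ring_scheme \<Rightarrow> ('g, 'r, 'm) coeff_system \<Rightarrow> nat \<Rightarrow>
      ('g, 'a) pgspace \<Rightarrow> ('g, 'b) pgspace \<Rightarrow> ('a \<Rightarrow> 'b) \<Rightarrow>
      (((nat \<Rightarrow> real) \<Rightarrow> 'a) \<Rightarrow> 'm) set \<Rightarrow> (((nat \<Rightarrow> real) \<Rightarrow> 'b) \<Rightarrow> 'm) set" where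
  "homology_map G R M q X Y f c =
     (\<Union>u\<in>c. gboundaries G R M Y q +>\<^bsub>gchains G M Y q\<^esub>
        fixed_map G R M (singular_gset q X) (singular_gset q Y) (simplex_map q f) u)"

end

theory Submission
  imports Defs
begin

text \<open>The retractions of the wedge onto its summands are left inverses of the inclusions, so the
  direct sum injects into the homology of the wedge without any hypothesis on base points. For
  surjectivity, extending a whisker at the base point over each summand gives an equivariant
  deformation of the wedge that collapses a neighbourhood of the base point. After sufficiently
  many barycentric subdivisions every simplex of the deformed cycle lies in one summand.

  Subdivisions, prisms and boundaries are carried over from integral singular chains as follows. A
  family that assigns to each simplex \<open>\<sigma>\<close> an integral combination of simplices fixed by the isotropy
  group of \<open>\<sigma>\<close>, equivariantly in \<open>\<sigma>\<close>, induces a homomorphism of the invariant chains with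
  coefficients in \<open>M\<close>, compatibly with sums and composition. Hence every identity between natural
  operators on integral chains holds with coefficients in \<open>M\<close>.\<close>

section \<open>Homomorphisms, products and quotients of modules\<close>

text \<open>The obstacle is the base point: a summand need not be open in the wedge, and a small
  simplex near the base point may pass through several summands. After the collapse such a simplex
  is constant at the base point, and this constant simplex is zero in reduced chains. An infinite
  family is handled by finiteness of supports: for a given cycle finitely many summands and one
  number n of subdivisions suffice. The homotopy from the identity to the n-fold subdivided
  deformation is therefore built in one piece for each fixed n. It comes from universal chains on
  the prisms \<Delta>^p x [0,1], which exist by acyclicity; since the same chains are pushed forward
  along all simplices, the homotopy commutes with G. Integral chains are the place where identities
  are proved because the coefficient module M(G/G_x) varies with the simplex: a coefficient at x can
  be moved to y along a projection of orbits only if G_x fixes y. This is the reason for the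
  condition on isotropy groups.\<close>

lemma mod_homI:
  assumes "\<And>x. x \<in> carrier M \<Longrightarrow> h x \<in> carrier N"
    and "\<And>x y. x \<in> carrier M \<Longrightarrow> y \<in> carrier M \<Longrightarrow> h (x \<oplus>\<^bsub>M\<^esub> y) = h x \<oplus>\<^bsub>N\<^esub> h y"
    and "\<And>r x. r \<in> carrier R \<Longrightarrow> x \<in> carrier M \<Longrightarrow> h (r \<odot>\<^bsub>M\<^esub> x) = r \<odot>\<^bsub>N\<^esub> h x"
  shows "h \<in> mod_hom R M N"
  using assms by (auto simp: mod_hom_def)

lemma mod_hom_closed: "h \<in> mod_hom R M N \<Longrightarrow> x \<in> carrier M \<Longrightarrow> h x \<in> carrier N"
  by (auto simp: mod_hom_def)

lemma mod_hom_add: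
  "h \<in> mod_hom R M N \<Longrightarrow> x \<in> carrier M \<Longrightarrow> y \<in> carrier M \<Longrightarrow> h (x \<oplus>\<^bsub>M\<^esub> y) = h x \<oplus>\<^bsub>N\<^esub> h y"
  by (auto simp: mod_hom_def)

lemma mod_hom_smult:
  "h \<in> mod_hom R M N \<Longrightarrow> r \<in> carrier R \<Longrightarrow> x \<in> carrier M \<Longrightarrow> h (r \<odot>\<^bsub>M\<^esub> x) = r \<odot>\<^bsub>N\<^esub> h x"
  by (auto simp: mod_hom_def)

lemma mod_hom_zero:
  assumes "module R M" "module R N" "h \<in> mod_hom R M N"
  shows "h \<zero>\<^bsub>M\<^esub> = \<zero>\<^bsub>N\<^esub>"
proof -
  interpret M: module R M by fact
  interpret N: module R N by fact
  have "h \<zero>\<^bsub>M\<^esub> = h (\<zero>\<^bsub>R\<^esub> \<odot>\<^bsub>M\<^esub> \<zero>\<^bsub>M\<^esub>)"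
    by simp
  also have "\<dots> = \<zero>\<^bsub>R\<^esub> \<odot>\<^bsub>N\<^esub> h \<zero>\<^bsub>M\<^esub>"
    by (rule mod_hom_smult[OF assms(3)]) simp_all
  also have "\<dots> = \<zero>\<^bsub>N\<^esub>"
    by (simp add: mod_hom_closed[OF assms(3)])
  finally show ?thesis .
qed

lemma mod_hom_a_inv:
  assumes "module R M" "module R N" "h \<in> mod_hom R M N" "x \<in> carrier M"
  shows "h (\<ominus>\<^bsub>M\<^esub> x) = \<ominus>\<^bsub>N\<^esub> h x"
proof -
  interpret M: module R M by fact
  interpret N: module R N by fact
  have "h (\<ominus>\<^bsub>M\<^esub> x) \<oplus>\<^bsub>N\<^esub> h x = \<zero>\<^bsub>N\<^esub>"
    using mod_hom_add[OF assms(3), of "\<ominus>\<^bsub>M\<^esub> x" x] assms(4) mod_hom_zero[OF assms(1-3)]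
    by (simp add: M.l_neg)
  then show ?thesis
    using N.minus_equality[of "h (\<ominus>\<^bsub>M\<^esub> x)" "h x"] assms(4)
    by (simp add: mod_hom_closed[OF assms(3)])
qed

lemma mod_hom_minus:
  assumes "module R M" "module R N" "h \<in> mod_hom R M N" "x \<in> carrier M" "y \<in> carrier M"
  shows "h (x \<ominus>\<^bsub>M\<^esub> y) = h x \<ominus>\<^bsub>N\<^esub> h y"
proof -
  interpret M: module R M by fact
  show ?thesis
    using assms by (simp add: a_minus_def mod_hom_add[OF assms(3)] mod_hom_a_inv[OF assms(1-3)])
qed

lemma mod_hom_finsum:
  assumes "module R M" "module R N" "h \<in> mod_hom R M N"
    and "finite A" "f \<in> A \<rightarrow> carrier M"
  shows "h (\<Oplus>\<^bsub>M\<^esub>i\<in>A. f i) = (\<Oplus>\<^bsub>N\<^esub>i\<in>A. h (f i))"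
  using assms(4,5)
proof (induction A)
  case empty
  interpret M: module R M by fact
  interpret N: module R N by fact
  show ?case by (simp add: mod_hom_zero[OF assms(1-3)])
next
  case (insert a A)
  interpret M: module R M by fact
  interpret N: module R N by fact
  have "(\<lambda>i. h (f i)) \<in> A \<rightarrow> carrier N" "h (f a) \<in> carrier N"
    using insert.prems by (auto intro!: mod_hom_closed[OF assms(3)])
  then show ?case
    using insert by (simp add: mod_hom_add[OF assms(3)] M.finsum_closed)
qed

lemma mod_hom_comp:
  "h \<in> mod_hom R M N \<Longrightarrow> k \<in> mod_hom R N P \<Longrightarrow> (\<lambda>x. k (h x)) \<in> mod_hom R M P"
  by (auto simp: mod_hom_def Pi_iff)

text \<open>The full product. Direct sums and the modules of functions with coefficients are this
  record with a smaller carrier, so their module axioms reduce to closure conditions on a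
  subset.\<close>

definition pointwise_module :: "'i set \<Rightarrow> ('i \<Rightarrow> ('r, 'm) module) \<Rightarrow> ('r, 'i \<Rightarrow> 'm) module" where
  "pointwise_module I M =
     \<lparr>carrier = (\<Pi>\<^sub>E i\<in>I. carrier (M i)), monoid.mult = undefined, one = undefined,
      zero = (\<lambda>i\<in>I. \<zero>\<^bsub>M i\<^esub>), add = (\<lambda>u v. \<lambda>i\<in>I. u i \<oplus>\<^bsub>M i\<^esub> v i),
      smult = (\<lambda>r u. \<lambda>i\<in>I. r \<odot>\<^bsub>M i\<^esub> u i)\<rparr>"

lemma module_pointwise_module:
  assumes "cring R" "\<And>i. i \<in> I \<Longrightarrow> module R (M i)"
  shows "module R (pointwise_module I M)"
proof (rule moduleI)
  note [simp] = module.smult_closed[OF assms(2)] module.smult_one[OF assms(2)]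
    abelian_group.axioms(1)[OF module.axioms(2)[OF assms(2)], THEN abelian_monoid.a_closed]
    abelian_group.axioms(1)[OF module.axioms(2)[OF assms(2)], THEN abelian_monoid.zero_closed]
    abelian_group.axioms(1)[OF module.axioms(2)[OF assms(2)], THEN abelian_monoid.l_zero]
  show "cring R" by fact
  show "abelian_group (pointwise_module I M)"
  proof (rule abelian_groupI)
    show "\<exists>y\<in>carrier (pointwise_module I M).
        y \<oplus>\<^bsub>pointwise_module I M\<^esub> x = \<zero>\<^bsub>pointwise_module I M\<^esub>"
      if x: "x \<in> carrier (pointwise_module I M)" for x
    proof
      show "(\<lambda>i\<in>I. \<ominus>\<^bsub>M i\<^esub> x i) \<in> carrier (pointwise_module I M)"
        using x abelian_group.a_inv_closed[OF module.axioms(2)[OF assms(2)]]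
        by (auto simp: pointwise_module_def PiE_iff)
      show "(\<lambda>i\<in>I. \<ominus>\<^bsub>M i\<^esub> x i) \<oplus>\<^bsub>pointwise_module I M\<^esub> x = \<zero>\<^bsub>pointwise_module I M\<^esub>"
        using x abelian_group.l_neg[OF module.axioms(2)[OF assms(2)]]
        by (auto simp: pointwise_module_def PiE_iff intro!: restrict_ext)
    qed
  qed (auto simp: pointwise_module_def PiE_iff extensional_def fun_eq_iff
      intro!: abelian_monoid.a_assoc abelian_monoid.a_comm
        abelian_group.axioms(1) module.axioms(2) assms(2))
qed (auto simp: pointwise_module_def PiE_iff extensional_def fun_eq_iff
    module.smult_closed[OF assms(2)] module.smult_one[OF assms(2)] 
    module.smult_l_distr[OF assms(2)] module.smult_r_distr[OF assms(2)] module.smult_assoc1[OF assms(2)])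

text \<open>Negation is multiplication by \<open>\<ominus> \<one>\<close>, so closure under
  negatives follows from closure under scalars.\<close>

lemma (in module) submoduleI_smult:
  assumes "H \<subseteq> carrier M" "\<zero>\<^bsub>M\<^esub> \<in> H"
    and "\<And>a b. a \<in> H \<Longrightarrow> b \<in> H \<Longrightarrow> a \<oplus>\<^bsub>M\<^esub> b \<in> H"
    and smult: "\<And>r x. r \<in> carrier R \<Longrightarrow> x \<in> H \<Longrightarrow> r \<odot>\<^bsub>M\<^esub> x \<in> H"
  shows "submodule H R M"
proof (rule submoduleI)
  show "\<ominus>\<^bsub>M\<^esub> a \<in> H" if "a \<in> H" for a
    using smult[of "\<ominus> \<one>" a] that assms(1) smult_l_minus[of \<one> a] by auto
qed (use assms in auto)

text \<open>Evaluation as a homomorphism is the device by which finite sums of functions are later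
  computed point by point, through \<open>mod_hom_finsum\<close>.\<close>

lemma pointwise_eval_hom:
  assumes "i \<in> I" "A \<subseteq> carrier (pointwise_module I M)"
  shows "(\<lambda>u. u i) \<in> mod_hom R ((pointwise_module I M)\<lparr>carrier := A\<rparr>) (M i)"
  using assms by (intro mod_homI) (auto simp: pointwise_module_def)

section \<open>Direct sums and homomorphisms out of them\<close>

lemma direct_sum_module_pointwise:
  "direct_sum_module I M =
     (pointwise_module I M)\<lparr>carrier :=
        {u \<in> \<Pi>\<^sub>E i\<in>I. carrier (M i). finite {i \<in> I. u i \<noteq> \<zero>\<^bsub>M i\<^esub>}}\<rparr>"
  by (simp add: direct_sum_module_def pointwise_module_def)

lemma finite_support_submodule:
  assumes "cring R" and M: "\<And>i. i \<in> I \<Longrightarrow> module R (M i)"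
  shows "submodule {u \<in> \<Pi>\<^sub>E i\<in>I. carrier (M i). finite {i \<in> I. u i \<noteq> \<zero>\<^bsub>M i\<^esub>}}
           R (pointwise_module I M)" (is "submodule ?A R ?P")
proof -
  interpret P: module R ?P
    by (rule module_pointwise_module) (use assms in auto)
  show ?thesis
  proof (rule P.submoduleI_smult)
    show "?A \<subseteq> carrier ?P"
      by (auto simp: pointwise_module_def)
    then have cl: "u \<in> ?A \<Longrightarrow> u \<in> carrier ?P" for u
      by blast
    have supp: "u \<in> ?A \<longleftrightarrow> u \<in> carrier ?P \<and> finite {i \<in> I. u i \<noteq> \<zero>\<^bsub>M i\<^esub>}" for u
      by (simp add: pointwise_module_def)
    have "finite {i \<in> I. \<zero>\<^bsub>?P\<^esub> i \<noteq> \<zero>\<^bsub>M i\<^esub>}"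
      by (rule finite_subset[of _ "{}"]) (auto simp: pointwise_module_def)
    then show "\<zero>\<^bsub>?P\<^esub> \<in> ?A"
      using supp P.zero_closed by blast
    show "u \<oplus>\<^bsub>?P\<^esub> v \<in> ?A" if u: "u \<in> ?A" and v: "v \<in> ?A" for u v
    proof -
      have "{i \<in> I. (u \<oplus>\<^bsub>?P\<^esub> v) i \<noteq> \<zero>\<^bsub>M i\<^esub>} \<subseteq> {i \<in> I. u i \<noteq> \<zero>\<^bsub>M i\<^esub>} \<union> {i \<in> I. v i \<noteq> \<zero>\<^bsub>M i\<^esub>}"
        using abelian_monoid.l_zero[OF abelian_group.axioms(1)[OF module.axioms(2)[OF M]]]
          abelian_monoid.zero_closed[OF abelian_group.axioms(1)[OF module.axioms(2)[OF M]]]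
        by (auto simp: pointwise_module_def)
      then have "finite {i \<in> I. (u \<oplus>\<^bsub>?P\<^esub> v) i \<noteq> \<zero>\<^bsub>M i\<^esub>}"
        using u v finite_subset by blast
      then show ?thesis
        using cl[OF u] cl[OF v] P.a_closed supp by blast
    qed
    show "r \<odot>\<^bsub>?P\<^esub> u \<in> ?A" if r: "r \<in> carrier R" and u: "u \<in> ?A" for r u
    proof -
      have "{i \<in> I. (r \<odot>\<^bsub>?P\<^esub> u) i \<noteq> \<zero>\<^bsub>M i\<^esub>} \<subseteq> {i \<in> I. u i \<noteq> \<zero>\<^bsub>M i\<^esub>}"
        using module.smult_r_null[OF M] r by (auto simp: pointwise_module_def)
      then have "finite {i \<in> I. (r \<odot>\<^bsub>?P\<^esub> u) i \<noteq> \<zero>\<^bsub>M i\<^esub>}"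
        using u finite_subset by blast
      then show ?thesis
        using cl[OF u] r P.smult_closed supp by blast
    qed
  qed
qed

lemma module_direct_sum_module:
  assumes "cring R" and "\<And>i. i \<in> I \<Longrightarrow> module R (M i)"
  shows "module R (direct_sum_module I M)"
  unfolding direct_sum_module_pointwise
  using assms by (intro submodule.submodule_is_module finite_support_submodule module_pointwise_module)

text \<open>The homomorphism given by the universal property of the direct sum. The sum runs over
  the support of \<open>u\<close> because \<open>finsum\<close> over an infinite index set is zero
  by convention.\<close>

definition direct_sum_lift ::
    "'i set \<Rightarrow> ('i \<Rightarrow> ('r, 'm) module) \<Rightarrow> ('r, 'n) module \<Rightarrow> ('i \<Rightarrow> 'm \<Rightarrow> 'n) \<Rightarrow> ('i \<Rightarrow> 'm) \<Rightarrow> 'n" where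
  "direct_sum_lift I N Q f u = (\<Oplus>\<^bsub>Q\<^esub>i\<in>{i \<in> I. u i \<noteq> \<zero>\<^bsub>N i\<^esub>}. f i (u i))"

text \<open>Terms outside the support vanish, so the support may be replaced by any larger finite
  set. This freedom is needed for additivity, since \<open>u\<close>, \<open>v\<close> and their sum
  have different supports.\<close>

lemma direct_sum_lift:
  fixes N :: "'i \<Rightarrow> ('r, 'm) module" and Q :: "('r, 'n) module"
  assumes cring: "cring R" and N: "\<And>i. i \<in> I \<Longrightarrow> module R (N i)" and Q: "module R Q"
    and f: "\<And>i. i \<in> I \<Longrightarrow> f i \<in> mod_hom R (N i) Q"
  shows direct_sum_lift_eq: "\<And>u J. u \<in> carrier (direct_sum_module I N) \<Longrightarrow> finite J \<Longrightarrow>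
      {i \<in> I. u i \<noteq> \<zero>\<^bsub>N i\<^esub>} \<subseteq> J \<Longrightarrow> J \<subseteq> I \<Longrightarrow> direct_sum_lift I N Q f u = (\<Oplus>\<^bsub>Q\<^esub>i\<in>J. f i (u i))"
    and direct_sum_lift_hom: "direct_sum_lift I N Q f \<in> mod_hom R (direct_sum_module I N) Q"
proof -
  interpret Q: module R Q by fact
  let ?S = "direct_sum_module I N"
  interpret S: module R ?S
    using cring N by (rule module_direct_sum_module)
  define supp where "supp u = {i \<in> I. u i \<noteq> \<zero>\<^bsub>N i\<^esub>}" for u :: "'i \<Rightarrow> 'm"
  let ?\<Phi> = "direct_sum_lift I N Q f"
  have \<Phi>_def: "?\<Phi> u = (\<Oplus>\<^bsub>Q\<^esub>i\<in>supp u. f i (u i))" for u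
    by (simp add: direct_sum_lift_def supp_def)
  have supp_fin: "finite (supp u)" and at: "i \<in> I \<Longrightarrow> u i \<in> carrier (N i)" if "u \<in> carrier ?S" for u i
    using that by (auto simp: direct_sum_module_def supp_def)
  have supp_sub: "supp u \<subseteq> I" for u
    by (auto simp: supp_def)
  have fcl: "i \<in> I \<Longrightarrow> x \<in> carrier (N i) \<Longrightarrow> f i x \<in> carrier Q" for i x
    using mod_hom_closed[OF f] .
  have f0: "i \<in> I \<Longrightarrow> f i \<zero>\<^bsub>N i\<^esub> = \<zero>\<^bsub>Q\<^esub>" for i
    by (rule mod_hom_zero[OF N Q f])
  have \<Phi>: "?\<Phi> u = (\<Oplus>\<^bsub>Q\<^esub>i\<in>J. f i (u i))"
    if u: "u \<in> carrier ?S" and J: "finite J" "supp u \<subseteq> J" "J \<subseteq> I" for u J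
    unfolding \<Phi>_def
  proof (rule Q.add.finprod_mono_neutral_cong_left)
    show "f i (u i) = \<zero>\<^bsub>Q\<^esub>" if "i \<in> J - supp u" for i
      using that J f0 by (auto simp: supp_def)
    show "(\<lambda>i. f i (u i)) \<in> J \<rightarrow> carrier Q"
      using J at[OF u] fcl by blast
  qed (use J in auto)
  then show "\<And>u J. u \<in> carrier ?S \<Longrightarrow> finite J \<Longrightarrow> {i \<in> I. u i \<noteq> \<zero>\<^bsub>N i\<^esub>} \<subseteq> J \<Longrightarrow> J \<subseteq> I \<Longrightarrow>
      ?\<Phi> u = (\<Oplus>\<^bsub>Q\<^esub>i\<in>J. f i (u i))"
    by (simp add: supp_def)
  show "?\<Phi> \<in> mod_hom R ?S Q"
  proof (rule mod_homI)
    show "?\<Phi> u \<in> carrier Q" if "u \<in> carrier ?S" for u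
      unfolding \<Phi>_def using supp_sub fcl at[OF that] by (intro Q.finsum_closed) blast
    show "?\<Phi> (u \<oplus>\<^bsub>?S\<^esub> v) = ?\<Phi> u \<oplus>\<^bsub>Q\<^esub> ?\<Phi> v" if u: "u \<in> carrier ?S" and v: "v \<in> carrier ?S" for u v
    proof -
      \<comment> \<open>Adding the support of the sum itself saves the proof that it is contained in
        the union of the other two.\<close>
      define J where "J = supp u \<union> supp v \<union> supp (u \<oplus>\<^bsub>?S\<^esub> v)"
      have J: "finite J" "J \<subseteq> I"
        using supp_fin[OF u] supp_fin[OF v] supp_fin[OF S.a_closed[OF u v]] supp_sub
        by (auto simp: J_def)
      have "?\<Phi> (u \<oplus>\<^bsub>?S\<^esub> v) = (\<Oplus>\<^bsub>Q\<^esub>i\<in>J. f i ((u \<oplus>\<^bsub>?S\<^esub> v) i))"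
        using J u v by (intro \<Phi>) (auto simp: J_def)
      also have "\<dots> = (\<Oplus>\<^bsub>Q\<^esub>i\<in>J. f i (u i) \<oplus>\<^bsub>Q\<^esub> f i (v i))"
        using J at[OF u] at[OF v] fcl mod_hom_add[OF f]
        by (intro Q.finsum_cong') (auto simp: direct_sum_module_def subset_iff)
      also have "\<dots> = (\<Oplus>\<^bsub>Q\<^esub>i\<in>J. f i (u i)) \<oplus>\<^bsub>Q\<^esub> (\<Oplus>\<^bsub>Q\<^esub>i\<in>J. f i (v i))"
        using J at[OF u] at[OF v] fcl by (intro Q.finsum_addf) blast+
      also have "\<dots> = ?\<Phi> u \<oplus>\<^bsub>Q\<^esub> ?\<Phi> v"
        using J u v by (subst (1 2) \<Phi>[of _ J]) (auto simp: J_def)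
      finally show ?thesis .
    qed
    show "?\<Phi> (a \<odot>\<^bsub>?S\<^esub> u) = a \<odot>\<^bsub>Q\<^esub> ?\<Phi> u" if a: "a \<in> carrier R" and u: "u \<in> carrier ?S" for a u
    proof -
      have sub: "supp (a \<odot>\<^bsub>?S\<^esub> u) \<subseteq> supp u"
        using a module.smult_r_null[OF N] by (auto simp: supp_def direct_sum_module_def)
      have "?\<Phi> (a \<odot>\<^bsub>?S\<^esub> u) = (\<Oplus>\<^bsub>Q\<^esub>i\<in>supp u. f i ((a \<odot>\<^bsub>?S\<^esub> u) i))"
        by (rule \<Phi>) (use sub u a supp_fin supp_sub in auto)
      also have "\<dots> = (\<Oplus>\<^bsub>Q\<^esub>i\<in>supp u. a \<odot>\<^bsub>Q\<^esub> f i (u i))"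
        using supp_sub[of u] at[OF u] fcl mod_hom_smult[OF f] a
        by (intro Q.finsum_cong') (auto simp: direct_sum_module_def subset_iff)
      also have "\<dots> = a \<odot>\<^bsub>Q\<^esub> ?\<Phi> u"
        unfolding \<Phi>_def using supp_sub[of u] at[OF u] fcl a supp_fin[OF u]
        by (intro Q.finsum_smult_ldistr[symmetric]) blast+
      finally show ?thesis .
    qed
  qed
qed

text \<open>The maps \<open>r j\<close> recover the coordinates of \<open>u\<close> from its image,
  which gives injectivity; \<open>span\<close> gives surjectivity. Only finite sums occur, so
  \<open>I\<close> may be infinite.\<close>

lemma direct_sum_iso:
  fixes N :: "'i \<Rightarrow> ('r, 'm) module" and Q :: "('r, 'n) module"
  assumes cring: "cring R" and N: "\<And>i. i \<in> I \<Longrightarrow> module R (N i)" and Q: "module R Q"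
    and f: "\<And>i. i \<in> I \<Longrightarrow> f i \<in> mod_hom R (N i) Q"
    and r: "\<And>i. i \<in> I \<Longrightarrow> r i \<in> mod_hom R Q (N i)"
    and rf: "\<And>i x. i \<in> I \<Longrightarrow> x \<in> carrier (N i) \<Longrightarrow> r i (f i x) = x"
    and rf0: "\<And>i j x. i \<in> I \<Longrightarrow> j \<in> I \<Longrightarrow> i \<noteq> j \<Longrightarrow> x \<in> carrier (N i) \<Longrightarrow> r j (f i x) = \<zero>\<^bsub>N j\<^esub>"
    and span: "\<And>z. z \<in> carrier Q \<Longrightarrow>
      \<exists>J v. finite J \<and> J \<subseteq> I \<and> (\<forall>j\<in>J. v j \<in> carrier (N j)) \<and> z = (\<Oplus>\<^bsub>Q\<^esub>j\<in>J. f j (v j))"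
  shows "\<exists>\<Phi>\<in>mod_iso R (direct_sum_module I N) Q.
           \<forall>i\<in>I. \<forall>x\<in>carrier (N i). \<Phi> (direct_sum_incl I N i x) = f i x"
proof -
  interpret Q: module R Q by fact
  let ?S = "direct_sum_module I N"
  define supp where "supp u = {i \<in> I. u i \<noteq> \<zero>\<^bsub>N i\<^esub>}" for u :: "'i \<Rightarrow> 'm"
  define \<Phi> where "\<Phi> = direct_sum_lift I N Q f"
  have supp_fin: "finite (supp u)" and at: "i \<in> I \<Longrightarrow> u i \<in> carrier (N i)" if "u \<in> carrier ?S" for u i
    using that by (auto simp: direct_sum_module_def supp_def)
  have supp_sub: "supp u \<subseteq> I" for u
    by (auto simp: supp_def)
  have fcl: "i \<in> I \<Longrightarrow> x \<in> carrier (N i) \<Longrightarrow> f i x \<in> carrier Q" for i x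
    using mod_hom_closed[OF f] .
  have \<Phi>: "\<Phi> u = (\<Oplus>\<^bsub>Q\<^esub>i\<in>J. f i (u i))"
    if "u \<in> carrier ?S" "finite J" "supp u \<subseteq> J" "J \<subseteq> I" for u J
    unfolding \<Phi>_def using direct_sum_lift_eq[OF cring N Q f] that by (simp add: supp_def)
  have hom: "\<Phi> \<in> mod_hom R ?S Q"
    unfolding \<Phi>_def by (rule direct_sum_lift_hom[OF cring N Q f])
  have r\<Phi>: "r j (\<Phi> u) = u j" if j: "j \<in> I" and u: "u \<in> carrier ?S" for j u
  proof -
    interpret Nj: module R "N j" using N[OF j] .
    \<comment> \<open>\<open>j\<close> is added so that the one surviving term is present even when
      \<open>u j\<close> is zero.\<close>
    have fin: "finite (insert j (supp u))" and sub: "insert j (supp u) \<subseteq> I"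
      using j supp_fin[OF u] supp_sub by auto
    have "r j (\<Phi> u) = r j (\<Oplus>\<^bsub>Q\<^esub>i\<in>insert j (supp u). f i (u i))"
      using \<Phi>[OF u fin subset_insertI sub] by simp
    also have "\<dots> = (\<Oplus>\<^bsub>N j\<^esub>i\<in>insert j (supp u). r j (f i (u i)))"
      by (rule mod_hom_finsum[OF Q N[OF j] r[OF j] fin]) (use sub at[OF u] fcl in blast)
    also have "\<dots> = (\<Oplus>\<^bsub>N j\<^esub>i\<in>insert j (supp u). if j = i then u j else \<zero>\<^bsub>N j\<^esub>)"
      using sub at[OF u] rf rf0 j
      by (intro Nj.finsum_cong') (auto simp: subset_iff)
    also have "\<dots> = u j"
      by (rule Nj.finsum_singleton[OF _ fin]) (use j at[OF u] in auto)
    finally show ?thesis .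
  qed
  have inj: "inj_on \<Phi> (carrier ?S)"
  proof (rule inj_onI)
    fix u v assume u: "u \<in> carrier ?S" and v: "v \<in> carrier ?S" and eq: "\<Phi> u = \<Phi> v"
    show "u = v"
    proof (rule extensionalityI[of _ I])
      show "u i = v i" if "i \<in> I" for i
        using r\<Phi>[OF that u] r\<Phi>[OF that v] eq by simp
    qed (use u v in \<open>auto simp: direct_sum_module_def PiE_iff\<close>)
  qed
  have "z \<in> \<Phi> ` carrier ?S" if z: "z \<in> carrier Q" for z
  proof -
    obtain J v where J: "finite J" "J \<subseteq> I" "\<forall>j\<in>J. v j \<in> carrier (N j)"
      and zJ: "z = (\<Oplus>\<^bsub>Q\<^esub>j\<in>J. f j (v j))"
      using span[OF z] by blast
    define u where "u = (\<lambda>i\<in>I. if i \<in> J then v i else \<zero>\<^bsub>N i\<^esub>)"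
    have sub: "supp u \<subseteq> J"
      by (auto simp: supp_def u_def)
    have uS: "u \<in> carrier ?S"
      using J finite_subset[OF sub J(1)] abelian_monoid.zero_closed[OF abelian_group.axioms(1)[OF module.axioms(2)[OF N]]]
      by (auto simp: direct_sum_module_def u_def supp_def)
    have "\<Phi> u = (\<Oplus>\<^bsub>Q\<^esub>i\<in>J. f i (u i))"
      by (rule \<Phi>[OF uS J(1) sub J(2)])
    also have "\<dots> = z"
      unfolding zJ using J fcl by (intro Q.finsum_cong') (auto simp: u_def)
    finally show ?thesis
      using uS by blast
  qed
  moreover have "\<Phi> ` carrier ?S \<subseteq> carrier Q"
    using mod_hom_closed[OF hom] by blast
  ultimately have iso: "\<Phi> \<in> mod_iso R ?S Q"
    using hom inj by (auto simp: mod_iso_def bij_betw_def)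
  moreover have "\<Phi> (direct_sum_incl I N i x) = f i x" if i: "i \<in> I" and x: "x \<in> carrier (N i)" for i x
  proof -
    let ?u = "direct_sum_incl I N i x"
    have sub: "supp ?u \<subseteq> {i}"
      by (auto simp: supp_def direct_sum_incl_def)
    have "?u \<in> carrier ?S"
      using i x finite_subset[OF sub] abelian_monoid.zero_closed[OF abelian_group.axioms(1)[OF module.axioms(2)[OF N]]]
      by (auto simp: direct_sum_module_def direct_sum_incl_def supp_def)
    then have "\<Phi> ?u = (\<Oplus>\<^bsub>Q\<^esub>j\<in>{i}. f j (?u j))"
      by (rule \<Phi>) (use sub i in auto)
    then show ?thesis
      using i x fcl by (simp add: direct_sum_incl_def)
  qed
  ultimately show ?thesis
    by blast
qed

section \<open>Quotient modules and maps between them\<close>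

lemma (in module) submodule_abelian_subgroup:
  assumes "submodule B R M"
  shows "abelian_subgroup B M"
  using assms by (intro abelian_subgroupI3 additive_subgroup.intro M.abelian_group_axioms)
    (simp add: submodule.axioms(1))

lemma (in module) submodule_coset_eq_iff:
  assumes B: "submodule B R M" and x: "x \<in> carrier M" and y: "y \<in> carrier M"
  shows "B +>\<^bsub>M\<^esub> x = B +>\<^bsub>M\<^esub> y \<longleftrightarrow> x \<ominus>\<^bsub>M\<^esub> y \<in> B"
proof -
  interpret B: abelian_subgroup B M
    by (rule submodule_abelian_subgroup[OF B])
  show ?thesis
    using B.a_rcos_module[OF y x] B.a_repr_independence'[OF _ y, of x] B.a_rcos_self[OF x]
    unfolding a_minus_def by auto
qed

lemma quotient_carrierE:
  assumes "c \<in> carrier (quotient_module M B)"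
  obtains x where "x \<in> carrier M" "c = B +>\<^bsub>M\<^esub> x"
  using assms by (auto simp: quotient_module_def A_RCOSETS_def')

lemma quotient_carrierI:
  "x \<in> carrier M \<Longrightarrow> B +>\<^bsub>M\<^esub> x \<in> carrier (quotient_module M B)"
  by (auto simp: quotient_module_def A_RCOSETS_def')

text \<open>Elements of one coset of \<open>B\<close> have images that differ by elements of
  \<open>B'\<close>. This justifies the unions over representatives in
  \<open>quotient_module\<close> and in \<open>homology_map\<close>: all cosets in such a union are
  equal.\<close>

lemma coset_image_const:
  fixes M :: "('r, 'm) module" and N :: "('r, 'n) module"
  assumes M: "module R M" and B: "submodule B R M" and x: "x \<in> carrier M"
    and N: "module R N" and h: "h \<in> mod_hom R M N" and B': "submodule B' R N" and hB: "h ` B \<subseteq> B'"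
  shows "(\<Union>u\<in>B +>\<^bsub>M\<^esub> x. B' +>\<^bsub>N\<^esub> h u) = B' +>\<^bsub>N\<^esub> h x"
proof -
  interpret module R M by fact
  interpret N: module R N by fact
  interpret B: abelian_subgroup B M
    by (rule submodule_abelian_subgroup[OF B])
  have "B' +>\<^bsub>N\<^esub> h u = B' +>\<^bsub>N\<^esub> h x" if u: "u \<in> B +>\<^bsub>M\<^esub> x" for u
  proof -
    have uM: "u \<in> carrier M"
      using u B.a_elemrcos_carrier[OF x] by blast
    have "u \<ominus>\<^bsub>M\<^esub> x \<in> B"
      using B.a_rcos_module[OF x uM] u by (simp add: a_minus_def)
    then have "h u \<ominus>\<^bsub>N\<^esub> h x \<in> B'"
      using hB mod_hom_minus[OF M N h uM x] by (metis image_subset_iff)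
    then show ?thesis
      using N.submodule_coset_eq_iff[OF B'] uM x mod_hom_closed[OF h] by blast
  qed
  then show ?thesis
    by (intro UN_constant_eq[OF B.a_rcos_self[OF x]]) blast
qed

text \<open>Multiplication by a fixed scalar is an endomorphism that preserves \<open>B\<close>, so
  \<open>coset_image_const\<close> computes it on representatives; the axioms then descend from
  \<open>M\<close>.\<close>

lemma quotient_module:
  fixes M :: "('r, 'm) module"
  assumes M: "module R M" and B: "submodule B R M"
  shows module_quotient_module: "module R (quotient_module M B)"
    and quotient_proj_hom: "(\<lambda>x. B +>\<^bsub>M\<^esub> x) \<in> mod_hom R M (quotient_module M B)"
proof -
  interpret module R M by fact
  interpret B: abelian_subgroup B M
    by (rule submodule_abelian_subgroup[OF B])
  let ?Q = "quotient_module M B"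
  have add: "(B +>\<^bsub>M\<^esub> x) \<oplus>\<^bsub>?Q\<^esub> (B +>\<^bsub>M\<^esub> y) = B +>\<^bsub>M\<^esub> (x \<oplus>\<^bsub>M\<^esub> y)"
    if "x \<in> carrier M" "y \<in> carrier M" for x y
    using B.a_rcos_sum[OF that] by (simp add: quotient_module_def)
  have smult: "r \<odot>\<^bsub>?Q\<^esub> (B +>\<^bsub>M\<^esub> x) = B +>\<^bsub>M\<^esub> (r \<odot>\<^bsub>M\<^esub> x)"
    if r: "r \<in> carrier R" and x: "x \<in> carrier M" for r x
  proof -
    have "(\<lambda>x. r \<odot>\<^bsub>M\<^esub> x) \<in> mod_hom R M M"
      using r by (intro mod_homI)
        (auto simp: smult_r_distr smult_assoc1[symmetric] R.m_comm)
    moreover have "(\<lambda>x. r \<odot>\<^bsub>M\<^esub> x) ` B \<subseteq> B"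
      using r submodule.smult_closed[OF B] by blast
    ultimately show ?thesis
      using coset_image_const[OF M B x M _ B] by (simp add: quotient_module_def)
  qed
  have zero: "\<zero>\<^bsub>?Q\<^esub> = B +>\<^bsub>M\<^esub> \<zero>\<^bsub>M\<^esub>"
    using B.a_subset by (simp add: quotient_module_def)
  have "abelian_group ?Q"
  proof (rule abelian_groupI)
    show "\<exists>d\<in>carrier ?Q. d \<oplus>\<^bsub>?Q\<^esub> c = \<zero>\<^bsub>?Q\<^esub>" if "c \<in> carrier ?Q" for c
      using that
    proof (rule quotient_carrierE)
      fix x assume x: "x \<in> carrier M" "c = B +>\<^bsub>M\<^esub> x"
      then have "(B +>\<^bsub>M\<^esub> \<ominus>\<^bsub>M\<^esub> x) \<oplus>\<^bsub>?Q\<^esub> c = \<zero>\<^bsub>?Q\<^esub>"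
        by (simp add: add zero M.l_neg)
      then show ?thesis
        using x(1) by (meson M.a_inv_closed quotient_carrierI)
    qed
  qed (auto elim!: quotient_carrierE simp: add zero M.a_ac intro!: quotient_carrierI)
  then show "module R ?Q"
  proof (intro moduleI R.is_cring)
  qed (auto elim!: quotient_carrierE simp: smult add smult_l_distr smult_r_distr smult_assoc1
      intro!: quotient_carrierI)
  show "(\<lambda>x. B +>\<^bsub>M\<^esub> x) \<in> mod_hom R M ?Q"
    by (rule mod_homI) (simp_all add: add smult quotient_carrierI)
qed

lemma quotient_map_hom:
  fixes M :: "('r, 'm) module" and N :: "('r, 'n) module"
  assumes M: "module R M" and B: "submodule B R M" and N: "module R N" and B': "submodule B' R N"
    and h: "h \<in> mod_hom R M N" and hB: "h ` B \<subseteq> B'"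
  shows "(\<lambda>c. \<Union>u\<in>c. B' +>\<^bsub>N\<^esub> h u) \<in> mod_hom R (quotient_module M B) (quotient_module N B')"
proof -
  note [simp] = coset_image_const[OF M B _ N h B' hB] mod_hom_closed[OF h]
  interpret module R M by fact
  note proj = quotient_proj_hom[OF M B] and proj' = quotient_proj_hom[OF N B']
  show ?thesis
  proof (rule mod_homI)
    fix c assume "c \<in> carrier (quotient_module M B)"
    then obtain x where x: "x \<in> carrier M" and c: "c = B +>\<^bsub>M\<^esub> x"
      by (rule quotient_carrierE)
    show "(\<Union>u\<in>c. B' +>\<^bsub>N\<^esub> h u) \<in> carrier (quotient_module N B')"
      using x by (simp add: c quotient_carrierI)
    show "(\<Union>u\<in>r \<odot>\<^bsub>quotient_module M B\<^esub> c. B' +>\<^bsub>N\<^esub> h u) =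
        r \<odot>\<^bsub>quotient_module N B'\<^esub> (\<Union>u\<in>c. B' +>\<^bsub>N\<^esub> h u)" if r: "r \<in> carrier R" for r
      using r x by (simp add: c mod_hom_smult[OF proj, symmetric] mod_hom_smult[OF proj', symmetric]
          mod_hom_smult[OF h] del: UN_simps)
    fix d assume "d \<in> carrier (quotient_module M B)"
    then obtain y where y: "y \<in> carrier M" and d: "d = B +>\<^bsub>M\<^esub> y"
      by (rule quotient_carrierE)
    show "(\<Union>u\<in>c \<oplus>\<^bsub>quotient_module M B\<^esub> d. B' +>\<^bsub>N\<^esub> h u) =
        (\<Union>u\<in>c. B' +>\<^bsub>N\<^esub> h u) \<oplus>\<^bsub>quotient_module N B'\<^esub> (\<Union>u\<in>d. B' +>\<^bsub>N\<^esub> h u)"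
      using x y by (simp add: c d mod_hom_add[OF proj, symmetric] mod_hom_add[OF proj', symmetric]
          mod_hom_add[OF h] del: UN_simps)
  qed
qed

text \<open>The form used for homology, with cycles modulo boundaries: the identities between
  \<open>f\<close> and \<open>r\<close> hold strictly on cycles, while \<open>span\<close> is asked
  for only modulo \<open>C\<close>.\<close>

lemma quotient_direct_sum_iso:
  fixes N :: "'i \<Rightarrow> ('r, 'm) module" and Q :: "('r, 'n) module"
  assumes cring: "cring R" and N: "\<And>i. i \<in> I \<Longrightarrow> module R (N i)" and Q: "module R Q"
    and B: "\<And>i. i \<in> I \<Longrightarrow> submodule (B i) R (N i)" and C: "submodule C R Q"
    and f: "\<And>i. i \<in> I \<Longrightarrow> f i \<in> mod_hom R (N i) Q" and fB: "\<And>i. i \<in> I \<Longrightarrow> f i ` B i \<subseteq> C"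
    and r: "\<And>i. i \<in> I \<Longrightarrow> r i \<in> mod_hom R Q (N i)" and rC: "\<And>i. i \<in> I \<Longrightarrow> r i ` C \<subseteq> B i"
    and rf: "\<And>i x. i \<in> I \<Longrightarrow> x \<in> carrier (N i) \<Longrightarrow> r i (f i x) = x"
    and rf0: "\<And>i j x. i \<in> I \<Longrightarrow> j \<in> I \<Longrightarrow> i \<noteq> j \<Longrightarrow> x \<in> carrier (N i) \<Longrightarrow> r j (f i x) = \<zero>\<^bsub>N j\<^esub>"
    and span: "\<And>z. z \<in> carrier Q \<Longrightarrow>
      \<exists>J v. finite J \<and> J \<subseteq> I \<and> (\<forall>j\<in>J. v j \<in> carrier (N j)) \<and> z \<ominus>\<^bsub>Q\<^esub> (\<Oplus>\<^bsub>Q\<^esub>j\<in>J. f j (v j)) \<in> C"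
  shows "\<exists>\<Phi>\<in>mod_iso R (direct_sum_module I (\<lambda>i. quotient_module (N i) (B i))) (quotient_module Q C).
           \<forall>i\<in>I. \<forall>c\<in>carrier (quotient_module (N i) (B i)).
             \<Phi> (direct_sum_incl I (\<lambda>i. quotient_module (N i) (B i)) i c) = (\<Union>u\<in>c. C +>\<^bsub>Q\<^esub> f i u)"
proof -
  interpret Q: module R Q by fact
  note f_coset = coset_image_const[OF N B _ Q f C fB]
  note r_coset = coset_image_const[OF Q C _ N r B rC]
  note fcl = mod_hom_closed[OF f]
  show ?thesis
  proof (rule direct_sum_iso[where r = "\<lambda>i c. \<Union>u\<in>c. B i +>\<^bsub>N i\<^esub> r i u"])
    show "cring R" by fact
    show "module R (quotient_module (N i) (B i))" if "i \<in> I" for i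
      using that by (intro module_quotient_module N B)
    show "module R (quotient_module Q C)"
      by (intro module_quotient_module Q C)
    show "(\<lambda>c. \<Union>u\<in>c. C +>\<^bsub>Q\<^esub> f i u) \<in> mod_hom R (quotient_module (N i) (B i)) (quotient_module Q C)"
      if "i \<in> I" for i
      using that by (intro quotient_map_hom N B Q C f fB)
    show "(\<lambda>c. \<Union>u\<in>c. B i +>\<^bsub>N i\<^esub> r i u) \<in> mod_hom R (quotient_module Q C) (quotient_module (N i) (B i))"
      if "i \<in> I" for i
      using that by (intro quotient_map_hom N B Q C r rC)
    show "(\<Union>u\<in>\<Union>u\<in>c. C +>\<^bsub>Q\<^esub> f i u. B i +>\<^bsub>N i\<^esub> r i u) = c"
      if i: "i \<in> I" and c: "c \<in> carrier (quotient_module (N i) (B i))" for i c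
    proof -
      obtain x where x: "x \<in> carrier (N i)" "c = B i +>\<^bsub>N i\<^esub> x"
        using quotient_carrierE[OF c] .
      show ?thesis
        unfolding x(2) f_coset[OF i i x(1) i i] r_coset[OF fcl[OF i x(1)] i i i i] rf[OF i x(1)] ..
    qed
    show "(\<Union>u\<in>\<Union>u\<in>c. C +>\<^bsub>Q\<^esub> f i u. B j +>\<^bsub>N j\<^esub> r j u) = \<zero>\<^bsub>quotient_module (N j) (B j)\<^esub>"
      if i: "i \<in> I" and j: "j \<in> I" and ij: "i \<noteq> j" and c: "c \<in> carrier (quotient_module (N i) (B i))" for i j c
    proof -
      obtain x where x: "x \<in> carrier (N i)" "c = B i +>\<^bsub>N i\<^esub> x"
        using quotient_carrierE[OF c] .
      show ?thesis
        unfolding x(2) f_coset[OF i i x(1) i i] r_coset[OF fcl[OF i x(1)] j j j j] rf0[OF i j ij x(1)]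
        by (rule mod_hom_zero[OF N module_quotient_module quotient_proj_hom]) (intro N B j)+
    qed
    show "\<exists>J v. finite J \<and> J \<subseteq> I \<and> (\<forall>j\<in>J. v j \<in> carrier (quotient_module (N j) (B j))) \<and>
        c = (\<Oplus>\<^bsub>quotient_module Q C\<^esub>j\<in>J. \<Union>u\<in>v j. C +>\<^bsub>Q\<^esub> f j u)"
      if c: "c \<in> carrier (quotient_module Q C)" for c
    proof -
      obtain z where z: "z \<in> carrier Q" "c = C +>\<^bsub>Q\<^esub> z"
        using quotient_carrierE[OF c] .
      obtain J v where J: "finite J" "J \<subseteq> I" and v: "\<forall>j\<in>J. v j \<in> carrier (N j)"
        and zv: "z \<ominus>\<^bsub>Q\<^esub> (\<Oplus>\<^bsub>Q\<^esub>j\<in>J. f j (v j)) \<in> C"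
        using span[OF z(1)] by blast
      have fv: "(\<lambda>j. f j (v j)) \<in> J \<rightarrow> carrier Q"
        using J v fcl by blast
      have "c = C +>\<^bsub>Q\<^esub> (\<Oplus>\<^bsub>Q\<^esub>j\<in>J. f j (v j))"
        using z zv Q.submodule_coset_eq_iff[OF C] fv by simp
      also have "\<dots> = (\<Oplus>\<^bsub>quotient_module Q C\<^esub>j\<in>J. C +>\<^bsub>Q\<^esub> f j (v j))"
        by (rule mod_hom_finsum[OF Q module_quotient_module[OF Q C] quotient_proj_hom[OF Q C] J(1) fv])
      also have "\<dots> = (\<Oplus>\<^bsub>quotient_module Q C\<^esub>j\<in>J. \<Union>u\<in>B j +>\<^bsub>N j\<^esub> v j. C +>\<^bsub>Q\<^esub> f j u)"
      proof (rule abelian_monoid.finsum_cong')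
        show "abelian_monoid (quotient_module Q C)"
          using module_quotient_module[OF Q C] by (simp add: module_def abelian_group_def)
        have eq: "(\<Union>u\<in>B j +>\<^bsub>N j\<^esub> v j. C +>\<^bsub>Q\<^esub> f j u) = C +>\<^bsub>Q\<^esub> f j (v j)" if "j \<in> J" for j
          using that J v f_coset[of j "v j"] by blast
        then show "C +>\<^bsub>Q\<^esub> f j (v j) = (\<Union>u\<in>B j +>\<^bsub>N j\<^esub> v j. C +>\<^bsub>Q\<^esub> f j u)" if "j \<in> J" for j
          using that by simp
        show "(\<lambda>j. \<Union>u\<in>B j +>\<^bsub>N j\<^esub> v j. C +>\<^bsub>Q\<^esub> f j u) \<in> J \<rightarrow> carrier (quotient_module Q C)"
          using eq fv by (auto intro!: quotient_carrierI)
      qed simp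
      finally show ?thesis
        using J v by (intro exI[of _ J] exI[of _ "\<lambda>j. B j +>\<^bsub>N j\<^esub> v j"]) (auto intro!: quotient_carrierI)
    qed
  qed
qed

section \<open>Coefficients along right translations of orbits\<close>

locale coefficients = group G for G :: "('g, 'k) monoid_scheme" (structure) +
  fixes R :: "('r, 'l) ring_scheme" and M :: "('g, 'r, 'm) coeff_system"
  assumes finite_group: "finite (carrier G)"
    and cring: "cring R"
    and coeff_system: "covariant_coeff_system G R M"
begin

text \<open>The condition under which \<open>orbit_map\<close> with index \<open>b\<close> is well
  defined. Indexing morphisms of orbits by group elements turns their composition into
  multiplication in \<open>G\<close>.\<close>

definition orbit_ok :: "'g set \<Rightarrow> 'g set \<Rightarrow> 'g \<Rightarrow> bool" where
  "orbit_ok H K b \<longleftrightarrow> b \<in> carrier G \<and> (\<forall>h\<in>H. inv b \<otimes> h \<otimes> b \<in> K)"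

definition orbit_coeff :: "'g set \<Rightarrow> 'g set \<Rightarrow> 'g \<Rightarrow> 'm \<Rightarrow> 'm" where
  "orbit_coeff H K b = map_at M H K (orbit_map G H K b)"

lemma l_coset_mult_mem:
  assumes "subgroup K G" "x \<in> carrier G" "k \<in> K"
  shows "(x \<otimes> k) <# K = x <# K"
  using assms by (metis coset_join3 lcos_m_assoc subgroup.mem_carrier subgroup.subset)

lemma lcosetsE:
  assumes "c \<in> lcosets H"
  obtains a where "a \<in> carrier G" "c = a <# H"
  using assms by (auto simp: LCOSETS_def)

lemma lcosetsI: "a \<in> carrier G \<Longrightarrow> a <# H \<in> lcosets H"
  by (auto simp: LCOSETS_def)

lemma finite_lcosets: "finite (lcosets H)"
  using finite_group by (simp add: LCOSETS_def)

text \<open>If c = ah with h in H, then cb = ab(\<open>inv b\<close> h b), and the last factor lies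
  in K; so all cosets in the union defining \<open>orbit_map\<close> coincide.\<close>

lemma orbit_map_coset:
  assumes H: "subgroup H G" and K: "subgroup K G" and b: "orbit_ok H K b" and a: "a \<in> carrier G"
  shows "orbit_map G H K b (a <# H) = (a \<otimes> b) <# K"
proof -
  have *: "(c \<otimes> b) <# K = (a \<otimes> b) <# K" if c: "c \<in> a <# H" for c
  proof -
    obtain h where h: "h \<in> H" "c = a \<otimes> h"
      using c by (auto simp: l_coset_def)
    have "h \<in> carrier G" "b \<in> carrier G"
      using h H b subgroup.mem_carrier by (auto simp: orbit_ok_def)
    then have "c \<otimes> b = (a \<otimes> b) \<otimes> (inv b \<otimes> h \<otimes> b)"
      using a h by (simp add: m_assoc[symmetric]) (simp add: m_assoc)
    then show ?thesis
      using l_coset_mult_mem[OF K, of "a \<otimes> b" "inv b \<otimes> h \<otimes> b"] b a h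
      by (simp add: orbit_ok_def)
  qed
  have "orbit_map G H K b (a <# H) = (\<Union>c\<in>a <# H. (c \<otimes> b) <# K)"
    using lcosetsI[OF a] by (simp add: orbit_map_def)
  also have "\<dots> = (a \<otimes> b) <# K"
    using * by (intro UN_constant_eq[OF lcos_self[OF a H]]) blast
  finally show ?thesis .
qed

lemma orbit_map_in_orbit_hom:
  assumes H: "subgroup H G" and K: "subgroup K G" and b: "orbit_ok H K b"
  shows "orbit_map G H K b \<in> orbit_hom G H K"
proof -
  have bc: "b \<in> carrier G"
    using b by (simp add: orbit_ok_def)
  have 1: "orbit_map G H K b c \<in> lcosets K" if "c \<in> lcosets H" for c
    using that orbit_map_coset[OF H K b] bc by (auto elim!: lcosetsE intro!: lcosetsI)
  have 2: "orbit_map G H K b (g <# c) = g <# orbit_map G H K b c"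
    if g: "g \<in> carrier G" and c: "c \<in> lcosets H" for g c
  proof -
    obtain a where a: "a \<in> carrier G" "c = a <# H"
      using c by (elim lcosetsE)
    then show ?thesis
      using orbit_map_coset[OF H K b] bc g subgroup.subset[OF H] subgroup.subset[OF K]
      by (simp add: lcos_m_assoc m_assoc)
  qed
  have "orbit_map G H K b \<in> extensional (lcosets H)"
    by (simp add: orbit_map_def)
  with 1 2 show ?thesis
    by (auto simp: orbit_hom_def PiE_def)
qed

lemma module_at: "subgroup H G \<Longrightarrow> module R (mod_at M H)"
  using coeff_system by (simp add: covariant_coeff_system_def)

lemma orbit_coeff_mod_hom:
  assumes "subgroup H G" "subgroup K G" "orbit_ok H K b"
  shows "orbit_coeff H K b \<in> mod_hom R (mod_at M H) (mod_at M K)"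
  using coeff_system assms orbit_map_in_orbit_hom[OF assms]
  by (simp add: covariant_coeff_system_def orbit_coeff_def)

lemma orbit_ok_comp:
  assumes "subgroup H G" "orbit_ok H K b" "orbit_ok K L b'"
  shows "orbit_ok H L (b \<otimes> b')"
proof -
  have "inv (b \<otimes> b') \<otimes> h \<otimes> (b \<otimes> b') = inv b' \<otimes> (inv b \<otimes> h \<otimes> b) \<otimes> b'" if "h \<in> H" for h
    using assms subgroup.mem_carrier[OF assms(1) that]
    by (simp add: orbit_ok_def inv_mult_group m_assoc)
  then show ?thesis
    using assms by (simp add: orbit_ok_def)
qed

text \<open>Right translation by b followed by right translation by b' is right translation by the
  product. Morphisms are extensional, so the two composites are equal as functions and functoriality
  of \<open>M\<close> applies.\<close>

lemma orbit_coeff_comp: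
  assumes H: "subgroup H G" and K: "subgroup K G" and L: "subgroup L G"
    and b: "orbit_ok H K b" and b': "orbit_ok K L b'" and l: "l \<in> carrier (mod_at M H)"
  shows "orbit_coeff K L b' (orbit_coeff H K b l) = orbit_coeff H L (b \<otimes> b') l"
proof -
  have "compose (lcosets H) (orbit_map G K L b') (orbit_map G H K b) = orbit_map G H L (b \<otimes> b')"
  proof
    fix c
    show "compose (lcosets H) (orbit_map G K L b') (orbit_map G H K b) c = orbit_map G H L (b \<otimes> b') c"
    proof (cases "c \<in> lcosets H")
      case True
      then obtain a where a: "a \<in> carrier G" "c = a <# H"
        by (elim lcosetsE)
      have "b \<in> carrier G" "b' \<in> carrier G"
        using b b' by (auto simp: orbit_ok_def)
      then show ?thesis
        using a True orbit_map_coset[OF H K b] orbit_map_coset[OF K L b']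
          orbit_map_coset[OF H L orbit_ok_comp[OF H b b']]
        by (simp add: compose_def m_assoc)
    qed (simp add: compose_def orbit_map_def)
  qed
  then show ?thesis
    using coeff_system H K L l orbit_map_in_orbit_hom[OF H K b] orbit_map_in_orbit_hom[OF K L b']
    unfolding covariant_coeff_system_def orbit_coeff_def by metis
qed

lemma orbit_ok_self: "subgroup H G \<Longrightarrow> b \<in> H \<Longrightarrow> orbit_ok H H b"
  by (simp add: orbit_ok_def subgroup.m_closed subgroup.m_inv_closed subgroup.mem_carrier)

lemma orbit_ok_one: "subgroup H G \<Longrightarrow> H \<subseteq> K \<Longrightarrow> orbit_ok H K \<one>"
  by (auto simp: orbit_ok_def subgroup.mem_carrier)

text \<open>Right translation by an element of H fixes every left coset of H, so it is the identity
  morphism of G/H. Hence elements of an isotropy group act trivially on the coefficients at their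
  point.\<close>

lemma orbit_coeff_id:
  assumes H: "subgroup H G" and b: "b \<in> H" and l: "l \<in> carrier (mod_at M H)"
  shows "orbit_coeff H H b l = l"
proof -
  have "orbit_map G H H b c = (\<lambda>c\<in>lcosets H. c) c" for c
  proof (cases "c \<in> lcosets H")
    case True
    then obtain a where a: "a \<in> carrier G" "c = a <# H"
      by (elim lcosetsE)
    then show ?thesis
      using True orbit_map_coset[OF H H orbit_ok_self[OF H b] a(1)] l_coset_mult_mem[OF H a(1) b]
      by simp
  qed (simp add: orbit_map_def)
  then have "orbit_map G H H b = (\<lambda>c\<in>lcosets H. c)"
    by blast
  then show ?thesis
    using coeff_system H l by (simp add: covariant_coeff_system_def orbit_coeff_def)
qed

end

section \<open>Functions with coefficients on a pointed G-set and the invariant ones among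
  them\<close>

lemma submodule_Collect:
  assumes M: "module R M" and H: "submodule H R M" and "P \<zero>\<^bsub>M\<^esub>"
    and "\<And>u v. u \<in> H \<Longrightarrow> v \<in> H \<Longrightarrow> P u \<Longrightarrow> P v \<Longrightarrow> P (u \<oplus>\<^bsub>M\<^esub> v)"
    and "\<And>r u. r \<in> carrier R \<Longrightarrow> u \<in> H \<Longrightarrow> P u \<Longrightarrow> P (r \<odot>\<^bsub>M\<^esub> u)"
  shows "submodule {u \<in> H. P u} R M"
proof -
  interpret module R M by fact
  show ?thesis
    using assms(3-) submoduleE[OF H] subgroup.one_closed[OF submodule.axioms(1)[OF H]]
    by (intro submoduleI_smult) auto
qed

lemma fun_module_pointwise:
  "fun_module G M S = (pointwise_module (points S) (coeff_at G M S))\<lparr>carrier := carrier (fun_module G M S)\<rparr>"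
  by (simp add: fun_module_def pointwise_module_def)

lemma fixed_module_pointwise:
  "fixed_module G M S = (pointwise_module (points S) (coeff_at G M S))\<lparr>carrier := carrier (fixed_module G M S)\<rparr>"
  by (simp add: fixed_module_def fun_module_def pointwise_module_def)

context coefficients
begin

context
  fixes S :: "('g, 's) pgset"
  assumes S: "pointed_gset G S"
begin

lemma gset_action: "group_action G (points S) (act S)"
  using S by (simp add: pointed_gset_def)

lemma gset_base: "basept S \<in> points S"
  using S by (simp add: pointed_gset_def)

lemma act_base: "g \<in> carrier G \<Longrightarrow> act S g (basept S) = basept S"
  using S by (simp add: pointed_gset_def)

lemma act_closed: "g \<in> carrier G \<Longrightarrow> x \<in> points S \<Longrightarrow> act S g x \<in> points S"
  using group_action.element_image[OF gset_action] by blast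

lemma act_mult:
  "g \<in> carrier G \<Longrightarrow> h \<in> carrier G \<Longrightarrow> x \<in> points S \<Longrightarrow> act S (g \<otimes> h) x = act S g (act S h x)"
  using group_action.composition_rule[OF gset_action] by blast

lemma act_one: "x \<in> points S \<Longrightarrow> act S \<one> x = x"
  using group_action.id_eq_one[OF gset_action] by (metis restrict_apply')

lemma act_inv: "g \<in> carrier G \<Longrightarrow> x \<in> points S \<Longrightarrow> act S (inv g) (act S g x) = x"
  using group_action.orbit_sym_aux[OF gset_action] by blast

lemma act_inv': "g \<in> carrier G \<Longrightarrow> x \<in> points S \<Longrightarrow> act S g (act S (inv g) x) = x"
  using act_inv[of "inv g" x] by simp

lemma act_eq_base: "g \<in> carrier G \<Longrightarrow> x \<in> points S \<Longrightarrow> act S g x = basept S \<longleftrightarrow> x = basept S"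
  by (metis act_base act_inv inv_closed)

lemma isotropy_subgroup: "x \<in> points S \<Longrightarrow> subgroup (isotropy G S x) G"
  using group_action.stabilizer_subgroup[OF gset_action] .

lemma isotropy_base: "isotropy G S (basept S) = carrier G"
  using act_base by (auto simp: stabilizer_def)

text \<open>If h fixes x, then the conjugate of h by g fixes gx.\<close>

lemma orbit_ok_translation:
  assumes g: "g \<in> carrier G" and x: "x \<in> points S"
  shows "orbit_ok (isotropy G S x) (isotropy G S (act S g x)) (inv g)"
proof -
  have "act S (inv (inv g) \<otimes> h \<otimes> inv g) (act S g x) = act S g x"
    if "h \<in> carrier G" "act S h x = x" for h
    using g x that by (simp add: act_mult act_closed act_inv)
  then show ?thesis
    using g by (auto simp: orbit_ok_def stabilizer_def)
qed

lemma transl_eq: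
  "transl G M S g x = orbit_coeff (isotropy G S x) (isotropy G S (act S g x)) (inv g)"
  by (simp add: transl_def orbit_coeff_def)

lemma transl_hom:
  "g \<in> carrier G \<Longrightarrow> x \<in> points S \<Longrightarrow>
     transl G M S g x \<in> mod_hom R (coeff_at G M S x) (coeff_at G M S (act S g x))"
  unfolding transl_eq
  by (intro orbit_coeff_mod_hom isotropy_subgroup act_closed orbit_ok_translation)

text \<open>The inverse of gh is the inverse of h times the inverse of g, which is the order in
  which right translations compose. The inverse in the index is what makes the translation of
  coefficients a left action.\<close>

lemma transl_mult:
  assumes g: "g \<in> carrier G" and h: "h \<in> carrier G" and x: "x \<in> points S"
    and l: "l \<in> carrier (coeff_at G M S x)"
  shows "transl G M S g (act S h x) (transl G M S h x l) = transl G M S (g \<otimes> h) x l"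
proof -
  have hx: "act S h x \<in> points S"
    by (rule act_closed[OF h x])
  have "transl G M S g (act S h x) (transl G M S h x l) =
      orbit_coeff (isotropy G S x) (isotropy G S (act S g (act S h x))) (inv h \<otimes> inv g) l"
    unfolding transl_eq
    by (intro orbit_coeff_comp isotropy_subgroup orbit_ok_translation act_closed g h x hx l)
  then show ?thesis
    using g h x by (simp add: transl_eq act_mult inv_mult_group)
qed

lemma transl_isotropy:
  assumes "h \<in> isotropy G S x" "x \<in> points S" "l \<in> carrier (coeff_at G M S x)"
  shows "transl G M S h x l = l"
proof -
  have "h \<in> carrier G" "act S h x = x"
    using assms(1) by (auto simp: stabilizer_def)
  then show ?thesis
    using orbit_coeff_id[OF isotropy_subgroup[OF assms(2)] _ assms(3), of "inv h"] assms
      subgroup.m_inv_closed[OF isotropy_subgroup[OF assms(2)] assms(1)]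
    by (simp add: transl_eq)
qed

text \<open>Two elements that move x to the same point differ on the right by an element of the
  isotropy group, which acts trivially on the coefficients at x. So \<open>gamma\<close> does not
  depend on the chosen representatives of cosets.\<close>

lemma transl_cong:
  assumes g: "g \<in> carrier G" and g': "g' \<in> carrier G" and x: "x \<in> points S"
    and l: "l \<in> carrier (coeff_at G M S x)" and eq: "act S g x = act S g' x"
  shows "transl G M S g x l = transl G M S g' x l"
proof -
  let ?k = "inv g \<otimes> g'"
  have kc: "?k \<in> carrier G" and gk: "g \<otimes> ?k = g'"
    using g g' by (simp_all add: m_assoc[symmetric])
  have kx: "act S ?k x = x"
    using g g' x eq[symmetric] by (simp add: act_mult act_inv)
  then have k: "?k \<in> isotropy G S x"
    using kc by (simp add: stabilizer_def)
  have "transl G M S g' x l = transl G M S g (act S ?k x) (transl G M S ?k x l)"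
    using transl_mult[OF g kc x l] unfolding gk by simp
  then show ?thesis
    unfolding kx transl_isotropy[OF k x l] by simp
qed

lemma module_coeff_at: "x \<in> points S \<Longrightarrow> module R (coeff_at G M S x)"
  by (intro module_at isotropy_subgroup)

lemma module_pointwise: "module R (pointwise_module (points S) (coeff_at G M S))"
  by (intro module_pointwise_module cring module_coeff_at)

lemma fun_module_submodule:
  "submodule (carrier (fun_module G M S)) R (pointwise_module (points S) (coeff_at G M S))"
    (is "submodule _ R ?P")
proof -
  have base: "module R (coeff_at G M S (basept S))"
    by (intro module_coeff_at gset_base)
  interpret B: module R "coeff_at G M S (basept S)" by (rule base)
  have eval: "(\<lambda>u. u (basept S)) \<in> mod_hom R ?P (coeff_at G M S (basept S))"
    using pointwise_eval_hom[OF gset_base subset_refl, where M = "coeff_at G M S" and R = R] by simp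
  have "carrier (fun_module G M S) =
      {u \<in> {u \<in> \<Pi>\<^sub>E x\<in>points S. carrier (coeff_at G M S x).
             finite {x \<in> points S. u x \<noteq> \<zero>\<^bsub>coeff_at G M S x\<^esub>}}.
         u (basept S) = \<zero>\<^bsub>coeff_at G M S (basept S)\<^esub>}"
    by (auto simp: fun_module_def)
  also have "submodule \<dots> R ?P"
  proof (rule submodule_Collect[OF module_pointwise finite_support_submodule[OF cring module_coeff_at]])
    show "\<zero>\<^bsub>?P\<^esub> (basept S) = \<zero>\<^bsub>coeff_at G M S (basept S)\<^esub>"
      by (rule mod_hom_zero[OF module_pointwise base eval])
  next
    fix u v assume "u \<in> {u \<in> \<Pi>\<^sub>E x\<in>points S. carrier (coeff_at G M S x).
             finite {x \<in> points S. u x \<noteq> \<zero>\<^bsub>coeff_at G M S x\<^esub>}}"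
      and "v \<in> {u \<in> \<Pi>\<^sub>E x\<in>points S. carrier (coeff_at G M S x).
             finite {x \<in> points S. u x \<noteq> \<zero>\<^bsub>coeff_at G M S x\<^esub>}}"
      and "u (basept S) = \<zero>\<^bsub>coeff_at G M S (basept S)\<^esub>"
      and "v (basept S) = \<zero>\<^bsub>coeff_at G M S (basept S)\<^esub>"
    then show "(u \<oplus>\<^bsub>?P\<^esub> v) (basept S) = \<zero>\<^bsub>coeff_at G M S (basept S)\<^esub>"
      using gset_base by (simp add: pointwise_module_def)
  next
    fix r u assume "r \<in> carrier R"
      and "u (basept S) = \<zero>\<^bsub>coeff_at G M S (basept S)\<^esub>"
    then show "(r \<odot>\<^bsub>?P\<^esub> u) (basept S) = \<zero>\<^bsub>coeff_at G M S (basept S)\<^esub>"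
      using gset_base by (simp add: pointwise_module_def)
  qed
  finally show ?thesis .
qed

lemma module_fun_module: "module R (fun_module G M S)"
  by (subst fun_module_pointwise)
    (intro submodule.submodule_is_module fun_module_submodule module_pointwise)

text \<open>Substituting gx for y removes the inverse in \<open>fun_act\<close>. Invariance then
  says that the value at one point determines the values on its whole orbit.\<close>

lemma fixed_module_carrier:
  "carrier (fixed_module G M S) =
     {u \<in> carrier (fun_module G M S).
        \<forall>g\<in>carrier G. \<forall>x\<in>points S. u (act S g x) = transl G M S g x (u x)}"
proof -
  have "(fun_act G M S g u = u) \<longleftrightarrow> (\<forall>x\<in>points S. u (act S g x) = transl G M S g x (u x))"
    if u: "u \<in> carrier (fun_module G M S)" and g: "g \<in> carrier G" for u g
  proof
    assume eq: "fun_act G M S g u = u"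
    show "\<forall>x\<in>points S. u (act S g x) = transl G M S g x (u x)"
    proof
      fix x assume x: "x \<in> points S"
      have "fun_act G M S g u (act S g x) = transl G M S g x (u x)"
        using g x by (simp add: fun_act_def act_closed act_inv Let_def)
      then show "u (act S g x) = transl G M S g x (u x)"
        unfolding eq .
    qed
  next
    assume eq: "\<forall>x\<in>points S. u (act S g x) = transl G M S g x (u x)"
    show "fun_act G M S g u = u"
    proof (rule extensionalityI[of _ "points S"])
      show "fun_act G M S g u y = u y" if y: "y \<in> points S" for y
        using eq[rule_format, of "act S (inv g) y"] g y
        by (simp add: fun_act_def act_closed act_inv' Let_def)
    qed (use u in \<open>auto simp: fun_act_def fun_module_def PiE_iff\<close>)
  qed
  then show ?thesis
    by (auto simp: fixed_module_def)
qed

lemma fixed_module_submodule: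
  "submodule (carrier (fixed_module G M S)) R (pointwise_module (points S) (coeff_at G M S))"
    (is "submodule _ R ?P")
  unfolding fixed_module_carrier
proof (rule submodule_Collect[OF module_pointwise fun_module_submodule])
  show "\<forall>g\<in>carrier G. \<forall>x\<in>points S. \<zero>\<^bsub>?P\<^esub> (act S g x) = transl G M S g x (\<zero>\<^bsub>?P\<^esub> x)"
    using mod_hom_zero[OF module_coeff_at module_coeff_at transl_hom]
    by (simp add: pointwise_module_def act_closed)
next
  have cl: "u x \<in> carrier (coeff_at G M S x)" if "u \<in> carrier (fun_module G M S)" "x \<in> points S" for u x
    using that by (auto simp: fun_module_def)
  show "\<forall>g\<in>carrier G. \<forall>x\<in>points S. (u \<oplus>\<^bsub>?P\<^esub> v) (act S g x) = transl G M S g x ((u \<oplus>\<^bsub>?P\<^esub> v) x)"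
    if "u \<in> carrier (fun_module G M S)" "v \<in> carrier (fun_module G M S)"
      "\<forall>g\<in>carrier G. \<forall>x\<in>points S. u (act S g x) = transl G M S g x (u x)"
      "\<forall>g\<in>carrier G. \<forall>x\<in>points S. v (act S g x) = transl G M S g x (v x)" for u v
    using that mod_hom_add[OF transl_hom] cl by (simp add: pointwise_module_def act_closed)
  show "\<forall>g\<in>carrier G. \<forall>x\<in>points S. (r \<odot>\<^bsub>?P\<^esub> u) (act S g x) = transl G M S g x ((r \<odot>\<^bsub>?P\<^esub> u) x)"
    if "r \<in> carrier R" "u \<in> carrier (fun_module G M S)"
      "\<forall>g\<in>carrier G. \<forall>x\<in>points S. u (act S g x) = transl G M S g x (u x)" for r u
    using that mod_hom_smult[OF transl_hom] cl by (simp add: pointwise_module_def act_closed)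
qed

lemma module_fixed_module: "module R (fixed_module G M S)"
  by (subst fixed_module_pointwise)
    (intro submodule.submodule_is_module fixed_module_submodule module_pointwise)

lemma fixed_eval_hom:
  assumes "x \<in> points S"
  shows "(\<lambda>u. u x) \<in> mod_hom R (fixed_module G M S) (coeff_at G M S x)"
  using pointwise_eval_hom[OF assms, of "carrier (fixed_module G M S)" "coeff_at G M S" R]
    module.submoduleE(1)[OF module_pointwise fixed_module_submodule]
  unfolding fixed_module_pointwise[symmetric] by blast

lemma fun_eval_hom:
  assumes "x \<in> points S"
  shows "(\<lambda>u. u x) \<in> mod_hom R (fun_module G M S) (coeff_at G M S x)"
  using pointwise_eval_hom[OF assms, of "carrier (fun_module G M S)" "coeff_at G M S" R]
    module.submoduleE(1)[OF module_pointwise fun_module_submodule]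
  unfolding fun_module_pointwise[symmetric] by blast

lemma fixed_eqI:
  assumes "u \<in> carrier (fixed_module G M S)" "v \<in> carrier (fixed_module G M S)"
    and "\<And>x. x \<in> points S \<Longrightarrow> u x = v x"
  shows "u = v"
  using assms by (intro extensionalityI[of u "points S"])
    (auto simp: fixed_module_carrier fun_module_def PiE_iff)

end

section \<open>The generators of the invariant functions\<close>

context
  fixes S :: "('g, 's) pgset"
  assumes S: "pointed_gset G S"
begin

interpretation Fun: module R "fun_module G M S"
  by (rule module_fun_module[OF S])

interpretation Fix: module R "fixed_module G M S"
  by (rule module_fixed_module[OF S])

lemma elem_closed:
  assumes x: "x \<in> points S" and l: "l \<in> carrier (coeff_at G M S x)"
  shows "elem G M S l x \<in> carrier (fun_module G M S)"
proof -
  have "\<zero>\<^bsub>coeff_at G M S y\<^esub> \<in> carrier (coeff_at G M S y)" if "y \<in> points S" for y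
    using module.axioms(2)[OF module_coeff_at[OF S that]] by (simp add: abelian_group_def abelian_monoid.zero_closed)
  moreover have "finite {y \<in> points S. elem G M S l x y \<noteq> \<zero>\<^bsub>coeff_at G M S y\<^esub>}"
    by (rule finite_subset[of _ "{x}"]) (auto simp: elem_def)
  ultimately show ?thesis
    using l gset_base[OF S] by (auto simp: fun_module_def elem_def)
qed

text \<open>Evaluation at a point turns the sum over cosets into a sum in a single coefficient
  module. Cosets of the isotropy group of x correspond to points of its orbit, so at most one
  summand is nonzero. The base point is separate because \<open>elem\<close> is zero there.\<close>

lemma gamma_closed_and_apply:
  assumes x: "x \<in> points S" and l: "l \<in> carrier (coeff_at G M S x)"
  shows gamma_fun_closed: "gamma G M S x l \<in> carrier (fun_module G M S)"
    and gamma_act: "\<And>g. g \<in> carrier G \<Longrightarrow> x \<noteq> basept S \<Longrightarrow> gamma G M S x l (act S g x) = transl G M S g x l"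
    and gamma_off: "\<And>y. y \<in> points S \<Longrightarrow> (\<And>g. g \<in> carrier G \<Longrightarrow> act S g x \<noteq> y) \<Longrightarrow>
      gamma G M S x l y = \<zero>\<^bsub>coeff_at G M S y\<^esub>"
    and gamma_at_base: "\<And>y. y \<in> points S \<Longrightarrow> x = basept S \<Longrightarrow> gamma G M S x l y = \<zero>\<^bsub>coeff_at G M S y\<^esub>"
proof -
  let ?H = "isotropy G S x"
  have H: "subgroup ?H G"
    by (rule isotropy_subgroup[OF S x])
  define r where "r c = (SOME g. g \<in> c)" for c :: "'g set"
  have r: "r (a <# ?H) \<in> carrier G \<and> act S (r (a <# ?H)) x = act S a x" if a: "a \<in> carrier G" for a
  proof -
    have "r (a <# ?H) \<in> a <# ?H"
      unfolding r_def using lcos_self[OF a H] by (rule someI)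
    then obtain h where h: "h \<in> ?H" "r (a <# ?H) = a \<otimes> h"
      by (auto simp: l_coset_def)
    then show ?thesis
      using a x by (auto simp: stabilizer_def act_mult[OF S])
  qed
  define t where "t c = elem G M S (transl G M S (r c) x l) (act S (r c) x)" for c
  have tcl: "t \<in> lcosets ?H \<rightarrow> carrier (fun_module G M S)"
  proof
    fix c assume "c \<in> lcosets ?H"
    then obtain a where "a \<in> carrier G" "c = a <# ?H"
      by (elim lcosetsE)
    then have rc: "r c \<in> carrier G"
      using r by blast
    show "t c \<in> carrier (fun_module G M S)"
      unfolding t_def by (intro elem_closed act_closed[OF S rc x] mod_hom_closed[OF transl_hom[OF S rc x] l])
  qed
  have gamma: "gamma G M S x l = (\<Oplus>\<^bsub>fun_module G M S\<^esub>c\<in>lcosets ?H. t c)"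
    by (simp add: gamma_def t_def r_def Let_def)
  show "gamma G M S x l \<in> carrier (fun_module G M S)"
    unfolding gamma using tcl by (rule Fun.finsum_closed)
  have eval: "gamma G M S x l y = (\<Oplus>\<^bsub>coeff_at G M S y\<^esub>c\<in>lcosets ?H. t c y)" if y: "y \<in> points S" for y
    unfolding gamma
    by (rule mod_hom_finsum[OF module_fun_module[OF S] module_coeff_at[OF S y] fun_eval_hom[OF S y]
          finite_lcosets tcl])
  have zero: "gamma G M S x l y = \<zero>\<^bsub>coeff_at G M S y\<^esub>"
    if y: "y \<in> points S" and 0: "\<And>c. c \<in> lcosets ?H \<Longrightarrow> t c y = \<zero>\<^bsub>coeff_at G M S y\<^esub>" for y
  proof -
    interpret C: module R "coeff_at G M S y" by (rule module_coeff_at[OF S y])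
    have "(\<Oplus>\<^bsub>coeff_at G M S y\<^esub>c\<in>lcosets ?H. t c y) = (\<Oplus>\<^bsub>coeff_at G M S y\<^esub>c\<in>lcosets ?H. \<zero>\<^bsub>coeff_at G M S y\<^esub>)"
      using 0 by (intro C.finsum_cong') auto
    then show ?thesis
      unfolding eval[OF y] by simp
  qed
  show "gamma G M S x l y = \<zero>\<^bsub>coeff_at G M S y\<^esub>"
    if y: "y \<in> points S" and off: "\<And>g. g \<in> carrier G \<Longrightarrow> act S g x \<noteq> y" for y
  proof (rule zero[OF y])
    fix c assume "c \<in> lcosets ?H"
    then obtain a where "a \<in> carrier G" "c = a <# ?H"
      by (elim lcosetsE)
    then show "t c y = \<zero>\<^bsub>coeff_at G M S y\<^esub>"
      using r[of a] off[of "r c"] y by (auto simp: t_def elem_def)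
  qed
  show "gamma G M S x l y = \<zero>\<^bsub>coeff_at G M S y\<^esub>" if y: "y \<in> points S" and base: "x = basept S" for y
  proof (rule zero[OF y])
    fix c assume "c \<in> lcosets ?H"
    then obtain a where "a \<in> carrier G" "c = a <# ?H"
      by (elim lcosetsE)
    then have "act S (r c) x = basept S"
      using r[of a] act_base[OF S] base by auto
    then show "t c y = \<zero>\<^bsub>coeff_at G M S y\<^esub>"
      using y by (simp add: t_def elem_def)
  qed
  show "gamma G M S x l (act S g x) = transl G M S g x l"
    if g: "g \<in> carrier G" and base: "x \<noteq> basept S" for g
  proof -
    let ?y = "act S g x"
    have y: "?y \<in> points S"
      by (rule act_closed[OF S g x])
    interpret C: module R "coeff_at G M S ?y" by (rule module_coeff_at[OF S y])
    let ?l = "transl G M S g x l"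
    have l': "?l \<in> carrier (coeff_at G M S ?y)"
      by (rule mod_hom_closed[OF transl_hom[OF S g x] l])
    have "t c ?y = (if g <# ?H = c then ?l else \<zero>\<^bsub>coeff_at G M S ?y\<^esub>)" if c: "c \<in> lcosets ?H" for c
    proof -
      obtain a where a: "a \<in> carrier G" "c = a <# ?H"
        using c by (elim lcosetsE)
      have ra: "r c \<in> carrier G" "act S (r c) x = act S a x"
        using r[OF a(1)] a(2) by auto
      show ?thesis
      proof (cases "act S a x = ?y")
        case True
        have k: "inv g \<otimes> a \<in> ?H"
          using True a g x act_inv[OF S g x] by (simp add: stabilizer_def act_mult[OF S])
        have "a = g \<otimes> (inv g \<otimes> a)"
          using a g by (simp add: m_assoc[symmetric])
        then have "c = g <# ?H"
          using l_coset_mult_mem[OF H g k] a(2) by simp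
        moreover have "transl G M S (r c) x l = ?l"
          using ra True by (intro transl_cong[OF S _ g x l]) simp_all
        moreover have "act S a x \<noteq> basept S"
          using act_eq_base[OF S a(1) x] base by simp
        ultimately show ?thesis
          using True ra y by (simp add: t_def elem_def)
      next
        case False
        then have "c \<noteq> g <# ?H"
          using r[OF g] ra by auto
        then show ?thesis
          using False ra y by (auto simp: t_def elem_def)
      qed
    qed
    then have "gamma G M S x l ?y =
        (\<Oplus>\<^bsub>coeff_at G M S ?y\<^esub>c\<in>lcosets ?H. if g <# ?H = c then ?l else \<zero>\<^bsub>coeff_at G M S ?y\<^esub>)"
      unfolding eval[OF y] using l' by (intro C.finsum_cong') auto
    also have "\<dots> = ?l"
      using lcosetsI[OF g] finite_lcosets l' by (intro C.finsum_singleton) auto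
    finally show ?thesis .
  qed
qed

lemma gamma_closed:
  assumes x: "x \<in> points S" and l: "l \<in> carrier (coeff_at G M S x)"
  shows "gamma G M S x l \<in> carrier (fixed_module G M S)"
proof -
  have "gamma G M S x l (act S g y) = transl G M S g y (gamma G M S x l y)"
    if g: "g \<in> carrier G" and y: "y \<in> points S" for g y
  proof (cases "x \<noteq> basept S \<and> (\<exists>h\<in>carrier G. act S h x = y)")
    case True
    then obtain h where h: "h \<in> carrier G" "act S h x = y" "x \<noteq> basept S"
      by blast
    then show ?thesis
      using gamma_act[OF x l h(1,3)] gamma_act[OF x l m_closed[OF g h(1)] h(3)]
        transl_mult[OF S g h(1) x l] g x by (simp add: act_mult[OF S])
  next
    case False
    have 0: "gamma G M S x l z = \<zero>\<^bsub>coeff_at G M S z\<^esub>"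
      if "z \<in> points S" "\<And>h. h \<in> carrier G \<Longrightarrow> act S h x = z \<Longrightarrow> x = basept S" for z
      using that gamma_at_base[OF x l that(1)] gamma_off[OF x l that(1)] by blast
    have "gamma G M S x l y = \<zero>\<^bsub>coeff_at G M S y\<^esub>"
      using False y by (intro 0) auto
    moreover have "gamma G M S x l (act S g y) = \<zero>\<^bsub>coeff_at G M S (act S g y)\<^esub>"
    proof (rule 0[OF act_closed[OF S g y]])
      fix h assume h: "h \<in> carrier G" "act S h x = act S g y"
      then have "act S (inv g \<otimes> h) x = y"
        using g x y by (simp add: act_mult[OF S] act_inv[OF S])
      then show "x = basept S"
        using False g h by blast
    qed
    ultimately show ?thesis
      using mod_hom_zero[OF module_coeff_at[OF S y] module_coeff_at[OF S act_closed[OF S g y]] transl_hom[OF S g y]]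
      by simp
  qed
  then show ?thesis
    using gamma_fun_closed[OF x l] by (simp add: fixed_module_carrier[OF S])
qed

text \<open>An invariant function is determined on an orbit by one value, so the value at x and
  vanishing off the orbit of x identify \<open>gamma\<close>; for the base point everything
  vanishes.\<close>

lemma gamma_eqI:
  assumes x: "x \<in> points S" and l: "l \<in> carrier (coeff_at G M S x)"
    and u: "u \<in> carrier (fixed_module G M S)"
    and ux: "x \<noteq> basept S \<Longrightarrow> u x = l"
    and off: "\<And>y. y \<in> points S \<Longrightarrow> (x = basept S \<or> (\<forall>g\<in>carrier G. act S g x \<noteq> y)) \<Longrightarrow> u y = \<zero>\<^bsub>coeff_at G M S y\<^esub>"
  shows "gamma G M S x l = u"
proof (rule fixed_eqI[OF S gamma_closed[OF x l] u])
  fix y assume y: "y \<in> points S"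
  show "gamma G M S x l y = u y"
  proof (cases "x \<noteq> basept S \<and> (\<exists>g\<in>carrier G. act S g x = y)")
    case True
    then obtain g where "g \<in> carrier G" "act S g x = y" "x \<noteq> basept S"
      by blast
    then show ?thesis
      using gamma_act[OF x l] ux u x by (auto simp: fixed_module_carrier[OF S])
  next
    case False
    then show ?thesis
      using off[OF y] gamma_at_base[OF x l y] gamma_off[OF x l y] by metis
  qed
qed

lemma gamma_self:
  assumes x: "x \<in> points S" and l: "l \<in> carrier (coeff_at G M S x)" and "x \<noteq> basept S"
  shows "gamma G M S x l x = l"
  using gamma_act[OF x l one_closed assms(3)] x l
    transl_isotropy[OF S subgroup.one_closed[OF isotropy_subgroup[OF S x]] x l]
  by (simp add: act_one[OF S])

lemma gamma_hom:
  assumes x: "x \<in> points S"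
  shows "gamma G M S x \<in> mod_hom R (coeff_at G M S x) (fixed_module G M S)"
proof -
  interpret C: module R "coeff_at G M S x" by (rule module_coeff_at[OF S x])
  note add = mod_hom_add[OF fixed_eval_hom[OF S]] and smult = mod_hom_smult[OF fixed_eval_hom[OF S]]
  have off: "gamma G M S x l y = \<zero>\<^bsub>coeff_at G M S y\<^esub>"
    if "y \<in> points S" "x = basept S \<or> (\<forall>g\<in>carrier G. act S g x \<noteq> y)" "l \<in> carrier (coeff_at G M S x)" for l y
    using that gamma_at_base[OF x that(3,1)] gamma_off[OF x that(3,1)] by blast
  show ?thesis
  proof (rule mod_homI)
    fix l l' assume l: "l \<in> carrier (coeff_at G M S x)" and l': "l' \<in> carrier (coeff_at G M S x)"
    show "gamma G M S x (l \<oplus>\<^bsub>coeff_at G M S x\<^esub> l') =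
        gamma G M S x l \<oplus>\<^bsub>fixed_module G M S\<^esub> gamma G M S x l'"
    proof (rule gamma_eqI)
      fix y assume y: "y \<in> points S" "x = basept S \<or> (\<forall>g\<in>carrier G. act S g x \<noteq> y)"
      interpret Cy: module R "coeff_at G M S y" by (rule module_coeff_at[OF S y(1)])
      show "(gamma G M S x l \<oplus>\<^bsub>fixed_module G M S\<^esub> gamma G M S x l') y = \<zero>\<^bsub>coeff_at G M S y\<^esub>"
        by (simp add: add[OF y(1)] gamma_closed x l l' off[OF y])
    qed (use x l l' gamma_closed in \<open>auto simp: add[OF x] gamma_self\<close>)
  next
    fix r l assume r: "r \<in> carrier R" and l: "l \<in> carrier (coeff_at G M S x)"
    show "gamma G M S x (r \<odot>\<^bsub>coeff_at G M S x\<^esub> l) = r \<odot>\<^bsub>fixed_module G M S\<^esub> gamma G M S x l"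
    proof (rule gamma_eqI)
      fix y assume y: "y \<in> points S" "x = basept S \<or> (\<forall>g\<in>carrier G. act S g x \<noteq> y)"
      interpret Cy: module R "coeff_at G M S y" by (rule module_coeff_at[OF S y(1)])
      show "(r \<odot>\<^bsub>fixed_module G M S\<^esub> gamma G M S x l) y = \<zero>\<^bsub>coeff_at G M S y\<^esub>"
        by (simp add: smult[OF y(1)] gamma_closed x r l off[OF y])
    qed (use x r l gamma_closed in \<open>auto simp: smult[OF x] gamma_self\<close>)
  qed (use x gamma_closed in auto)
qed

lemma gamma_base:
  assumes "l \<in> carrier (coeff_at G M S (basept S))"
  shows "gamma G M S (basept S) l = \<zero>\<^bsub>fixed_module G M S\<^esub>"
  using mod_hom_zero[OF module_fixed_module[OF S] module_coeff_at[OF S] fixed_eval_hom[OF S]]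
  by (intro gamma_eqI assms gset_base[OF S]) auto

text \<open>A generator depends on the orbit only, provided the coefficient is moved along with the
  point. This makes constructions by representatives of orbits compatible with the action.\<close>

lemma gamma_translate:
  assumes g: "g \<in> carrier G" and x: "x \<in> points S" and l: "l \<in> carrier (coeff_at G M S x)"
  shows "gamma G M S (act S g x) (transl G M S g x l) = gamma G M S x l"
proof (rule gamma_eqI[OF act_closed[OF S g x] mod_hom_closed[OF transl_hom[OF S g x] l] gamma_closed[OF x l]])
  show "gamma G M S x l (act S g x) = transl G M S g x l" if "act S g x \<noteq> basept S"
    using gamma_act[OF x l g] that act_eq_base[OF S g x] by blast
next
  fix y assume y: "y \<in> points S"
    and off: "act S g x = basept S \<or> (\<forall>h\<in>carrier G. act S h (act S g x) \<noteq> y)"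
  show "gamma G M S x l y = \<zero>\<^bsub>coeff_at G M S y\<^esub>"
  proof (cases "x = basept S")
    case False
    then have "act S h (act S g x) \<noteq> y" if "h \<in> carrier G" for h
      using off that act_eq_base[OF S g x] by blast
    then have "act S h x \<noteq> y" if "h \<in> carrier G" for h
      using that g x act_mult[OF S, of "h \<otimes> inv g" g x] by (metis inv_closed inv_solve_right m_closed)
    then show ?thesis
      by (rule gamma_off[OF x l y])
  qed (rule gamma_at_base[OF x l y])
qed

text \<open>Generation by the elements \<open>gamma\<close>, as an induction on the size of the
  support: subtracting the generator at a support point x with coefficient u(x) removes x from the
  support and adds no new point.\<close>

lemma fixed_induct [consumes 1, case_names zero gamma]:
  assumes u: "u \<in> carrier (fixed_module G M S)"
    and zero: "P \<zero>\<^bsub>fixed_module G M S\<^esub>"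
    and gamma: "\<And>x l v. x \<in> points S \<Longrightarrow> l \<in> carrier (coeff_at G M S x) \<Longrightarrow>
      v \<in> carrier (fixed_module G M S) \<Longrightarrow> P v \<Longrightarrow> P (gamma G M S x l \<oplus>\<^bsub>fixed_module G M S\<^esub> v)"
  shows "P u"
  using u
proof (induction "card {x \<in> points S. u x \<noteq> \<zero>\<^bsub>coeff_at G M S x\<^esub>}" arbitrary: u rule: less_induct)
  case less
  let ?supp = "\<lambda>u. {x \<in> points S. u x \<noteq> \<zero>\<^bsub>coeff_at G M S x\<^esub>}"
  have 0: "\<zero>\<^bsub>fixed_module G M S\<^esub> x = \<zero>\<^bsub>coeff_at G M S x\<^esub>" if "x \<in> points S" for x
    by (rule mod_hom_zero[OF module_fixed_module[OF S] module_coeff_at[OF S that] fixed_eval_hom[OF S that]])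
  show ?case
  proof (cases "?supp u = {}")
    case True
    then have "u = \<zero>\<^bsub>fixed_module G M S\<^esub>"
      using 0 by (intro fixed_eqI[OF S less.prems Fix.zero_closed]) auto
    then show ?thesis
      using zero by simp
  next
    case False
    then obtain x where x: "x \<in> points S" "u x \<noteq> \<zero>\<^bsub>coeff_at G M S x\<^esub>"
      by blast
    have u: "u \<in> carrier (fun_module G M S)"
      "\<And>g x. g \<in> carrier G \<Longrightarrow> x \<in> points S \<Longrightarrow> u (act S g x) = transl G M S g x (u x)"
      using less.prems by (auto simp: fixed_module_carrier[OF S])
    have l: "u x \<in> carrier (coeff_at G M S x)" and base: "x \<noteq> basept S" and fin: "finite (?supp u)"
      using u(1) x by (auto simp: fun_module_def)
    let ?g = "gamma G M S x (u x)"
    let ?v = "u \<ominus>\<^bsub>fixed_module G M S\<^esub> ?g"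
    have gc: "?g \<in> carrier (fixed_module G M S)"
      by (rule gamma_closed[OF x(1) l])
    have vc: "?v \<in> carrier (fixed_module G M S)"
      using gc less.prems by simp
    have v: "?v y = u y \<ominus>\<^bsub>coeff_at G M S y\<^esub> ?g y" if y: "y \<in> points S" for y
      by (rule mod_hom_minus[OF module_fixed_module[OF S] module_coeff_at[OF S y] fixed_eval_hom[OF S y] less.prems gc])
    have sub: "?supp ?v \<subseteq> ?supp u"
    proof
      fix y assume y: "y \<in> ?supp ?v"
      interpret C: module R "coeff_at G M S y" by (rule module_coeff_at[OF S]) (use y in simp)
      show "y \<in> ?supp u"
      proof (rule ccontr)
        assume "y \<notin> ?supp u"
        then have uy: "u y = \<zero>\<^bsub>coeff_at G M S y\<^esub>"
          using y by simp
        \<comment> \<open>If y were in the orbit of x, invariance would carry the zero value of u at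
          y back to x, where u is nonzero.\<close>
        have "act S g x \<noteq> y" if g: "g \<in> carrier G" for g
        proof
          assume gx: "act S g x = y"
          then have "u x = transl G M S (inv g) y (u y)"
            using u(2)[OF inv_closed[OF g], of y] act_inv[OF S g x(1)] y by simp
          also have "\<dots> = \<zero>\<^bsub>coeff_at G M S x\<^esub>"
            using mod_hom_zero[OF module_coeff_at[OF S] module_coeff_at[OF S] transl_hom[OF S inv_closed[OF g]], of y]
              act_closed[OF S inv_closed[OF g]] act_inv[OF S g x(1)] gx uy y by simp
          finally show False
            using x(2) by simp
        qed
        then have "?g y = \<zero>\<^bsub>coeff_at G M S y\<^esub>"
          using y by (intro gamma_off[OF x(1) l]) auto
        then show False
          using y v[of y] uy by (simp add: a_minus_def)
      qed
    qed
    moreover have "x \<notin> ?supp ?v"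
    proof -
      interpret C: module R "coeff_at G M S x" by (rule module_coeff_at[OF S x(1)])
      show ?thesis
        using v[OF x(1)] gamma_self[OF x(1) l base] l by (simp add: a_minus_def C.r_neg)
    qed
    ultimately have "?supp ?v \<subset> ?supp u"
      using x by blast
    then have "P ?v"
      using fin psubset_card_mono vc by (intro less.hyps) auto
    then have "P (?g \<oplus>\<^bsub>fixed_module G M S\<^esub> ?v)"
      by (rule gamma[OF x(1) l vc])
    moreover have "?g \<oplus>\<^bsub>fixed_module G M S\<^esub> ?v = u"
      using gc less.prems by (simp add: a_minus_def Fix.a_lcomm Fix.r_neg)
    ultimately show ?thesis
      by simp
  qed
qed

end

section \<open>From integral chains to invariant functions\<close>

definition fixed_points :: "('g, 't) pgset \<Rightarrow> 'g set \<Rightarrow> 't set" where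
  "fixed_points T H = {y \<in> points T. H \<subseteq> isotropy G T y}"

text \<open>\<open>orbit_coeff H K \<one>\<close> is \<open>M\<^sub>*\<close> of the projection \<open>G/H \<rightarrow> G/K\<close>. The chosen homomorphism is the
  only one, since the \<open>H\<close>-fixed points generate.\<close>

definition chain_gamma ::
    "('g, 't) pgset \<Rightarrow> 'g set \<Rightarrow> 'm \<Rightarrow> ('t \<Rightarrow>\<^sub>0 int) \<Rightarrow> 't \<Rightarrow> 'm" where
  "chain_gamma T H l =
     (SOME h. h \<in> hom (free_Abelian_group (fixed_points T H)) (add_monoid (fixed_module G M T)) \<and>
        (\<forall>y\<in>fixed_points T H. h (frag_of y) = gamma G M T y (orbit_coeff H (isotropy G T y) \<one> l)))"

context
  fixes T :: "('g, 't) pgset" and H :: "'g set"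
  assumes T: "pointed_gset G T" and H: "subgroup H G"
begin

interpretation Fix: module R "fixed_module G M T"
  by (rule module_fixed_module[OF T])

lemma fixed_pointsD:
  assumes "y \<in> fixed_points T H"
  shows "y \<in> points T" "orbit_ok H (isotropy G T y) \<one>"
  using assms orbit_ok_one[OF H] by (auto simp: fixed_points_def)

text \<open>The projection of G/H onto the orbit of y exists because H is contained in the isotropy
  group of y. It is the only way in which a coefficient at H is moved to y.\<close>

lemma projection_hom:
  assumes "y \<in> fixed_points T H"
  shows "orbit_coeff H (isotropy G T y) \<one> \<in> mod_hom R (mod_at M H) (coeff_at G M T y)"
  using assms by (intro orbit_coeff_mod_hom H isotropy_subgroup[OF T] fixed_pointsD)

context
  fixes l assumes l: "l \<in> carrier (mod_at M H)"
begin

lemma chain_gamma: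
  shows chain_gamma_hom:
      "chain_gamma T H l \<in> hom (free_Abelian_group (fixed_points T H)) (add_monoid (fixed_module G M T))"
    and chain_gamma_of:
      "\<And>y. y \<in> fixed_points T H \<Longrightarrow>
        chain_gamma T H l (frag_of y) = gamma G M T y (orbit_coeff H (isotropy G T y) \<one> l)"
proof -
  have "(\<lambda>y. gamma G M T y (orbit_coeff H (isotropy G T y) \<one> l)) ` fixed_points T H
      \<subseteq> carrier (add_monoid (fixed_module G M T))"
    using gamma_closed[OF T fixed_pointsD(1)] mod_hom_closed[OF projection_hom l] by auto
  then obtain h where "h \<in> hom (free_Abelian_group (fixed_points T H)) (add_monoid (fixed_module G M T))"
    "\<And>y. y \<in> fixed_points T H \<Longrightarrow> h (frag_of y) = gamma G M T y (orbit_coeff H (isotropy G T y) \<one> l)"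
    by (rule comm_group.free_Abelian_group_universal[OF Fix.M.a_comm_group]) blast
  then have "\<exists>h. h \<in> hom (free_Abelian_group (fixed_points T H)) (add_monoid (fixed_module G M T)) \<and>
        (\<forall>y\<in>fixed_points T H. h (frag_of y) = gamma G M T y (orbit_coeff H (isotropy G T y) \<one> l))"
    by blast
  from someI_ex[OF this] show
    "chain_gamma T H l \<in> hom (free_Abelian_group (fixed_points T H)) (add_monoid (fixed_module G M T))"
    "\<And>y. y \<in> fixed_points T H \<Longrightarrow>
        chain_gamma T H l (frag_of y) = gamma G M T y (orbit_coeff H (isotropy G T y) \<one> l)"
    by (auto simp: chain_gamma_def)
qed

lemma chain_gamma_closed:
  "Poly_Mapping.keys c \<subseteq> fixed_points T H \<Longrightarrow> chain_gamma T H l c \<in> carrier (fixed_module G M T)"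
  using hom_in_carrier[OF chain_gamma_hom, of c] by simp

lemma chain_gamma_add:
  assumes "Poly_Mapping.keys a \<subseteq> fixed_points T H" "Poly_Mapping.keys b \<subseteq> fixed_points T H"
  shows "chain_gamma T H l (a + b) = chain_gamma T H l a \<oplus>\<^bsub>fixed_module G M T\<^esub> chain_gamma T H l b"
  using hom_mult[OF chain_gamma_hom, of a b] assms by simp

lemma chain_gamma_diff:
  assumes a: "Poly_Mapping.keys a \<subseteq> fixed_points T H" and b: "Poly_Mapping.keys b \<subseteq> fixed_points T H"
  shows "chain_gamma T H l (a - b) = chain_gamma T H l a \<ominus>\<^bsub>fixed_module G M T\<^esub> chain_gamma T H l b"
proof -
  have ab: "Poly_Mapping.keys (a - b) \<subseteq> fixed_points T H"
    using keys_diff[of a b] a b by blast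
  note [simp] = chain_gamma_closed[OF a] chain_gamma_closed[OF b] chain_gamma_closed[OF ab]
  have "chain_gamma T H l a = chain_gamma T H l (a - b) \<oplus>\<^bsub>fixed_module G M T\<^esub> chain_gamma T H l b"
    using chain_gamma_add[OF ab b] by simp
  then show ?thesis
    by (simp add: a_minus_def Fix.a_assoc Fix.r_neg)
qed

lemma chain_gamma_0: "chain_gamma T H l 0 = \<zero>\<^bsub>fixed_module G M T\<^esub>"
  using chain_gamma_diff[of 0 0] chain_gamma_closed[of 0] by (simp add: a_minus_def Fix.r_neg)

lemma chain_gamma_sum:
  assumes "finite A" "\<And>i. i \<in> A \<Longrightarrow> Poly_Mapping.keys (f i) \<subseteq> fixed_points T H"
  shows "chain_gamma T H l (sum f A) = (\<Oplus>\<^bsub>fixed_module G M T\<^esub>i\<in>A. chain_gamma T H l (f i))"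
  using assms
proof (induction A)
  case (insert a A)
  have "Poly_Mapping.keys (sum f A) \<subseteq> fixed_points T H"
    using keys_sum[of f A] insert.prems by blast
  then show ?case
    using insert by (simp add: chain_gamma_add chain_gamma_closed)
qed (simp add: chain_gamma_0)

text \<open>Translates the integral signs of the singular boundary into the powers of
  \<open>\<ominus> \<one>\<close> in \<open>R\<close> that occur in
  \<open>gboundary\<close>.\<close>

lemma chain_gamma_sign:
  assumes "Poly_Mapping.keys c \<subseteq> fixed_points T H"
  shows "chain_gamma T H l (frag_cmul ((-1) ^ k) c) =
    ((\<ominus>\<^bsub>R\<^esub> \<one>\<^bsub>R\<^esub>) [^]\<^bsub>R\<^esub> k) \<odot>\<^bsub>fixed_module G M T\<^esub> chain_gamma T H l c"
proof (induction k)
  case 0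
  show ?case
    using chain_gamma_closed[OF assms] by simp
next
  case (Suc k)
  let ?c = "frag_cmul ((-1) ^ k) c"
  have keys: "Poly_Mapping.keys ?c \<subseteq> fixed_points T H"
    using assms keys_cmul[of "(-1) ^ k" c] by blast
  have "frag_cmul ((-1) ^ Suc k) c = 0 - ?c"
    by (simp add: frag_cmul_cmul[symmetric] del: frag_cmul_cmul)
  then have "chain_gamma T H l (frag_cmul ((-1) ^ Suc k) c) = \<ominus>\<^bsub>fixed_module G M T\<^esub> chain_gamma T H l ?c"
    using chain_gamma_diff[of 0 ?c] keys chain_gamma_closed[OF keys]
    by (simp add: chain_gamma_0 a_minus_def)
  also have "\<dots> = (\<ominus>\<^bsub>R\<^esub> \<one>\<^bsub>R\<^esub>) \<odot>\<^bsub>fixed_module G M T\<^esub> chain_gamma T H l ?c"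
    using chain_gamma_closed[OF keys] by (simp add: Fix.smult_l_minus)
  finally show ?case
    using chain_gamma_closed[OF assms]
    by (simp add: Suc.IH Fix.smult_assoc1[symmetric] Fix.R.m_comm)
qed

end

text \<open>Additivity in \<open>c\<close> holds by construction. Linearity in \<open>l\<close>
  holds on single points, where the map is a projection of coefficients followed by
  \<open>gamma\<close>, and passes to differences of chains.\<close>

lemma chain_gamma_linear:
  assumes "Poly_Mapping.keys c \<subseteq> fixed_points T H"
  shows "(\<lambda>l. chain_gamma T H l c) \<in> mod_hom R (mod_at M H) (fixed_module G M T)"
  using assms
proof (induction c rule: free_Abelian_group_induct[consumes 1, case_names zero diff of])
  interpret MH: module R "mod_at M H" by (rule module_at[OF H])
  case zero
  show ?case
    by (rule mod_homI) (simp_all add: chain_gamma_0)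
next
  interpret MH: module R "mod_at M H" by (rule module_at[OF H])
  case (diff a b)
  then show ?case
    by (intro mod_homI)
      (simp_all add: chain_gamma_diff chain_gamma_closed mod_hom_add[OF diff(3)] mod_hom_add[OF diff(4)]
        mod_hom_smult[OF diff(3)] mod_hom_smult[OF diff(4)] a_minus_def Fix.smult_r_distr Fix.smult_r_minus
        Fix.minus_add Fix.a_ac)
next
  interpret MH: module R "mod_at M H" by (rule module_at[OF H])
  case (of y)
  note hom = mod_hom_comp[OF projection_hom[OF of] gamma_hom[OF T fixed_pointsD(1)[OF of]]]
  show ?case
    by (intro mod_homI)
      (simp_all add: of chain_gamma_of mod_hom_closed[OF hom] mod_hom_add[OF hom] mod_hom_smult[OF hom])
qed

end

text \<open>Generators at the base point are zero. For singular chains this is the reduction: the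
  constant simplex at the base point contributes nothing.\<close>

lemma chain_gamma_base:
  assumes T: "pointed_gset G T" and H: "subgroup H G" and l: "l \<in> carrier (mod_at M H)"
    and c: "Poly_Mapping.keys c \<subseteq> {basept T}"
  shows "chain_gamma T H l c = \<zero>\<^bsub>fixed_module G M T\<^esub>"
proof -
  interpret Fix: module R "fixed_module G M T"
    by (rule module_fixed_module[OF T])
  have base: "basept T \<in> fixed_points T H"
    using gset_base[OF T] isotropy_base[OF T] subgroup.subset[OF H] by (simp add: fixed_points_def)
  show ?thesis
    using c
  proof (induction c rule: free_Abelian_group_induct[consumes 1, case_names zero diff of])
    case (diff a b)
    have "Poly_Mapping.keys a \<subseteq> fixed_points T H" "Poly_Mapping.keys b \<subseteq> fixed_points T H"
      using diff(1,2) base by blast+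
    then show ?case
      using diff(3,4) by (simp add: chain_gamma_diff[OF T H l] a_minus_def)
  next
    case (of y)
    then show ?case
      using base mod_hom_closed[OF projection_hom[OF T H base] l]
      by (simp add: chain_gamma_of[OF T H l] gamma_base[OF T])
  qed (simp add: chain_gamma_0[OF T H l])
qed

section \<open>Equivariant families of integral chains and the homomorphisms they induce\<close>

lemma fixed_points_translate:
  assumes S: "pointed_gset G S" and T: "pointed_gset G T"
    and g: "g \<in> carrier G" and x: "x \<in> points S"
    and y: "y \<in> fixed_points T (isotropy G S x)"
  shows "act T g y \<in> fixed_points T (isotropy G S (act S g x))"
proof -
  have yT: "y \<in> points T"
    using y by (simp add: fixed_points_def)
  have "act T h (act T g y) = act T g y" if h: "h \<in> carrier G" "act S h (act S g x) = act S g x" for h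
  proof -
    let ?k = "inv g \<otimes> (h \<otimes> g)"
    have "act S ?k x = x"
      using h g x by (simp add: act_mult[OF S] act_inv[OF S] act_closed[OF S])
    then have "?k \<in> isotropy G S x"
      using g h by (simp add: stabilizer_def)
    then have "?k \<in> isotropy G T y"
      using y by (auto simp: fixed_points_def)
    then have "act T ?k y = y"
      by (simp add: stabilizer_def)
    moreover have "g \<otimes> ?k = h \<otimes> g"
      using g h by (simp add: m_assoc[symmetric])
    ultimately show ?thesis
      using g h yT act_mult[OF T g, of ?k y] act_mult[OF T, of h g y] by simp
  qed
  then show ?thesis
    using act_closed[OF T g yT] by (auto simp: fixed_points_def stabilizer_def)
qed

text \<open>On a single point y the two sides are \<open>gamma\<close> at gy and at y. Translating
  the coefficient and then projecting, or projecting and then translating, is the same morphism of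
  orbits: both have index \<open>inv g\<close>. So \<open>gamma_translate\<close> applies.\<close>

lemma chain_gamma_translate:
  assumes S: "pointed_gset G S" and T: "pointed_gset G T"
    and g: "g \<in> carrier G" and x: "x \<in> points S" and l: "l \<in> carrier (coeff_at G M S x)"
    and c: "Poly_Mapping.keys c \<subseteq> fixed_points T (isotropy G S x)"
  shows "chain_gamma T (isotropy G S (act S g x)) (transl G M S g x l)
           (frag_extend (frag_of \<circ> act T g) c) = chain_gamma T (isotropy G S x) l c"
proof -
  have gx: "act S g x \<in> points S"
    by (rule act_closed[OF S g x])
  note H = isotropy_subgroup[OF S x] and H' = isotropy_subgroup[OF S gx]
  have l': "transl G M S g x l \<in> carrier (coeff_at G M S (act S g x))"
    by (rule mod_hom_closed[OF transl_hom[OF S g x] l])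
  have keys: "Poly_Mapping.keys (frag_extend (frag_of \<circ> act T g) c) \<subseteq> fixed_points T (isotropy G S (act S g x))"
    if "Poly_Mapping.keys c \<subseteq> fixed_points T (isotropy G S x)" for c
    using keys_frag_extend[of "frag_of \<circ> act T g" c] that fixed_points_translate[OF S T g x] by fastforce
  show ?thesis
    using c
  proof (induction c rule: free_Abelian_group_induct[consumes 1, case_names zero diff of])
    case zero
    show ?case
      by (simp add: chain_gamma_0[OF T H l] chain_gamma_0[OF T H' l'])
  next
    case (diff a b)
    then show ?case
      by (simp add: frag_extend_diff chain_gamma_diff[OF T H l] chain_gamma_diff[OF T H' l'] keys[unfolded comp_def] comp_def)
  next
    case (of y)
    note y = fixed_pointsD[OF T H of] and gy = fixed_pointsD[OF T H' fixed_points_translate[OF S T g x of]]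
    have "orbit_coeff (isotropy G S (act S g x)) (isotropy G T (act T g y)) \<one> (transl G M S g x l) =
        orbit_coeff (isotropy G S x) (isotropy G T (act T g y)) (inv g) l"
      using orbit_coeff_comp[OF H H' isotropy_subgroup[OF T gy(1)] orbit_ok_translation[OF S g x] gy(2) l] g
      by (simp add: transl_eq[OF S])
    also have "\<dots> = transl G M T g y (orbit_coeff (isotropy G S x) (isotropy G T y) \<one> l)"
      using orbit_coeff_comp[OF H isotropy_subgroup[OF T y(1)] isotropy_subgroup[OF T gy(1)] y(2)
          orbit_ok_translation[OF T g y(1)] l] g
      by (simp add: transl_eq[OF T])
    finally show ?case
      using gamma_translate[OF T g y(1) mod_hom_closed[OF projection_hom[OF T H of] l]]
      by (simp add: chain_gamma_of[OF T H l of] chain_gamma_of[OF T H' l' fixed_points_translate[OF S T g x of]])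
  qed
qed

text \<open>The keys have to be fixed by the isotropy group of the point; equivariance alone only makes
  the isotropy group permute them.\<close>

definition equivariant_chain :: "('g, 's) pgset \<Rightarrow> ('g, 't) pgset \<Rightarrow> ('s \<Rightarrow> 't \<Rightarrow>\<^sub>0 int) \<Rightarrow> bool" where
  "equivariant_chain S T \<phi> \<longleftrightarrow>
     (\<forall>x\<in>points S. Poly_Mapping.keys (\<phi> x) \<subseteq> fixed_points T (isotropy G S x)) \<and>
     (\<forall>g\<in>carrier G. \<forall>x\<in>points S. \<phi> (act S g x) = frag_extend (frag_of \<circ> act T g) (\<phi> x)) \<and>
     Poly_Mapping.keys (\<phi> (basept S)) \<subseteq> {basept T}"

text \<open>The choice depends only on the orbit as a set, hence it selects exactly one point of
  every orbit.\<close>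

definition orbit_reps :: "('g, 's) pgset \<Rightarrow> 's set" where
  "orbit_reps S = {x \<in> points S. x = (SOME z. z \<in> orbit G (act S) x)}"

text \<open>The formula that defines \<open>fixed_map\<close> on generators, with the point f(x)
  replaced by an integral chain. Summation over representatives counts every orbit once; summation
  over the whole support would multiply by the lengths of the orbits.\<close>

definition induced :: "('g, 's) pgset \<Rightarrow> ('g, 't) pgset \<Rightarrow> ('s \<Rightarrow> 't \<Rightarrow>\<^sub>0 int) \<Rightarrow> ('s \<Rightarrow> 'm) \<Rightarrow> 't \<Rightarrow> 'm" where
  "induced S T \<phi> u =
     direct_sum_lift (orbit_reps S) (coeff_at G M S) (fixed_module G M T)
       (\<lambda>x l. chain_gamma T (isotropy G S x) l (\<phi> x)) (restrict u (orbit_reps S))"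

lemma equivariant_chain_keys:
  "equivariant_chain S T \<phi> \<Longrightarrow> x \<in> points S \<Longrightarrow> Poly_Mapping.keys (\<phi> x) \<subseteq> fixed_points T (isotropy G S x)"
  by (simp add: equivariant_chain_def)

lemma orbit_reps_unique:
  assumes S: "pointed_gset G S" and x: "x \<in> points S"
  obtains g where "g \<in> carrier G" "act S g x \<in> orbit_reps S"
    "\<And>h. h \<in> carrier G \<Longrightarrow> act S h x \<in> orbit_reps S \<Longrightarrow> act S h x = act S g x"
proof -
  have orb: "orbit G (act S) (act S h x) = orbit G (act S) x" if h: "h \<in> carrier G" for h
  proof -
    have "act S g (act S h x) \<in> orbit G (act S) x" if "g \<in> carrier G" for g
      using that h x act_mult[OF S, of g h x] unfolding orbit_def by (metis (mono_tags) m_closed mem_Collect_eq)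
    moreover have "act S g x \<in> orbit G (act S) (act S h x)" if "g \<in> carrier G" for g
    proof -
      have "act S g x = act S (g \<otimes> inv h) (act S h x)"
        using that h x by (simp add: act_mult[OF S] act_inv[OF S] act_closed[OF S])
      then show ?thesis
        using that h unfolding orbit_def by blast
    qed
    ultimately show ?thesis
      unfolding orbit_def by blast
  qed
  have "x \<in> orbit G (act S) x"
    using act_one[OF S x] one_closed unfolding orbit_def by force
  then have "(SOME z. z \<in> orbit G (act S) x) \<in> orbit G (act S) x"
    by (rule someI)
  then obtain g where g: "g \<in> carrier G" "(SOME z. z \<in> orbit G (act S) x) = act S g x"
    unfolding orbit_def by auto
  show thesis
  proof (rule that[OF g(1)])
    show "act S g x \<in> orbit_reps S"
      using act_closed[OF S g(1) x] orb[OF g(1)] g(2) by (simp add: orbit_reps_def)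
    show "act S h x = act S g x" if "h \<in> carrier G" "act S h x \<in> orbit_reps S" for h
      using that orb[OF that(1)] g(2) by (simp add: orbit_reps_def)
  qed
qed

context
  fixes S :: "('g, 's) pgset" and T :: "('g, 't) pgset"
  assumes S: "pointed_gset G S" and T: "pointed_gset G T"
begin

lemma restrict_orbit_reps_hom:
  "(\<lambda>u. restrict u (orbit_reps S)) \<in>
     mod_hom R (fixed_module G M S) (direct_sum_module (orbit_reps S) (coeff_at G M S))"
proof -
  have sub: "orbit_reps S \<subseteq> points S"
    by (auto simp: orbit_reps_def)
  show ?thesis
  proof (rule mod_homI)
    fix u assume u: "u \<in> carrier (fixed_module G M S)"
    then have "finite {x \<in> points S. u x \<noteq> \<zero>\<^bsub>coeff_at G M S x\<^esub>}"
      and "\<And>x. x \<in> points S \<Longrightarrow> u x \<in> carrier (coeff_at G M S x)"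
      by (auto simp: fixed_module_carrier[OF S] fun_module_def)
    moreover have "{x \<in> orbit_reps S. restrict u (orbit_reps S) x \<noteq> \<zero>\<^bsub>coeff_at G M S x\<^esub>} \<subseteq>
        {x \<in> points S. u x \<noteq> \<zero>\<^bsub>coeff_at G M S x\<^esub>}"
      using sub by auto
    ultimately show "restrict u (orbit_reps S) \<in> carrier (direct_sum_module (orbit_reps S) (coeff_at G M S))"
      using sub finite_subset by (fastforce simp: direct_sum_module_def simp del: restrict_apply)
  qed (use sub in \<open>auto simp: direct_sum_module_def fixed_module_def fun_module_def fun_eq_iff subset_iff\<close>)
qed

context
  fixes \<phi> assumes \<phi>: "equivariant_chain S T \<phi>"
begin

lemma induced_summand_hom:
  "x \<in> points S \<Longrightarrow> (\<lambda>l. chain_gamma T (isotropy G S x) l (\<phi> x)) \<in> mod_hom R (coeff_at G M S x) (fixed_module G M T)"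
  by (intro chain_gamma_linear[OF T] isotropy_subgroup[OF S] equivariant_chain_keys[OF \<phi>])

lemma induced_hom: "induced S T \<phi> \<in> mod_hom R (fixed_module G M S) (fixed_module G M T)"
proof -
  have sub: "orbit_reps S \<subseteq> points S"
    by (auto simp: orbit_reps_def)
  show ?thesis
    unfolding induced_def
    by (rule mod_hom_comp[OF restrict_orbit_reps_hom direct_sum_lift_hom])
      (use cring module_coeff_at[OF S] module_fixed_module[OF T] induced_summand_hom sub in auto)
qed

text \<open>Away from the base point the only representative where the generator can be nonzero is
  some gx, and equivariance of the family moves its contribution back to x, so the choice of
  representatives disappears. At the base point both sides vanish, the right one because the keys
  there are the base point.\<close>

lemma induced_gamma:
  assumes x: "x \<in> points S" and l: "l \<in> carrier (coeff_at G M S x)"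
  shows "induced S T \<phi> (gamma G M S x l) = chain_gamma T (isotropy G S x) l (\<phi> x)"
proof (cases "x = basept S")
  case True
  have "chain_gamma T (isotropy G S x) l (\<phi> x) = \<zero>\<^bsub>fixed_module G M T\<^esub>"
    using \<phi> True by (intro chain_gamma_base[OF T isotropy_subgroup[OF S x] l]) (simp add: equivariant_chain_def)
  then show ?thesis
    using mod_hom_zero[OF module_fixed_module[OF S] module_fixed_module[OF T] induced_hom] True
      gamma_base[OF S] l by simp
next
  case False
  obtain g where g: "g \<in> carrier G" and gx: "act S g x \<in> orbit_reps S"
    and unique: "\<And>h. h \<in> carrier G \<Longrightarrow> act S h x \<in> orbit_reps S \<Longrightarrow> act S h x = act S g x"
    by (rule orbit_reps_unique[OF S x]) blast
  let ?u = "restrict (gamma G M S x l) (orbit_reps S)"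
  have sub: "orbit_reps S \<subseteq> points S"
    by (auto simp: orbit_reps_def)
  have gxS: "act S g x \<in> points S"
    using gx sub by blast
  have supp: "{y \<in> orbit_reps S. ?u y \<noteq> \<zero>\<^bsub>coeff_at G M S y\<^esub>} \<subseteq> {act S g x}"
  proof
    fix y assume "y \<in> {y \<in> orbit_reps S. ?u y \<noteq> \<zero>\<^bsub>coeff_at G M S y\<^esub>}"
    then have y: "y \<in> orbit_reps S" "gamma G M S x l y \<noteq> \<zero>\<^bsub>coeff_at G M S y\<^esub>"
      by auto
    then obtain h where "h \<in> carrier G" "act S h x = y"
      using gamma_off[OF S x l, of y] sub by blast
    then show "y \<in> {act S g x}"
      using unique y(1) by blast
  qed
  have u: "?u \<in> carrier (direct_sum_module (orbit_reps S) (coeff_at G M S))"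
    by (rule mod_hom_closed[OF restrict_orbit_reps_hom gamma_closed[OF S x l]])
  have l': "transl G M S g x l \<in> carrier (coeff_at G M S (act S g x))"
    by (rule mod_hom_closed[OF transl_hom[OF S g x] l])
  interpret Fix: module R "fixed_module G M T"
    by (rule module_fixed_module[OF T])
  have "induced S T \<phi> (gamma G M S x l) =
      (\<Oplus>\<^bsub>fixed_module G M T\<^esub>y\<in>{act S g x}. chain_gamma T (isotropy G S y) (?u y) (\<phi> y))"
    unfolding induced_def
    by (rule direct_sum_lift_eq[OF cring _ module_fixed_module[OF T] _ u _ supp])
      (use module_coeff_at[OF S] induced_summand_hom sub gx in auto)
  also have "\<dots> = chain_gamma T (isotropy G S (act S g x)) (transl G M S g x l) (\<phi> (act S g x))"
    using gx gamma_act[OF S x l g False] mod_hom_closed[OF induced_summand_hom[OF gxS] l'] by simp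
  also have "\<dots> = chain_gamma T (isotropy G S x) l (\<phi> x)"
    using chain_gamma_translate[OF S T g x l equivariant_chain_keys[OF \<phi> x]] \<phi> g x
    by (simp add: equivariant_chain_def)
  finally show ?thesis .
qed

end

end

section \<open>Functoriality of the induced homomorphisms\<close>

lemma fixed_hom_eqI:
  assumes S: "pointed_gset G S" and N: "module R N"
    and h: "h \<in> mod_hom R (fixed_module G M S) N" and k: "k \<in> mod_hom R (fixed_module G M S) N"
    and eq: "\<And>x l. x \<in> points S \<Longrightarrow> l \<in> carrier (coeff_at G M S x) \<Longrightarrow> h (gamma G M S x l) = k (gamma G M S x l)"
    and u: "u \<in> carrier (fixed_module G M S)"
  shows "h u = k u"
  using u
proof (induction u rule: fixed_induct[OF S, consumes 1, case_names zero gamma])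
  case zero
  show ?case
    by (simp add: mod_hom_zero[OF module_fixed_module[OF S] N h] mod_hom_zero[OF module_fixed_module[OF S] N k])
next
  case (gamma x l v)
  then show ?case
    by (simp add: mod_hom_add[OF h] mod_hom_add[OF k] gamma_closed[OF S] eq)
qed

text \<open>The isotropy group of x fixes each key y of the first chain, so it lies in the isotropy
  group of y, which fixes the keys of the second. Thus the condition on keys survives
  composition.\<close>

lemma equivariant_chain_comp:
  assumes S: "pointed_gset G S" and T: "pointed_gset G T" and U: "pointed_gset G U"
    and \<phi>: "equivariant_chain S T \<phi>" and \<psi>: "equivariant_chain T U \<psi>"
  shows "equivariant_chain S U (\<lambda>x. frag_extend \<psi> (\<phi> x))"
  unfolding equivariant_chain_def
proof (intro conjI ballI)
  fix x assume x: "x \<in> points S"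
  have "Poly_Mapping.keys (\<psi> y) \<subseteq> fixed_points U (isotropy G S x)" if "y \<in> Poly_Mapping.keys (\<phi> x)" for y
    using equivariant_chain_keys[OF \<phi> x] equivariant_chain_keys[OF \<psi>, of y] that
    by (auto simp: fixed_points_def)
  then show "Poly_Mapping.keys (frag_extend \<psi> (\<phi> x)) \<subseteq> fixed_points U (isotropy G S x)"
    using keys_frag_extend[of \<psi> "\<phi> x"] by blast
  fix g assume g: "g \<in> carrier G"
  have "frag_extend \<psi> (frag_extend (frag_of \<circ> act T g) c) = frag_extend (frag_of \<circ> act U g) (frag_extend \<psi> c)"
    if "Poly_Mapping.keys c \<subseteq> points T" for c
    using that
  proof (induction c rule: frag_induction)
    case (one y)
    then show ?case
      using \<psi> g by (simp add: equivariant_chain_def comp_def)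
  qed (simp_all add: frag_extend_diff)
  moreover have "Poly_Mapping.keys (\<phi> x) \<subseteq> points T"
    using equivariant_chain_keys[OF \<phi> x] by (auto simp: fixed_points_def)
  ultimately show "frag_extend \<psi> (\<phi> (act S g x)) = frag_extend (frag_of \<circ> act U g) (frag_extend \<psi> (\<phi> x))"
    using \<phi> g x by (simp add: equivariant_chain_def)
next
  show "Poly_Mapping.keys (frag_extend \<psi> (\<phi> (basept S))) \<subseteq> {basept U}"
    using keys_frag_extend[of \<psi> "\<phi> (basept S)"] \<phi> \<psi> unfolding equivariant_chain_def by blast
qed

lemma equivariant_chain_diff:
  assumes \<phi>: "equivariant_chain S T \<phi>" and \<psi>: "equivariant_chain S T \<psi>"
  shows "equivariant_chain S T (\<lambda>x. \<phi> x - \<psi> x)"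
  using \<phi> \<psi> unfolding equivariant_chain_def
  by (auto simp: frag_extend_diff dest!: subsetD[OF keys_diff])

text \<open>Functoriality on a single generator. By additivity \<open>c\<close> may be taken to be
  one point y, and then the value at y of the second family is again treated point by point.\<close>

lemma induced_chain_gamma:
  assumes T: "pointed_gset G T" and U: "pointed_gset G U" and \<psi>: "equivariant_chain T U \<psi>"
    and H: "subgroup H G" and l: "l \<in> carrier (mod_at M H)" and c: "Poly_Mapping.keys c \<subseteq> fixed_points T H"
  shows "induced T U \<psi> (chain_gamma T H l c) = chain_gamma U H l (frag_extend \<psi> c)"
proof -
  note hom = induced_hom[OF T U \<psi>]
  have keys: "Poly_Mapping.keys (frag_extend \<psi> c) \<subseteq> fixed_points U H"
    if "Poly_Mapping.keys c \<subseteq> fixed_points T H" for c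
  proof -
    have "Poly_Mapping.keys (\<psi> y) \<subseteq> fixed_points U H" if "y \<in> fixed_points T H" for y
      using that equivariant_chain_keys[OF \<psi>, of y] by (auto simp: fixed_points_def)
    then show ?thesis
      using keys_frag_extend[of \<psi> c] that by blast
  qed
  show ?thesis
    using c
  proof (induction c rule: free_Abelian_group_induct[consumes 1, case_names zero diff of])
    case zero
    show ?case
      by (simp add: chain_gamma_0[OF T H l] chain_gamma_0[OF U H l]
          mod_hom_zero[OF module_fixed_module[OF T] module_fixed_module[OF U] hom])
  next
    case (diff a b)
    then show ?case
      by (simp add: frag_extend_diff chain_gamma_diff[OF T H l] chain_gamma_diff[OF U H l] keys
          mod_hom_minus[OF module_fixed_module[OF T] module_fixed_module[OF U] hom] chain_gamma_closed[OF T H l])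
  next
    case (of y)
    note y = fixed_pointsD[OF T H of]
    let ?l = "orbit_coeff H (isotropy G T y) \<one> l"
    have l': "?l \<in> carrier (coeff_at G M T y)"
      by (rule mod_hom_closed[OF projection_hom[OF T H of] l])
    \<comment> \<open>The coefficient reaches a point z either through the orbit of y or directly
      from G/H; both ways are the projection onto the orbit of z.\<close>
    have "chain_gamma U (isotropy G T y) ?l c = chain_gamma U H l c"
      if "Poly_Mapping.keys c \<subseteq> fixed_points U (isotropy G T y)" for c
      using that
    proof (induction c rule: free_Abelian_group_induct[consumes 1, case_names zero diff of])
      case zero
      show ?case
        by (simp add: chain_gamma_0[OF U H l] chain_gamma_0[OF U isotropy_subgroup[OF T y(1)] l'])
    next
      case (diff a b)
      have sub: "fixed_points U (isotropy G T y) \<subseteq> fixed_points U H"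
        using of by (auto simp: fixed_points_def)
      show ?case
        using diff order_trans[OF diff(1) sub] order_trans[OF diff(2) sub]
        by (simp add: chain_gamma_diff[OF U H l] chain_gamma_diff[OF U isotropy_subgroup[OF T y(1)] l'])
    next
      case (of z)
      note Hy = isotropy_subgroup[OF T y(1)]
      note z = fixed_pointsD[OF U Hy of]
      have zH: "z \<in> fixed_points U H"
        using of \<open>y \<in> fixed_points T H\<close> by (auto simp: fixed_points_def)
      show ?case
        using orbit_coeff_comp[OF H Hy isotropy_subgroup[OF U z(1)] y(2) z(2) l]
        by (simp add: chain_gamma_of[OF U Hy l' of] chain_gamma_of[OF U H l zH])
    qed
    then show ?case
      using equivariant_chain_keys[OF \<psi> y(1)]
      by (simp add: chain_gamma_of[OF T H l of] induced_gamma[OF T U \<psi> y(1) l'])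
  qed
qed

lemma induced_comp:
  assumes S: "pointed_gset G S" and T: "pointed_gset G T" and U: "pointed_gset G U"
    and \<phi>: "equivariant_chain S T \<phi>" and \<psi>: "equivariant_chain T U \<psi>"
    and u: "u \<in> carrier (fixed_module G M S)"
  shows "induced T U \<psi> (induced S T \<phi> u) = induced S U (\<lambda>x. frag_extend \<psi> (\<phi> x)) u"
proof (rule fixed_hom_eqI[OF S module_fixed_module[OF U]
      mod_hom_comp[OF induced_hom[OF S T \<phi>] induced_hom[OF T U \<psi>]]
      induced_hom[OF S U equivariant_chain_comp[OF S T U \<phi> \<psi>]] _ u])
  fix x l assume x: "x \<in> points S" and l: "l \<in> carrier (coeff_at G M S x)"
  show "induced T U \<psi> (induced S T \<phi> (gamma G M S x l)) =
      induced S U (\<lambda>x. frag_extend \<psi> (\<phi> x)) (gamma G M S x l)"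
    unfolding induced_gamma[OF S T \<phi> x l] induced_gamma[OF S U equivariant_chain_comp[OF S T U \<phi> \<psi>] x l]
    by (rule induced_chain_gamma[OF T U \<psi> isotropy_subgroup[OF S x] l equivariant_chain_keys[OF \<phi> x]])
qed

text \<open>Identities between families have to be checked on the points of the G-set only. This
  matters because identities of singular chain operators are available only for continuous
  simplices.\<close>

lemma induced_cong:
  assumes S: "pointed_gset G S" and T: "pointed_gset G T"
    and \<phi>: "equivariant_chain S T \<phi>" and \<psi>: "equivariant_chain S T \<psi>"
    and eq: "\<And>x. x \<in> points S \<Longrightarrow> \<phi> x = \<psi> x" and u: "u \<in> carrier (fixed_module G M S)"
  shows "induced S T \<phi> u = induced S T \<psi> u"
  by (rule fixed_hom_eqI[OF S module_fixed_module[OF T] induced_hom[OF S T \<phi>] induced_hom[OF S T \<psi>] _ u])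
    (simp add: induced_gamma[OF S T \<phi>] induced_gamma[OF S T \<psi>] eq)

lemma induced_diff:
  assumes S: "pointed_gset G S" and T: "pointed_gset G T"
    and \<phi>: "equivariant_chain S T \<phi>" and \<psi>: "equivariant_chain S T \<psi>"
    and u: "u \<in> carrier (fixed_module G M S)"
  shows "induced S T (\<lambda>x. \<phi> x - \<psi> x) u = induced S T \<phi> u \<ominus>\<^bsub>fixed_module G M T\<^esub> induced S T \<psi> u"
proof -
  interpret Fix: module R "fixed_module G M T"
    by (rule module_fixed_module[OF T])
  note \<delta> = equivariant_chain_diff[OF \<phi> \<psi>]
  note hom = induced_hom[OF S T \<phi>] induced_hom[OF S T \<psi>] induced_hom[OF S T \<delta>]
  note [simp] = mod_hom_closed[OF hom(1)] mod_hom_closed[OF hom(2)] mod_hom_closed[OF hom(3)]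
  have "induced S T (\<lambda>x. \<phi> x - \<psi> x) u \<oplus>\<^bsub>fixed_module G M T\<^esub> induced S T \<psi> u = induced S T \<phi> u"
  proof (rule fixed_hom_eqI[OF S module_fixed_module[OF T] _ hom(1) _ u])
    show "(\<lambda>u. induced S T (\<lambda>x. \<phi> x - \<psi> x) u \<oplus>\<^bsub>fixed_module G M T\<^esub> induced S T \<psi> u)
        \<in> mod_hom R (fixed_module G M S) (fixed_module G M T)"
      by (rule mod_homI)
        (simp_all add: mod_hom_add[OF hom(2)] mod_hom_add[OF hom(3)] mod_hom_smult[OF hom(2)]
          mod_hom_smult[OF hom(3)] Fix.smult_r_distr Fix.a_ac)
    fix x l assume x: "x \<in> points S" and l: "l \<in> carrier (coeff_at G M S x)"
    note keys = equivariant_chain_keys[OF \<phi> x] equivariant_chain_keys[OF \<psi> x] equivariant_chain_keys[OF \<delta> x]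
    show "induced S T (\<lambda>x. \<phi> x - \<psi> x) (gamma G M S x l) \<oplus>\<^bsub>fixed_module G M T\<^esub> induced S T \<psi> (gamma G M S x l) =
        induced S T \<phi> (gamma G M S x l)"
      unfolding induced_gamma[OF S T \<phi> x l] induced_gamma[OF S T \<psi> x l] induced_gamma[OF S T \<delta> x l]
      using chain_gamma_add[OF T isotropy_subgroup[OF S x] l keys(3,2)] by simp
  qed
  then have "induced S T \<phi> u \<ominus>\<^bsub>fixed_module G M T\<^esub> induced S T \<psi> u =
      (induced S T (\<lambda>x. \<phi> x - \<psi> x) u \<oplus>\<^bsub>fixed_module G M T\<^esub> induced S T \<psi> u) \<ominus>\<^bsub>fixed_module G M T\<^esub> induced S T \<psi> u"
    by simp
  also have "\<dots> = induced S T (\<lambda>x. \<phi> x - \<psi> x) u"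
    using u by (simp add: a_minus_def Fix.a_assoc Fix.r_neg)
  finally show ?thesis ..
qed

lemma equivariant_chain_identity: "equivariant_chain S S frag_of"
  by (auto simp: equivariant_chain_def fixed_points_def)

lemma chain_gamma_self:
  assumes S: "pointed_gset G S" and x: "x \<in> points S" and l: "l \<in> carrier (coeff_at G M S x)"
  shows "chain_gamma S (isotropy G S x) l (frag_of x) = gamma G M S x l"
proof -
  note H = isotropy_subgroup[OF S x]
  have "x \<in> fixed_points S (isotropy G S x)"
    using x by (simp add: fixed_points_def)
  then show ?thesis
    using orbit_coeff_id[OF H subgroup.one_closed[OF H] l] by (simp add: chain_gamma_of[OF S H l])
qed

lemma induced_frag_of:
  assumes S: "pointed_gset G S" and u: "u \<in> carrier (fixed_module G M S)"
  shows "induced S S frag_of u = u"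
proof (rule fixed_hom_eqI[OF S module_fixed_module[OF S] induced_hom[OF S S equivariant_chain_identity] _ _ u])
  show "(\<lambda>u. u) \<in> mod_hom R (fixed_module G M S) (fixed_module G M S)"
    by (rule mod_homI) simp_all
qed (simp add: induced_gamma[OF S S equivariant_chain_identity] chain_gamma_self[OF S])

lemma equivariant_chain_map:
  assumes "\<And>x. x \<in> points S \<Longrightarrow> f x \<in> points T"
    and eq: "\<And>g x. g \<in> carrier G \<Longrightarrow> x \<in> points S \<Longrightarrow> f (act S g x) = act T g (f x)"
    and "f (basept S) = basept T"
  shows "equivariant_chain S T (\<lambda>x. frag_of (f x))"
proof -
  have "isotropy G S x \<subseteq> isotropy G T (f x)" if "x \<in> points S" for x
    using eq[OF _ that] by (force simp: stabilizer_def)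
  then show ?thesis
    using assms by (auto simp: equivariant_chain_def fixed_points_def)
qed

text \<open>Shows that the definite description in \<open>fixed_map\<close> denotes:
  \<open>induced\<close> gives existence and generation by \<open>gamma\<close> gives uniqueness.
  From here on maps of G-sets are treated as families with a single key of coefficient 1.\<close>

lemma fixed_map_eq_induced:
  assumes S: "pointed_gset G S" and T: "pointed_gset G T"
    and f: "\<And>x. x \<in> points S \<Longrightarrow> f x \<in> points T"
      "\<And>g x. g \<in> carrier G \<Longrightarrow> x \<in> points S \<Longrightarrow> f (act S g x) = act T g (f x)"
      "f (basept S) = basept T"
    and u: "u \<in> carrier (fixed_module G M S)"
  shows "fixed_map G R M S T f u = induced S T (\<lambda>x. frag_of (f x)) u"
proof -
  let ?P = "\<lambda>h. h \<in> mod_hom R (fixed_module G M S) (fixed_module G M T) \<and>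
        h \<in> extensional (carrier (fixed_module G M S)) \<and>
        (\<forall>x\<in>points S. \<forall>l\<in>carrier (coeff_at G M S x).
           h (gamma G M S x l) =
           gamma G M T (f x)
             (map_at M (isotropy G S x) (isotropy G T (f x))
                (orbit_map G (isotropy G S x) (isotropy G T (f x)) \<one>) l))"
  note ec = equivariant_chain_map[of S f T, OF f]
  note hom = induced_hom[OF S T ec]
  interpret Fix: module R "fixed_module G M S"
    by (rule module_fixed_module[OF S])
  \<comment> \<open>\<open>fixed_map\<close> asks for an extensional function, which
    \<open>induced\<close> need not be outside the invariant functions.\<close>
  define h where "h = restrict (induced S T (\<lambda>x. frag_of (f x))) (carrier (fixed_module G M S))"
  have "h \<in> mod_hom R (fixed_module G M S) (fixed_module G M T)"
    unfolding h_def
    by (rule mod_homI) (simp_all add: mod_hom_closed[OF hom] mod_hom_add[OF hom] mod_hom_smult[OF hom])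
  moreover have "h (gamma G M S x l) =
      gamma G M T (f x)
        (map_at M (isotropy G S x) (isotropy G T (f x))
           (orbit_map G (isotropy G S x) (isotropy G T (f x)) \<one>) l)"
    if x: "x \<in> points S" and l: "l \<in> carrier (coeff_at G M S x)" for x l
    using equivariant_chain_keys[OF ec x] gamma_closed[OF S x l]
    by (simp add: h_def induced_gamma[OF S T ec x l] chain_gamma_of[OF T isotropy_subgroup[OF S x] l] orbit_coeff_def)
  ultimately have Ph: "?P h"
    by (simp add: h_def)
  have uniq: "k = h" if k: "?P k" for k
  proof (rule extensionalityI[of _ "carrier (fixed_module G M S)"])
    fix v assume v: "v \<in> carrier (fixed_module G M S)"
    show "k v = h v"
      by (rule fixed_hom_eqI[OF S module_fixed_module[OF T] _ _ _ v]) (use k Ph in auto)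
  qed (use k Ph in auto)
  have "fixed_map G R M S T f = h"
    unfolding fixed_map_def by (rule the_equality[of ?P, OF Ph uniq])
  then show ?thesis
    using u by (simp add: h_def)
qed

end

section \<open>A natural chain homotopy between inclusion and iterated subdivision\<close>

abbreviation simplex_space :: "nat \<Rightarrow> (nat \<Rightarrow> real) topology" where
  "simplex_space p \<equiv> subtopology (powertop_real UNIV) (standard_simplex p)"

abbreviation prism_space :: "nat \<Rightarrow> ((nat \<Rightarrow> real) \<times> real) topology" where
  "prism_space p \<equiv> prod_topology (simplex_space p) (top_of_set {0..1})"

abbreviation identity_simplex :: "nat \<Rightarrow> (nat \<Rightarrow> real) chain" where
  "identity_simplex p \<equiv> frag_of (restrict id (standard_simplex p))"

lemma identity_simplex_chain: "singular_chain p (simplex_space p) (identity_simplex p)"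
  by (simp add: simplicial_imp_singular_simplex singular_chain_of)

lemma singular_simplex_continuous: "singular_simplex p X \<sigma> \<Longrightarrow> continuous_map (simplex_space p) X \<sigma>"
  by (simp add: singular_simplex_def)

lemma singular_chain_iterated_subdivision:
  "singular_chain p X c \<Longrightarrow> singular_chain p X ((singular_subdivision p ^^ n) c)"
  by (induction n) (auto simp: singular_chain_singular_subdivision)

lemma naturality_iterated_subdivision:
  assumes "singular_chain p X c"
  shows "(singular_subdivision p ^^ n) (chain_map p g c) = chain_map p g ((singular_subdivision p ^^ n) c)"
  using assms
  by (induction n)
    (auto simp: naturality_singular_subdivision[OF singular_chain_iterated_subdivision[OF assms]])

lemma boundary_iterated_subdivision:
  assumes "singular_chain p X c"
  shows "chain_boundary p ((singular_subdivision p ^^ n) c) =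
           (singular_subdivision (p - Suc 0) ^^ n) (chain_boundary p c)"
  using assms
  by (induction n)
    (auto simp: chain_boundary_singular_subdivision[OF singular_chain_iterated_subdivision[OF assms]])

lemma iterated_subdivision_zero:
  "singular_chain 0 X c \<Longrightarrow> (singular_subdivision 0 ^^ n) c = c"
  by (induction n) (auto simp: singular_subdivision_zero)

section \<open>Acyclicity of the prism over a simplex\<close>

lemma prism_space_contraction:
  assumes e: "e \<in> standard_simplex q"
  shows "homotopic_with (\<lambda>h. h \<in> {} \<rightarrow> {}) (prism_space q) (prism_space q) id (\<lambda>_. (e, 0))"
proof -
  \<comment> \<open>The straight-line contraction of the convex set \<Delta>^q x [0,1] to (e, 0).
    The vacuous condition on the empty set is the relative form in which homotopy invariance of
    homology is applied.\<close>
  let ?h = "\<lambda>(s, x, t). ((\<lambda>i. (1 - s) * x i + s * e i), (1 - s) * t) :: (nat \<Rightarrow> real) \<times> real"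
  let ?Z = "prod_topology (top_of_set {0..1::real}) (prism_space q)"
  have s: "continuous_map ?Z euclideanreal (\<lambda>z. fst z)"
    using continuous_map_fst[of "top_of_set {0..1::real}" "prism_space q"] continuous_map_into_fulltopology by blast
  have xt: "continuous_map ?Z (prism_space q) (\<lambda>z. snd z)"
    by (rule continuous_map_snd)
  have x: "continuous_map ?Z euclideanreal (\<lambda>z. fst (snd z) i)" for i
  proof -
    have "continuous_map ?Z (simplex_space q) (\<lambda>z. fst (snd z))"
      using continuous_map_compose[OF xt continuous_map_fst] by (simp add: comp_def)
    then show ?thesis
      using continuous_map_compose[OF _ continuous_map_product_projection[of i UNIV "\<lambda>_. euclideanreal"]]
      by (fastforce simp: comp_def continuous_map_in_subtopology)
  qed
  have t: "continuous_map ?Z euclideanreal (\<lambda>z. snd (snd z))"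
    using continuous_map_compose[OF xt continuous_map_snd] continuous_map_into_fulltopology
    by (fastforce simp: comp_def)
  have cont: "continuous_map ?Z (prod_topology (powertop_real UNIV) euclideanreal) ?h"
    unfolding case_prod_unfold continuous_map_pairwise comp_def continuous_map_componentwise_UNIV
    by (simp, intro conjI allI continuous_map_add continuous_map_real_mult continuous_map_diff s x t) auto
  have range: "?h z \<in> standard_simplex q \<times> {0..1}" if z: "z \<in> topspace ?Z" for z
  proof -
    obtain s x t where z': "z = (s, x, t)" "s \<in> {0..1}" "x \<in> standard_simplex q" "t \<in> {0..1}"
      using z by auto
    then show ?thesis
      using convex_standard_simplex[OF z'(3) e, of s] by (auto simp: mult_le_one)
  qed
  have "continuous_map ?Z
      (subtopology (prod_topology (powertop_real UNIV) euclideanreal) (standard_simplex q \<times> {0..1})) ?h"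
    unfolding continuous_map_in_subtopology using cont range by blast
  then have "continuous_map ?Z (prism_space q) ?h"
    by (simp only: subtopology_Times)
  then show ?thesis
    unfolding homotopic_with_def by (intro exI[of _ ?h]) auto
qed

text \<open>By the contraction a cycle is homologous to its image under a constant map, which is a
  cycle on a one-point space. Such a cycle bounds in positive degree, hence
  \<open>1 \<le> p\<close>; degree 0 is handled by \<open>prism_chain_0\<close>.\<close>

lemma prism_space_acyclic:
  assumes p: "1 \<le> p" and c: "singular_chain p (prism_space q) c" "chain_boundary p c = 0"
  shows "\<exists>d. singular_chain (Suc p) (prism_space q) d \<and> chain_boundary (Suc p) d = c"
proof -
  obtain e where e: "e \<in> standard_simplex q"
    using nonempty_standard_simplex by blast
  let ?k = "\<lambda>_::(nat \<Rightarrow> real) \<times> real. (e, 0::real)"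
  let ?pt = "subtopology (prism_space q) {(e, 0)}"
  have cyc: "singular_relcycle p (prism_space q) {} c"
    using c by (simp add: singular_cycle)
  have id: "chain_map p id c = c"
    using c(1) by (rule chain_map_ident)
  have hom: "homologous_rel p (prism_space q) {} c (chain_map p ?k c)"
    using homotopic_imp_homologous_rel_chain_maps[OF prism_space_contraction[OF e] cyc] by (simp add: id)
  have pt: "topspace ?pt = {(e, 0)}"
    using e by auto
  have "continuous_map (prism_space q) ?pt ?k"
    using e by (auto simp: continuous_map_in_subtopology)
  then have "singular_relcycle p ?pt {} (chain_map p ?k c)"
    by (auto intro: singular_relcycle_chain_map[OF cyc])
  then have "singular_relboundary p ?pt {} (chain_map p ?k c)"
    by (simp only: singular_boundary_eq_cycle_singleton[OF pt p])
  then have "singular_relboundary p (prism_space q) {} (chain_map p ?k c)"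
    using singular_boundary_mono[OF subset_UNIV] by (metis subtopology_UNIV)
  then have "singular_relboundary p (prism_space q) {} (c - chain_map p ?k c + chain_map p ?k c)"
    using hom by (intro singular_relboundary_add) (simp_all add: homologous_rel_def)
  then show ?thesis
    by (simp add: singular_boundary)
qed

section \<open>The prism operator and its boundary\<close>

definition prism ::
    "((nat \<Rightarrow> real) \<times> real) chain \<Rightarrow> ('a \<times> real \<Rightarrow> 'b) \<Rightarrow> nat \<Rightarrow> 'a chain \<Rightarrow> 'b chain" where
  "prism x D p c = frag_extend (\<lambda>\<sigma>. chain_map (Suc p) (\<lambda>(y, t). D (\<sigma> y, t)) x) c"

text \<open>The step of the acyclic models construction: \<open>x'\<close> and \<open>x\<close> are the values in degrees \<open>p - 1\<close> and
  \<open>p\<close> of a homotopy from the inclusion of the bottom to the subdivided inclusion of the top. The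
  homotopies of the library do not come with the naturality that is needed to make them
  equivariant.\<close>

definition prism_chain ::
    "nat \<Rightarrow> nat \<Rightarrow> ((nat \<Rightarrow> real) \<times> real) chain \<Rightarrow> ((nat \<Rightarrow> real) \<times> real) chain \<Rightarrow> bool" where
  "prism_chain n p x' x \<longleftrightarrow>
     singular_chain (Suc p) (prism_space p) x \<and>
     chain_boundary (Suc p) x =
       chain_map p (\<lambda>y. (y, 1)) ((singular_subdivision p ^^ n) (identity_simplex p)) -
       chain_map p (\<lambda>y. (y, 0)) (identity_simplex p) -
       prism x' id (p - 1) (chain_boundary p (identity_simplex p))"

lemma prism_0 [simp]: "prism x D p 0 = 0"
  by (simp add: prism_def)

lemma prism_diff: "prism x D p (a - b) = prism x D p a - prism x D p b"
  by (simp add: prism_def frag_extend_diff)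

lemma continuous_map_prism:
  assumes "continuous_map K X \<sigma>" and "continuous_map (prod_topology X (top_of_set {0..1::real})) Y D"
  shows "continuous_map (prod_topology K (top_of_set {0..1})) Y (\<lambda>(y, t). D (\<sigma> y, t))"
proof -
  have "continuous_map (prod_topology K (top_of_set {0..1})) (prod_topology X (top_of_set {0..1::real})) (\<lambda>(y, t). (\<sigma> y, t))"
    using assms(1) by (simp add: continuous_map_prod_top[where f = \<sigma> and g = "\<lambda>t. t"])
  from continuous_map_compose[OF this assms(2)] show ?thesis
    by (simp add: comp_def case_prod_unfold)
qed

lemma singular_chain_prism:
  assumes x: "singular_chain (Suc p) (prism_space p) x" and c: "singular_chain p X c"
    and D: "continuous_map (prod_topology X (top_of_set {0..1})) Y D"
  shows "singular_chain (Suc p) Y (prism x D p c)"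
  unfolding prism_def
proof (rule singular_chain_extend)
  fix \<sigma> assume "\<sigma> \<in> Poly_Mapping.keys c"
  then have "singular_simplex p X \<sigma>"
    using c by (auto simp: singular_chain_def)
  then show "singular_chain (Suc p) Y (chain_map (Suc p) (\<lambda>(y, t). D (\<sigma> y, t)) x)"
    by (intro singular_chain_chain_map[OF x] continuous_map_prism[OF singular_simplex_continuous D])
qed

text \<open>The defining equation on the identity simplex propagates to all chains by naturality.\<close>

lemma chain_boundary_prism:
  assumes x: "prism_chain n p x' x" and x': "0 < p \<Longrightarrow> singular_chain p (prism_space (p - 1)) x'"
    and D: "continuous_map (prod_topology X (top_of_set {0..1})) Y D"
    and c: "singular_chain p X c"
  shows "chain_boundary (Suc p) (prism x D p c) =
      chain_map p (\<lambda>y. D (y, 1)) ((singular_subdivision p ^^ n) c) -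
      chain_map p (\<lambda>y. D (y, 0)) c - prism x' D (p - 1) (chain_boundary p c)"
  using c unfolding singular_chain_def
proof (induction c rule: frag_induction)
  case zero
  show ?case
    by simp
next
  case (diff a b)
  then show ?case
    by (simp add: prism_diff chain_boundary_diff chain_map_diff singular_subdivision_power_diff)
next
  case (one \<sigma>)
  then have \<sigma>: "singular_simplex p X \<sigma>"
    by simp
  let ?\<iota> = "identity_simplex p"
  let ?h = "\<lambda>(y, t). D (\<sigma> y, t)"
  have \<iota>: "singular_chain p (simplex_space p) ?\<iota>"
    by (rule identity_simplex_chain)
  have \<sigma>\<iota>: "chain_map p \<sigma> ?\<iota> = frag_of \<sigma>"
    by (rule singular_simplex_chain_map_id[OF \<sigma>])
  have 1: "chain_map p ?h (chain_map p (\<lambda>y. (y, 1)) ((singular_subdivision p ^^ n) ?\<iota>)) =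
      chain_map p (\<lambda>y. D (y, 1)) ((singular_subdivision p ^^ n) (frag_of \<sigma>))"
  proof -
    have "chain_map p ?h (chain_map p (\<lambda>y. (y, 1)) d) = chain_map p (\<lambda>y. D (y, 1)) (chain_map p \<sigma> d)" for d
      unfolding chain_map_compose[THEN fun_cong, unfolded comp_apply, symmetric] by (simp add: comp_def)
    moreover have "chain_map p \<sigma> ((singular_subdivision p ^^ n) ?\<iota>) = (singular_subdivision p ^^ n) (frag_of \<sigma>)"
      using naturality_iterated_subdivision[OF \<iota>, of n \<sigma>] unfolding \<sigma>\<iota> ..
    ultimately show ?thesis
      by simp
  qed
  have 0: "chain_map p ?h (chain_map p (\<lambda>y. (y, 0)) ?\<iota>) = chain_map p (\<lambda>y. D (y, 0)) (frag_of \<sigma>)"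
    unfolding \<sigma>\<iota>[symmetric] chain_map_compose[THEN fun_cong, unfolded comp_apply, symmetric] by (simp add: comp_def)
  \<comment> \<open>Naturality of the prism operator one degree lower, applied to the faces of the
    identity simplex. In degree 0 both sides vanish with the boundary.\<close>
  have 2: "chain_map p ?h (prism x' id (p - 1) (chain_boundary p ?\<iota>)) = prism x' D (p - 1) (chain_boundary p (frag_of \<sigma>))"
  proof (cases "p = 0")
    case True
    then show ?thesis
      by (simp add: chain_boundary_def)
  next
    case False
    then have p: "Suc (p - Suc 0) = p"
      by simp
    have "chain_map p ?h (prism x' id (p - 1) d) = prism x' D (p - 1) (chain_map (p - 1) \<sigma> d)"
      if "singular_chain (p - 1) (simplex_space p) d" for d
      using that unfolding singular_chain_def
    proof (induction d rule: frag_induction)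
      case (one \<tau>)
      then have \<tau>: "singular_simplex (p - Suc 0) (simplex_space p) \<tau>"
        by simp
      have "chain_map p (\<lambda>z. ?h ((\<lambda>(y, t). (\<tau> y, t)) z)) x' =
          chain_map p (\<lambda>(y, t). D (simplex_map (p - Suc 0) \<sigma> \<tau> y, t)) x'"
        using x' False by (intro chain_map_eq[where X = "prism_space (p - 1)"]) (auto simp: simplex_map_def)
      then show ?case
        using p chain_map_compose[of p ?h "\<lambda>(y, t). (\<tau> y, t)"]
        by (simp add: prism_def comp_def fun_eq_iff)
    qed (auto simp: prism_diff chain_map_diff)
    then show ?thesis
      using chain_boundary_chain_map[OF \<iota>, of \<sigma>] singular_chain_boundary[OF \<iota>] \<sigma>\<iota> by simp
  qed
  \<comment> \<open>The prism over \<sigma> is the image of \<open>x\<close> under the map that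
    \<sigma> and \<open>D\<close> define on the model prism, so its boundary is the image of the
    equation defining \<open>x\<close>.\<close>
  have "chain_boundary (Suc p) (prism x D p (frag_of \<sigma>)) = chain_map p ?h (chain_boundary (Suc p) x)"
    using x chain_boundary_chain_map[of "Suc p" "prism_space p" x ?h] by (simp add: prism_def prism_chain_def)
  then show ?case
    using x 0 1 2 by (simp add: prism_chain_def chain_map_diff)
qed

section \<open>The universal prism chains, degree by degree\<close>

lemma continuous_map_end:
  "s \<in> {0..1} \<Longrightarrow> continuous_map X (prod_topology X (top_of_set {0..1::real})) (\<lambda>y. (y, s))"
  by (simp add: continuous_map_pairwise comp_def)

text \<open>In degree 0 subdivision is the identity and the lower term vanishes, so what is needed
  is that the top and bottom points of the prism are homologous, which the vertical path
  gives.\<close>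

lemma prism_chain_0: "\<exists>x. prism_chain n 0 x' x"
proof -
  let ?\<iota> = "identity_simplex 0"
  have \<iota>: "singular_chain 0 (simplex_space 0) ?\<iota>"
    by (rule identity_simplex_chain)
  then have cyc: "singular_relcycle 0 (simplex_space 0) {} ?\<iota>"
    by (simp add: singular_cycle chain_boundary_def)
  have "continuous_map (prod_topology (top_of_set {0..1::real}) (simplex_space 0)) (prism_space 0) (\<lambda>(t, y). (y, t))"
    using continuous_map_pairwise continuous_map_fst continuous_map_snd
    by (fastforce simp: comp_def case_prod_unfold)
  then have "homotopic_with (\<lambda>h. h \<in> {} \<rightarrow> {}) (simplex_space 0) (prism_space 0) (\<lambda>y. (y, 1)) (\<lambda>y. (y, 0))"
    \<comment> \<open>A homotopy has its first map at time 0, so the two ends are exchanged.\<close>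
    unfolding homotopic_with_sym[of _ _ _ "\<lambda>y. (y, 1)"] homotopic_with_def
    by (intro exI[of _ "\<lambda>(t, y). (y, t)"]) auto
  then have "homologous_rel 0 (prism_space 0) {} (chain_map 0 (\<lambda>y. (y, 1)) ?\<iota>) (chain_map 0 (\<lambda>y. (y, 0)) ?\<iota>)"
    using cyc by (rule homotopic_imp_homologous_rel_chain_maps)
  then show ?thesis
    by (simp add: homologous_rel_def singular_boundary prism_chain_def iterated_subdivision_zero[OF \<iota>]
        chain_boundary_def[of 0] )
qed

text \<open>The right side of the equation for the new chain is a cycle: by \<open>bd\<close>,
  applied to the boundary of the identity simplex, the boundary of its last term cancels that of the
  first two. Acyclicity then provides a chain that it bounds.\<close>

lemma prism_chain_Suc:
  assumes x: "singular_chain (Suc p) (prism_space p) x"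
    and bd: "\<And>c. singular_chain p (simplex_space (Suc p)) c \<Longrightarrow> chain_boundary p c = 0 \<Longrightarrow>
      chain_boundary (Suc p) (prism x id p c) =
      chain_map p (\<lambda>y. (y, 1)) ((singular_subdivision p ^^ n) c) - chain_map p (\<lambda>y. (y, 0)) c"
  shows "\<exists>y. prism_chain n (Suc p) x y"
proof -
  let ?\<iota> = "identity_simplex (Suc p)"
  have \<iota>: "singular_chain (Suc p) (simplex_space (Suc p)) ?\<iota>"
    by (rule identity_simplex_chain)
  have sd: "singular_chain (Suc p) (simplex_space (Suc p)) ((singular_subdivision (Suc p) ^^ n) ?\<iota>)"
    by (rule singular_chain_iterated_subdivision[OF \<iota>])
  have bd\<iota>: "singular_chain p (simplex_space (Suc p)) (chain_boundary (Suc p) ?\<iota>)"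
    using singular_chain_boundary_alt[OF \<iota>] .
  have bdbd: "chain_boundary p (chain_boundary (Suc p) ?\<iota>) = 0"
    using chain_boundary_boundary_alt[OF \<iota>] .
  let ?c = "chain_map (Suc p) (\<lambda>y. (y, 1)) ((singular_subdivision (Suc p) ^^ n) ?\<iota>) -
       chain_map (Suc p) (\<lambda>y. (y, 0)) ?\<iota> - prism x id p (chain_boundary (Suc p) ?\<iota>)"
  have "singular_chain (Suc p) (prism_space (Suc p)) ?c"
    by (intro singular_chain_diff singular_chain_chain_map[OF sd] singular_chain_chain_map[OF \<iota>]
        singular_chain_prism[OF x bd\<iota>] continuous_map_end continuous_map_id) auto
  moreover have "chain_boundary (Suc p) ?c = 0"
    using boundary_iterated_subdivision[OF \<iota>] bd[OF bd\<iota> bdbd]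
    by (simp add: chain_boundary_diff chain_boundary_chain_map[OF sd] chain_boundary_chain_map[OF \<iota>]
          del: chain_map_of)
  ultimately show ?thesis
    using prism_space_acyclic[of "Suc p"] by (simp add: prism_chain_def)
qed

text \<open>Dependent choice over the degree. The invariant \<open>?Q\<close> carries along the
  boundary formula for cycles on the next simplex, which the next step needs; for cycles the lower
  chain drops out, so \<open>?Q\<close> speaks of one chain only and the choice of
  \<open>P (Suc p)\<close> depends on \<open>P p\<close> alone.\<close>

lemma prism_chains_exist: "\<exists>P. \<forall>p. prism_chain n p (P (p - 1)) (P p)"
proof -
  let ?Q = "\<lambda>p x. (p = 0 \<longrightarrow> prism_chain n 0 0 x) \<and> singular_chain (Suc p) (prism_space p) x \<and>
    (\<forall>c. singular_chain p (simplex_space (Suc p)) c \<longrightarrow> chain_boundary p c = 0 \<longrightarrow>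
      chain_boundary (Suc p) (prism x id p c) =
      chain_map p (\<lambda>y. (y, 1)) ((singular_subdivision p ^^ n) c) - chain_map p (\<lambda>y. (y, 0)) c)"
  have Q: "?Q p x" if that1: "prism_chain n p x' x" and that0: "0 < p \<Longrightarrow> singular_chain p (prism_space (p - 1)) x'"
    and that3: "p = 0 \<Longrightarrow> x' = 0" for p x x'
  proof -
    have "chain_boundary (Suc p) (prism x id p c) =
        chain_map p (\<lambda>y. (y, 1)) ((singular_subdivision p ^^ n) c) - chain_map p (\<lambda>y. (y, 0)) c"
      if c: "singular_chain p (simplex_space (Suc p)) c" "chain_boundary p c = 0" for c
      using chain_boundary_prism[OF that1 that0 continuous_map_id c(1)] c(2) by simp
    then show ?thesis
      using that1 that3 by (auto simp: prism_chain_def)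
  qed
  have "\<exists>P. \<forall>p. ?Q p (P p) \<and> prism_chain n (Suc p) (P p) (P (Suc p))"
  proof (rule dependent_nat_choice)
    show "\<exists>x. ?Q 0 x"
      using prism_chain_0[of n 0] Q by blast
    show "\<exists>y. ?Q (Suc p) y \<and> prism_chain n (Suc p) x y" if x: "?Q p x" for x p
    proof -
      obtain y where y: "prism_chain n (Suc p) x y"
        using prism_chain_Suc[of p x n] x by blast
      then show ?thesis
        using Q[OF y] x by auto
    qed
  qed
  then obtain P where P: "\<And>p. ?Q p (P p)" "\<And>p. prism_chain n (Suc p) (P p) (P (Suc p))"
    by blast
  have "prism_chain n p (P (p - 1)) (P p)" for p
  proof (cases p)
    \<comment> \<open>By truncated subtraction \<open>P (p - 1)\<close> is \<open>P 0\<close> itself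
      here; it is applied to the zero chain.\<close>
    case 0
    then show ?thesis
      using P(1)[of 0] by (simp add: prism_chain_def chain_boundary_def[of 0])
  next
    case (Suc k)
    then show ?thesis
      using P(2) by simp
  qed
  then show ?thesis
    by blast
qed

section \<open>The chain complex of a pointed G-space\<close>

text \<open>A pointed \<open>G\<close>-space without the k-space condition, which plays no role for singular chains.\<close>

definition pointed_action :: "('g, 'k) monoid_scheme \<Rightarrow> ('g, 'a) pgspace \<Rightarrow> bool" where
  "pointed_action G X \<longleftrightarrow>
     group_action G (topspace (spc X)) (sact X) \<and>
     (\<forall>g\<in>carrier G. continuous_map (spc X) (spc X) (sact X g)) \<and>
     spt X \<in> topspace (spc X) \<and> (\<forall>g\<in>carrier G. sact X g (spt X) = spt X)"

definition pointed_gmap ::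
    "('g, 'k) monoid_scheme \<Rightarrow> ('g, 'a) pgspace \<Rightarrow> ('g, 'b) pgspace \<Rightarrow> ('a \<Rightarrow> 'b) \<Rightarrow> bool" where
  "pointed_gmap G X Y f \<longleftrightarrow>
     continuous_map (spc X) (spc Y) f \<and>
     (\<forall>g\<in>carrier G. \<forall>x\<in>topspace (spc X). f (sact X g x) = sact Y g (f x)) \<and> f (spt X) = spt Y"

text \<open>The inverse of the translation by g is the translation by the inverse of g, so
  bijectivity follows from the laws of an action.\<close>

lemma group_actionI:
  assumes "group G" and ext: "\<And>g. g \<in> carrier G \<Longrightarrow> \<phi> g \<in> extensional E"
    and cl: "\<And>g x. g \<in> carrier G \<Longrightarrow> x \<in> E \<Longrightarrow> \<phi> g x \<in> E"
    and one: "\<And>x. x \<in> E \<Longrightarrow> \<phi> \<one>\<^bsub>G\<^esub> x = x"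
    and mult: "\<And>g h x. g \<in> carrier G \<Longrightarrow> h \<in> carrier G \<Longrightarrow> x \<in> E \<Longrightarrow> \<phi> (g \<otimes>\<^bsub>G\<^esub> h) x = \<phi> g (\<phi> h x)"
  shows "group_action G E \<phi>"
proof -
  interpret group G by fact
  have inv: "\<phi> (inv\<^bsub>G\<^esub> g) (\<phi> g x) = x" "\<phi> g (\<phi> (inv\<^bsub>G\<^esub> g) x) = x" if "g \<in> carrier G" "x \<in> E" for g x
    using that one mult[of "inv\<^bsub>G\<^esub> g" g x] mult[of g "inv\<^bsub>G\<^esub> g" x] by simp_all
  have Bij: "\<phi> g \<in> Bij E" if g: "g \<in> carrier G" for g
  proof -
    have "bij_betw (\<phi> g) E E"
      by (rule bij_betw_byWitness[where f' = "\<phi> (inv\<^bsub>G\<^esub> g)"]) (use g inv cl in auto)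
    then show ?thesis
      using ext[OF g] by (simp add: Bij_def)
  qed
  have "\<phi> \<in> hom G (BijGroup E)"
  proof (rule homI)
    show "\<phi> g \<in> carrier (BijGroup E)" if "g \<in> carrier G" for g
      using Bij[OF that] by (simp add: BijGroup_def)
    show "\<phi> (g \<otimes>\<^bsub>G\<^esub> h) = \<phi> g \<otimes>\<^bsub>BijGroup E\<^esub> \<phi> h" if g: "g \<in> carrier G" and h: "h \<in> carrier G" for g h
    proof (rule extensionalityI[of _ E])
      show "\<phi> (g \<otimes>\<^bsub>G\<^esub> h) x = (\<phi> g \<otimes>\<^bsub>BijGroup E\<^esub> \<phi> h) x" if "x \<in> E" for x
        using that g h Bij by (simp add: BijGroup_def compose_def mult)
    qed (use g h ext Bij in \<open>auto simp: BijGroup_def\<close>)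
  qed
  then show ?thesis
    by (simp add: group_action_def group_hom_def group_hom_axioms_def group_BijGroup is_group)
qed

lemma pointed_gset_singular:
  assumes G: "group G" and X: "pointed_action G X"
  shows "pointed_gset G (singular_gset q X)"
proof -
  interpret group G by fact
  have act: "group_action G (topspace (spc X)) (sact X)"
    and cont: "\<And>g. g \<in> carrier G \<Longrightarrow> continuous_map (spc X) (spc X) (sact X g)"
    and pt: "spt X \<in> topspace (spc X)" "\<And>g. g \<in> carrier G \<Longrightarrow> sact X g (spt X) = spt X"
    using X by (auto simp: pointed_action_def)
  let ?S = "singular_simplex_set q (spc X)"
  let ?act = "\<lambda>g. \<lambda>\<sigma>\<in>?S. simplex_map q (sact X g) \<sigma>"
  have cl: "simplex_map q (sact X g) \<sigma> \<in> ?S" if "g \<in> carrier G" "\<sigma> \<in> ?S" for g \<sigma>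
    using that cont singular_simplex_simplex_map by blast
  have "group_action G ?S ?act"
  proof (rule group_actionI[OF G])
    show "?act \<one>\<^bsub>G\<^esub> \<sigma> = \<sigma>" if "\<sigma> \<in> ?S" for \<sigma>
    proof -
      have "sact X \<one>\<^bsub>G\<^esub> x = x" if "x \<in> topspace (spc X)" for x
        using group_action.id_eq_one[OF act] that by (metis restrict_apply')
      then show ?thesis
        using that simplex_map_id_gen[of q "spc X" \<sigma> "sact X \<one>\<^bsub>G\<^esub>"] by simp
    qed
    show "?act (g \<otimes>\<^bsub>G\<^esub> h) \<sigma> = ?act g (?act h \<sigma>)"
      if g: "g \<in> carrier G" and h: "h \<in> carrier G" and \<sigma>: "\<sigma> \<in> ?S" for g h \<sigma>
    proof -
      have "simplex_map q (sact X (g \<otimes>\<^bsub>G\<^esub> h)) \<sigma> = simplex_map q (sact X g \<circ> sact X h) \<sigma>"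
        using \<sigma> g h group_action.composition_rule[OF act]
        by (intro simplex_map_eq[of q "spc X"]) auto
      then show ?thesis
        using \<sigma> cl[OF h \<sigma>] by (simp add: simplex_map_compose)
    qed
  qed (use cl in auto)
  moreover have "(\<lambda>t\<in>standard_simplex q. spt X) \<in> ?S"
    using pt(1) by (auto simp: singular_simplex_def intro: continuous_map_eq[of _ _ "\<lambda>_. spt X"])
  moreover have "simplex_map q (sact X g) (\<lambda>t\<in>standard_simplex q. spt X) = (\<lambda>t\<in>standard_simplex q. spt X)"
    if "g \<in> carrier G" for g
    using pt(2)[OF that] by (auto simp: simplex_map_def fun_eq_iff)
  ultimately show ?thesis
    by (simp add: pointed_gset_def singular_gset_def)
qed

text \<open>The boundary operator on basis elements, which is the form of a family that
  \<open>induced\<close> takes.\<close>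

definition simplex_boundary :: "nat \<Rightarrow> ((nat \<Rightarrow> real) \<Rightarrow> 'a) \<Rightarrow> 'a chain" where
  "simplex_boundary q \<sigma> = chain_boundary q (frag_of \<sigma>)"

lemma frag_extend_simplex_boundary: "frag_extend (simplex_boundary q) c = chain_boundary q c"
proof -
  have "frag_extend (simplex_boundary q) c = chain_boundary q c" if "Poly_Mapping.keys c \<subseteq> UNIV"
    using that
    by (induction c rule: frag_induction) (simp_all add: simplex_boundary_def frag_extend_diff chain_boundary_diff)
  then show ?thesis
    by simp
qed

section \<open>Boundaries and pointed maps as equivariant families\<close>

context coefficients
begin

lemma equivariant_chain_cong:
  assumes S: "pointed_gset G S" and eq: "\<And>x. x \<in> points S \<Longrightarrow> \<phi> x = \<psi> x"
    and \<phi>: "equivariant_chain S T \<phi>"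
  shows "equivariant_chain S T \<psi>"
  using \<phi> act_closed[OF S] gset_base[OF S] unfolding equivariant_chain_def by (simp add: eq[symmetric])

text \<open>Every chain operator below is the push-forward of a fixed chain on a model space under maps
  that depend equivariantly on the simplex.\<close>

lemma equivariant_chain_natural:
  assumes X: "pointed_action G X" and Y: "pointed_action G Y" and c: "singular_chain q K c"
    and cont: "\<And>\<sigma>. singular_simplex p (spc X) \<sigma> \<Longrightarrow> continuous_map K (spc Y) (F \<sigma>)"
    and equiv: "\<And>g \<sigma> k. g \<in> carrier G \<Longrightarrow> singular_simplex p (spc X) \<sigma> \<Longrightarrow> k \<in> topspace K \<Longrightarrow>
      F (simplex_map p (sact X g) \<sigma>) k = sact Y g (F \<sigma> k)"
    and base: "\<And>k. k \<in> topspace K \<Longrightarrow> F (\<lambda>t\<in>standard_simplex p. spt X) k = spt Y"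
  shows "equivariant_chain (singular_gset p X) (singular_gset q Y) (\<lambda>\<sigma>. chain_map q (F \<sigma>) c)"
proof -
  let ?S = "singular_gset p X" and ?T = "singular_gset q Y"
  have keys: "\<exists>\<tau>. singular_simplex q K \<tau> \<and> \<rho> = simplex_map q (F \<sigma>) \<tau>"
    if "\<rho> \<in> Poly_Mapping.keys (chain_map q (F \<sigma>) c)" for \<sigma> \<rho>
    using that keys_frag_extend[of "frag_of \<circ> simplex_map q (F \<sigma>)" c] c
    unfolding chain_map_def singular_chain_def by fastforce
  \<comment> \<open>Translating a simplex in the image for \<sigma> gives the corresponding simplex
    in the image for the translate of \<sigma>.\<close>
  have translate: "simplex_map q (sact Y g) (simplex_map q (F \<sigma>) \<tau>) = simplex_map q (F (simplex_map p (sact X g) \<sigma>)) \<tau>"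
    if "g \<in> carrier G" "singular_simplex p (spc X) \<sigma>" "singular_simplex q K \<tau>" for g \<sigma> \<tau>
    unfolding simplex_map_compose[THEN fun_cong, unfolded comp_apply, symmetric]
    using that equiv by (intro simplex_map_eq[of q K]) auto
  show ?thesis
    unfolding equivariant_chain_def
  proof (intro conjI ballI)
    fix \<sigma> assume "\<sigma> \<in> points ?S"
    then have \<sigma>: "singular_simplex p (spc X) \<sigma>"
      by (simp add: singular_gset_def)
    show "Poly_Mapping.keys (chain_map q (F \<sigma>) c) \<subseteq> fixed_points ?T (isotropy G ?S \<sigma>)"
    proof
      fix \<rho> assume "\<rho> \<in> Poly_Mapping.keys (chain_map q (F \<sigma>) c)"
      then obtain \<tau> where \<tau>: "singular_simplex q K \<tau>" and \<rho>: "\<rho> = simplex_map q (F \<sigma>) \<tau>"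
        using keys by blast
      have "singular_simplex q (spc Y) \<rho>"
        unfolding \<rho> by (rule singular_simplex_simplex_map[OF \<tau> cont[OF \<sigma>]])
      \<comment> \<open>For g in the isotropy group of \<sigma> the translate of \<sigma> is
        \<sigma> itself, so \<open>translate\<close> says that g fixes each key
        individually.\<close>
      then show "\<rho> \<in> fixed_points ?T (isotropy G ?S \<sigma>)"
        using \<sigma> translate[OF _ \<sigma> \<tau>] by (auto simp: fixed_points_def stabilizer_def singular_gset_def \<rho>)
    qed
  next
    fix g \<sigma> assume g: "g \<in> carrier G" and "\<sigma> \<in> points ?S"
    then have \<sigma>: "singular_simplex p (spc X) \<sigma>"
      by (simp add: singular_gset_def)
    have "chain_map q (F (simplex_map p (sact X g) \<sigma>)) c =
        frag_extend (frag_of \<circ> (act ?T g \<circ> simplex_map q (F \<sigma>))) c"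
      unfolding chain_map_def
    proof (rule frag_extend_eq)
      show "(frag_of \<circ> simplex_map q (F (simplex_map p (sact X g) \<sigma>))) \<tau> =
          (frag_of \<circ> (act ?T g \<circ> simplex_map q (F \<sigma>))) \<tau>" if "\<tau> \<in> Poly_Mapping.keys c" for \<tau>
      proof -
        have \<tau>: "singular_simplex q K \<tau>"
          using c that by (auto simp: singular_chain_def)
        show ?thesis
          using translate[OF g \<sigma> \<tau>] singular_simplex_simplex_map[OF \<tau> cont[OF \<sigma>]]
          by (simp add: singular_gset_def)
      qed
    qed
    also have "\<dots> = frag_extend (frag_of \<circ> act ?T g) (chain_map q (F \<sigma>) c)"
      by (simp only: chain_map_def frag_extend_compose comp_assoc)
    finally have "chain_map q (F (simplex_map p (sact X g) \<sigma>)) c =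
        frag_extend (frag_of \<circ> act ?T g) (chain_map q (F \<sigma>) c)" .
    then show "chain_map q (F (act ?S g \<sigma>)) c = frag_extend (frag_of \<circ> act ?T g) (chain_map q (F \<sigma>) c)"
      using \<sigma> by (simp add: singular_gset_def)
  next
    show "Poly_Mapping.keys (chain_map q (F (basept ?S)) c) \<subseteq> {basept ?T}"
    proof
      fix \<rho> assume "\<rho> \<in> Poly_Mapping.keys (chain_map q (F (basept ?S)) c)"
      then obtain \<tau> where \<tau>: "singular_simplex q K \<tau>" and \<rho>: "\<rho> = simplex_map q (F (basept ?S)) \<tau>"
        using keys by blast
      have "simplex_map q (F (basept ?S)) \<tau> = simplex_map q (\<lambda>_. spt Y) \<tau>"
        using base by (intro simplex_map_eq[OF \<tau>]) (simp add: singular_gset_def)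
      then show "\<rho> \<in> {basept ?T}"
        by (simp add: \<rho> singular_gset_def simplex_map_def comp_def)
    qed
  qed
qed

text \<open>The boundary of \<sigma> is the image under \<sigma> of the boundary of the identity
  simplex, so this is the natural construction with model map \<sigma>.\<close>

lemma equivariant_chain_boundary:
  assumes X: "pointed_action G X"
  shows "equivariant_chain (singular_gset q X) (singular_gset (q - 1) X) (simplex_boundary q)"
proof (rule equivariant_chain_cong[OF pointed_gset_singular[OF is_group X]])
  show "equivariant_chain (singular_gset q X) (singular_gset (q - 1) X)
      (\<lambda>\<sigma>. chain_map (q - 1) \<sigma> (chain_boundary q (identity_simplex q)))"
    by (rule equivariant_chain_natural[OF X X singular_chain_boundary[OF identity_simplex_chain, folded One_nat_def]
          singular_simplex_continuous])
      (auto simp: simplex_map_def)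
  show "chain_map (q - 1) \<sigma> (chain_boundary q (identity_simplex q)) = simplex_boundary q \<sigma>"
    if "\<sigma> \<in> points (singular_gset q X)" for \<sigma>
    using that chain_boundary_chain_map[OF identity_simplex_chain, of q \<sigma>] singular_simplex_chain_map_id[of q "spc X" \<sigma>]
    by (simp add: singular_gset_def simplex_boundary_def)
qed

lemma equivariant_chain_gmap:
  assumes X: "pointed_action G X" and Y: "pointed_action G Y" and f: "pointed_gmap G X Y f"
  shows "equivariant_chain (singular_gset q X) (singular_gset q Y) (\<lambda>\<sigma>. frag_of (simplex_map q f \<sigma>))"
    and fixed_map_gmap: "\<And>u. u \<in> carrier (gchains G M X q) \<Longrightarrow>
      fixed_map G R M (singular_gset q X) (singular_gset q Y) (simplex_map q f) u =
      induced (singular_gset q X) (singular_gset q Y) (\<lambda>\<sigma>. frag_of (simplex_map q f \<sigma>)) u"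
proof -
  let ?S = "singular_gset q X" and ?T = "singular_gset q Y"
  have cont: "continuous_map (spc X) (spc Y) f" and base: "f (spt X) = spt Y"
    and equiv: "\<And>g x. g \<in> carrier G \<Longrightarrow> x \<in> topspace (spc X) \<Longrightarrow> f (sact X g x) = sact Y g (f x)"
    using f by (auto simp: pointed_gmap_def)
  have 1: "simplex_map q f \<sigma> \<in> points ?T" if "\<sigma> \<in> points ?S" for \<sigma>
    using that singular_simplex_simplex_map[OF _ cont] by (simp add: singular_gset_def)
  have 2: "simplex_map q f (act ?S g \<sigma>) = act ?T g (simplex_map q f \<sigma>)" if g: "g \<in> carrier G" and \<sigma>: "\<sigma> \<in> points ?S" for g \<sigma>
  proof -
    have "simplex_map q (f \<circ> sact X g) \<sigma> = simplex_map q (sact Y g \<circ> f) \<sigma>"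
      using \<sigma> equiv[OF g] by (intro simplex_map_eq[of q "spc X"]) (auto simp: singular_gset_def)
    then show ?thesis
      using \<sigma> 1[OF \<sigma>] by (simp add: singular_gset_def simplex_map_compose)
  qed
  have 3: "simplex_map q f (basept ?S) = basept ?T"
    using base by (auto simp: singular_gset_def simplex_map_def fun_eq_iff)
  show "equivariant_chain ?S ?T (\<lambda>\<sigma>. frag_of (simplex_map q f \<sigma>))"
    by (rule equivariant_chain_map) (use 1 2 3 in auto)
  show "fixed_map G R M ?S ?T (simplex_map q f) u = induced ?S ?T (\<lambda>\<sigma>. frag_of (simplex_map q f \<sigma>)) u"
    if "u \<in> carrier (gchains G M X q)" for u
    using that unfolding gchains_def
    by (intro fixed_map_eq_induced pointed_gset_singular is_group X Y 1 2 3)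
qed

lemma mod_hom_sum:
  assumes N: "module R N" and h: "\<And>i. i \<in> A \<Longrightarrow> h i \<in> mod_hom R L N" and A: "finite A"
  shows "(\<lambda>u. \<Oplus>\<^bsub>N\<^esub>i\<in>A. h i u) \<in> mod_hom R L N"
proof -
  interpret N: module R N by fact
  have cl: "(\<lambda>i. h i u) \<in> A \<rightarrow> carrier N" if "u \<in> carrier L" for u
    using mod_hom_closed[OF h that] by blast
  show ?thesis
  proof (rule mod_homI)
    fix u v assume u: "u \<in> carrier L" and v: "v \<in> carrier L"
    have "(\<Oplus>\<^bsub>N\<^esub>i\<in>A. h i (u \<oplus>\<^bsub>L\<^esub> v)) = (\<Oplus>\<^bsub>N\<^esub>i\<in>A. h i u \<oplus>\<^bsub>N\<^esub> h i v)"
      using cl[OF u] cl[OF v] mod_hom_add[OF h u v] by (intro N.finsum_cong') auto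
    then show "(\<Oplus>\<^bsub>N\<^esub>i\<in>A. h i (u \<oplus>\<^bsub>L\<^esub> v)) = (\<Oplus>\<^bsub>N\<^esub>i\<in>A. h i u) \<oplus>\<^bsub>N\<^esub> (\<Oplus>\<^bsub>N\<^esub>i\<in>A. h i v)"
      using N.finsum_addf[OF cl[OF u] cl[OF v]] by simp
  next
    fix r u assume r: "r \<in> carrier R" and u: "u \<in> carrier L"
    have "(\<Oplus>\<^bsub>N\<^esub>i\<in>A. h i (r \<odot>\<^bsub>L\<^esub> u)) = (\<Oplus>\<^bsub>N\<^esub>i\<in>A. r \<odot>\<^bsub>N\<^esub> h i u)"
      using cl[OF u] mod_hom_smult[OF h r u] r by (intro N.finsum_cong') auto
    then show "(\<Oplus>\<^bsub>N\<^esub>i\<in>A. h i (r \<odot>\<^bsub>L\<^esub> u)) = r \<odot>\<^bsub>N\<^esub> (\<Oplus>\<^bsub>N\<^esub>i\<in>A. h i u)"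
      using N.finsum_smult_ldistr[OF A r cl[OF u]] by simp
  qed (use cl in \<open>auto intro: N.finsum_closed\<close>)
qed

text \<open>Both sides are homomorphisms, so they are compared on generators, where additivity and
  the sign rule of \<open>chain_gamma\<close> expand the integral boundary into the alternating sum
  of faces. In degree 0 both are zero. The calculus of families thus applies to the given
  complex.\<close>

lemma gboundary_eq_induced:
  assumes X: "pointed_action G X" and u: "u \<in> carrier (gchains G M X q)"
  shows "gboundary G R M X q u = induced (singular_gset q X) (singular_gset (q - 1) X) (simplex_boundary q) u"
proof -
  let ?S = "singular_gset q X" and ?T = "singular_gset (q - 1) X"
  have S: "pointed_gset G ?S" and T: "pointed_gset G ?T"
    by (rule pointed_gset_singular[OF is_group X])+
  interpret N: module R "fixed_module G M ?T"
    by (rule module_fixed_module[OF T])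
  note bd = equivariant_chain_boundary[OF X, of q]
  have u': "u \<in> carrier (fixed_module G M ?S)"
    using u by (simp add: gchains_def)
  show ?thesis
  proof (cases "q = 0")
    case True
    have "\<zero>\<^bsub>fixed_module G M ?T\<^esub> = induced ?S ?T (simplex_boundary q) u"
    proof (rule fixed_hom_eqI[OF S module_fixed_module[OF T] _ induced_hom[OF S T bd] _ u'])
      show "(\<lambda>u. \<zero>\<^bsub>fixed_module G M ?T\<^esub>) \<in> mod_hom R (fixed_module G M ?S) (fixed_module G M ?T)"
        by (rule mod_homI) (simp_all del: One_nat_def)
      show "\<zero>\<^bsub>fixed_module G M ?T\<^esub> = induced ?S ?T (simplex_boundary q) (gamma G M ?S x l)"
        if x: "x \<in> points ?S" and l: "l \<in> carrier (coeff_at G M ?S x)" for x l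
        unfolding induced_gamma[OF S T bd x l] using chain_gamma_0[OF T isotropy_subgroup[OF S x] l] True
        by (simp add: simplex_boundary_def chain_boundary_def)
    qed
    then show ?thesis
      using True by (simp add: gboundary_def gchains_def)
  next
    case False
    let ?f = "\<lambda>i \<sigma>. frag_of (singular_face q i \<sigma>)"
    have face: "singular_face q i \<sigma> \<in> points ?T" if "i \<le> q" "\<sigma> \<in> points ?S" for i \<sigma>
      using that False singular_simplex_singular_face[of q "spc X" \<sigma> i] by (simp add: singular_gset_def)
    have face_act: "singular_face q i (act ?S g \<sigma>) = act ?T g (singular_face q i \<sigma>)"
      if "i \<le> q" "\<sigma> \<in> points ?S" "g \<in> carrier G" for i g \<sigma>
      using that False face[OF that(1,2)]
      by (auto simp: singular_gset_def singular_face_def simplex_map_def fun_eq_iff simplical_face_in_standard_simplex)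
    have face_base: "singular_face q i (basept ?S) = basept ?T" if "i \<le> q" for i
      using that False
      by (auto simp: singular_gset_def singular_face_def fun_eq_iff simplical_face_in_standard_simplex)
    have ec: "equivariant_chain ?S ?T (?f i)" if "i \<le> q" for i
      by (rule equivariant_chain_map) (use that face face_act face_base in auto)
    have sgn: "(\<ominus>\<^bsub>R\<^esub> \<one>\<^bsub>R\<^esub>) [^]\<^bsub>R\<^esub> i \<in> carrier R" for i :: nat
      by simp
    let ?h = "\<lambda>i u. ((\<ominus>\<^bsub>R\<^esub> \<one>\<^bsub>R\<^esub>) [^]\<^bsub>R\<^esub> (i::nat)) \<odot>\<^bsub>fixed_module G M ?T\<^esub> induced ?S ?T (?f i) u"
    have h: "?h i \<in> mod_hom R (fixed_module G M ?S) (fixed_module G M ?T)" if "i \<le> q" for i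
    proof -
      note hom = induced_hom[OF S T ec[OF that]]
      show ?thesis
        by (rule mod_homI)
          (simp_all add: mod_hom_closed[OF hom] mod_hom_add[OF hom] mod_hom_smult[OF hom]
            N.smult_r_distr N.smult_assoc1[symmetric] N.R.m_comm del: One_nat_def)
    qed
    have "gboundary G R M X q u = (\<Oplus>\<^bsub>fixed_module G M ?T\<^esub>i\<in>{0..q}. ?h i u)"
    proof -
      have "fixed_map G R M ?S ?T (singular_face q i) u = induced ?S ?T (?f i) u" if "i \<le> q" for i
        by (rule fixed_map_eq_induced[OF S T face[OF that] face_act[OF that] face_base[OF that] u'])
      then have "(\<Oplus>\<^bsub>fixed_module G M ?T\<^esub>i\<in>{0..q}. ((\<ominus>\<^bsub>R\<^esub> \<one>\<^bsub>R\<^esub>) [^]\<^bsub>R\<^esub> i) \<odot>\<^bsub>fixed_module G M ?T\<^esub>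
          fixed_map G R M ?S ?T (singular_face q i) u) = (\<Oplus>\<^bsub>fixed_module G M ?T\<^esub>i\<in>{0..q}. ?h i u)"
        using mod_hom_closed[OF h u'] by (intro N.finsum_cong') auto
      then show ?thesis
        using False by (simp only: gboundary_def gchains_def if_False)
    qed
    also have "\<dots> = induced ?S ?T (simplex_boundary q) u"
    proof (rule fixed_hom_eqI[OF S module_fixed_module[OF T] _ induced_hom[OF S T bd] _ u'])
      show "(\<lambda>u. \<Oplus>\<^bsub>fixed_module G M ?T\<^esub>i\<in>{0..q}. ?h i u) \<in> mod_hom R (fixed_module G M ?S) (fixed_module G M ?T)"
        by (rule mod_hom_sum[OF module_fixed_module[OF T] h]) auto
      fix x l assume x: "x \<in> points ?S" and l: "l \<in> carrier (coeff_at G M ?S x)"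
      note H = isotropy_subgroup[OF S x]
      have keys: "Poly_Mapping.keys (frag_of (singular_face q i x)) \<subseteq> fixed_points ?T (isotropy G ?S x)" if "i \<le> q" for i
        using equivariant_chain_keys[OF ec[OF that] x] .
      have "induced ?S ?T (simplex_boundary q) (gamma G M ?S x l) =
          chain_gamma ?T (isotropy G ?S x) l (\<Sum>i\<le>q. frag_cmul ((-1) ^ i) (frag_of (singular_face q i x)))"
        unfolding induced_gamma[OF S T bd x l]
        using False by (simp add: simplex_boundary_def chain_boundary_of)
      also have "\<dots> = (\<Oplus>\<^bsub>fixed_module G M ?T\<^esub>i\<in>{..q}. chain_gamma ?T (isotropy G ?S x) l (frag_cmul ((-1) ^ i) (frag_of (singular_face q i x))))"
        using keys by (intro chain_gamma_sum[OF T H l]) auto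
      also have "\<dots> = (\<Oplus>\<^bsub>fixed_module G M ?T\<^esub>i\<in>{0..q}. ?h i (gamma G M ?S x l))"
        using mod_hom_closed[OF h gamma_closed[OF S x l]] chain_gamma_sign[OF T H l keys] induced_gamma[OF S T ec x l]
        by (intro N.finsum_cong') (auto simp: atLeast0AtMost)
      finally show "(\<Oplus>\<^bsub>fixed_module G M ?T\<^esub>i\<in>{0..q}. ?h i (gamma G M ?S x l)) =
          induced ?S ?T (simplex_boundary q) (gamma G M ?S x l)" ..
    qed
    finally show ?thesis .
  qed
qed

end

section \<open>Contracting a neighbourhood of the base point\<close>

lemma closedin_sequentially:
  fixes S :: "'a::first_countable_topology set"
  shows "closedin (top_of_set S) T \<longleftrightarrow>
    T \<subseteq> S \<and> (\<forall>x l. (\<forall>n. x n \<in> T) \<and> l \<in> S \<and> x \<longlonglongrightarrow> l \<longrightarrow> l \<in> T)" (is "_ \<longleftrightarrow> ?seq")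
proof
  assume "closedin (top_of_set S) T"
  then obtain C where C: "closed C" "T = S \<inter> C"
    by (auto simp: closedin_closed)
  then show ?seq
    using closed_sequentially[OF C(1)] by blast
next
  assume seq: ?seq
  then have "T = S \<inter> closure T"
    using closure_subset[of T] by (auto simp: closure_sequential)
  then show "closedin (top_of_set S) T"
    using closed_closure closedin_closed by blast
qed

text \<open>Closedness is detected by convergent sequences, and a sequence with its limit forms a
  countable compact space, of which every infinite type contains a copy.\<close>

lemma k_space_over_metric:
  fixes S :: "'b::heine_borel set"
  assumes inf: "infinite (UNIV :: 'z set)"
  shows "k_space_over TYPE('z) (top_of_set S)"
  unfolding k_space_over_def
proof (intro allI impI)
  fix W assume W: "W \<subseteq> topspace (top_of_set S)"
    and test: "\<forall>(Z :: 'z topology) f. compact_space Z \<longrightarrow> Hausdorff_space Z \<longrightarrow>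
      continuous_map Z (top_of_set S) f \<longrightarrow> closedin Z {t \<in> topspace Z. f t \<in> W}"
  show "closedin (top_of_set S) W"
    unfolding closedin_sequentially
  proof (intro conjI allI impI)
    show "W \<subseteq> S"
      using W by simp
    fix x l assume "(\<forall>n. x n \<in> W) \<and> l \<in> S \<and> x \<longlonglongrightarrow> l"
    then have x: "\<And>n. x n \<in> W" and l: "l \<in> S" "x \<longlonglongrightarrow> l"
      by auto
    define y where "y n = (inverse (real (Suc n)), x n)" for n
    define K where "K = insert (0, l) (range y)"
    have y: "y \<longlonglongrightarrow> (0, l)"
      unfolding y_def using LIMSEQ_inverse_real_of_nat l(2) by (intro tendsto_Pair)
    have "compact K"
      unfolding K_def by (rule compact_sequence_with_limit[OF y])
    have "countable K"
      by (simp add: K_def)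
    obtain k :: "nat \<Rightarrow> 'z" where k: "inj k"
      using infinite_countable_subset[OF inf] by blast
    define j where "j = k \<circ> to_nat_on K"
    have j: "inj_on j K"
      unfolding j_def using inj_on_to_nat_on[OF \<open>countable K\<close>] k by (intro comp_inj_on) (auto intro: inj_on_subset)
    \<comment> \<open>The copy of \<open>K\<close> with points in \<open>'z\<close>, topologised
      through the inverse of \<open>j\<close>.\<close>
    define Z where "Z = pullback_topology (j ` K) (inv_into K j) (top_of_set K)"
    have topZ: "topspace Z = j ` K"
      by (auto simp: Z_def topspace_pullback_topology j)
    have inv: "continuous_map Z (top_of_set K) (inv_into K j)"
      using continuous_map_pullback[OF continuous_map_id[of "top_of_set K"], of "j ` K" "inv_into K j"] by (simp add: Z_def)
    have jcont: "continuous_map (top_of_set K) Z j"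
      unfolding Z_def
      by (rule continuous_map_pullback') (auto simp: j intro: continuous_map_eq[OF continuous_map_id])
    have "homeomorphic_maps (top_of_set K) Z j (inv_into K j)"
      using inv jcont j by (auto simp: homeomorphic_maps_def topZ)
    then have hom: "top_of_set K homeomorphic_space Z"
      by (auto simp: homeomorphic_space_def)
    have Z: "compact_space Z" "Hausdorff_space Z"
      using homeomorphic_compact_space[OF hom] homeomorphic_Hausdorff_space[OF hom] \<open>compact K\<close>
      by (auto simp: compact_space_subtopology Hausdorff_space_subtopology)
    have "continuous_map (top_of_set K) (top_of_set S) snd"
      using W x l by (auto simp: continuous_on_snd K_def y_def)
    then have "continuous_map Z (top_of_set S) (snd \<circ> inv_into K j)"
      by (rule continuous_map_compose[OF inv])
    then have "closedin Z {t \<in> topspace Z. (snd \<circ> inv_into K j) t \<in> W}"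
      using test Z by blast
    then have "closedin (top_of_set K) {z \<in> topspace (top_of_set K). j z \<in> {t \<in> topspace Z. (snd \<circ> inv_into K j) t \<in> W}}"
      by (rule closedin_continuous_map_preimage[OF jcont])
    moreover have "{z \<in> topspace (top_of_set K). j z \<in> {t \<in> topspace Z. (snd \<circ> inv_into K j) t \<in> W}} = {z \<in> K. snd z \<in> W}"
      using j by (auto simp: topZ dest!: inj_onD[OF j])
    ultimately have "closedin (top_of_set K) {z \<in> K. snd z \<in> W}"
      by simp
    moreover have "y n \<in> {z \<in> K. snd z \<in> W}" for n
      using x by (simp add: K_def y_def)
    ultimately have "(0, l) \<in> {z \<in> K. snd z \<in> W}"
      using y unfolding closedin_sequentially K_def by blast
    then show "l \<in> W"
      by simp
  qed
qed

text \<open>Hausdorff spaces on a finite type are discrete, so every subset passes the test and is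
  closed.\<close>

lemma k_space_over_finite:
  assumes "finite (UNIV :: 'z set)" and X: "k_space_over TYPE('z) X" and "U \<subseteq> topspace X"
  shows "openin X U"
proof -
  have "closedin X (topspace X - U)"
  proof (rule X[unfolded k_space_over_def, rule_format])
    fix Z :: "'z topology" and f
    assume "Hausdorff_space Z"
    then show "closedin Z {t \<in> topspace Z. f t \<in> topspace X - U}"
      using assms(1) by (intro closedin_Hausdorff_finite) (auto intro: finite_subset)
  qed auto
  then show ?thesis
    using assms(3) by (simp add: openin_closedin_eq double_diff)
qed

text \<open>Test maps into \<open>K\<close> composed with \<open>k\<close> are test maps into
  \<open>Y\<close>. This reduces the k-space condition on a space glued from pieces to the
  pieces.\<close>

lemma k_space_over_preimage:
  assumes K: "k_space_over TYPE('z) K" and k: "continuous_map K Y k"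
    and test: "\<forall>(Z :: 'z topology) f. compact_space Z \<longrightarrow> Hausdorff_space Z \<longrightarrow>
        continuous_map Z Y f \<longrightarrow> closedin Z {t \<in> topspace Z. f t \<in> W}"
  shows "closedin K {x \<in> topspace K. k x \<in> W}"
proof (rule K[unfolded k_space_over_def, rule_format])
  fix Z :: "'z topology" and f
  assume Z: "compact_space Z" "Hausdorff_space Z" and f: "continuous_map Z K f"
  have "closedin Z {t \<in> topspace Z. (k \<circ> f) t \<in> W}"
    using test Z continuous_map_compose[OF f k] by blast
  moreover have "{t \<in> topspace Z. f t \<in> {x \<in> topspace K. k x \<in> W}} = {t \<in> topspace Z. (k \<circ> f) t \<in> W}"
    using continuous_map_image_subset_topspace[OF f] by auto
  ultimately show "closedin Z {t \<in> topspace Z. f t \<in> {x \<in> topspace K. k x \<in> W}}"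
    by simp
qed auto

text \<open>The mapping cylinder of the inclusion of a point.\<close>

definition whisker_points :: "'a topology \<Rightarrow> 'a \<Rightarrow> ('a \<times> real) set" where
  "whisker_points X a = topspace X \<times> {0} \<union> {a} \<times> {0..1}"

definition whisker_topology :: "'a topology \<Rightarrow> 'a \<Rightarrow> ('a \<times> real) topology" where
  "whisker_topology X a = topology (\<lambda>U. U \<subseteq> whisker_points X a \<and>
     openin X {x \<in> topspace X. (x, 0) \<in> U} \<and> openin (top_of_set {0..1}) {t \<in> {0..1}. (a, t) \<in> U})"

lemma openin_whisker:
  "openin (whisker_topology X a) U \<longleftrightarrow> U \<subseteq> whisker_points X a \<and>
     openin X {x \<in> topspace X. (x, 0) \<in> U} \<and> openin (top_of_set {0..1}) {t \<in> {0..1}. (a, t) \<in> U}"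
proof -
  have "istopology (\<lambda>U. U \<subseteq> whisker_points X a \<and>
     openin X {x \<in> topspace X. (x, 0) \<in> U} \<and> openin (top_of_set {0..1}) {t \<in> {0..1}. (a, t) \<in> U})"
    unfolding istopology_def
  proof (intro conjI allI impI)
    fix U V :: "('a \<times> real) set"
    have eq: "{x \<in> A. k x \<in> U \<inter> V} = {x \<in> A. k x \<in> U} \<inter> {x \<in> A. k x \<in> V}" for A :: "'c set" and k
      by auto
    assume "U \<subseteq> whisker_points X a \<and>
        openin X {x \<in> topspace X. (x, 0) \<in> U} \<and> openin (top_of_set {0..1}) {t \<in> {0..1}. (a, t) \<in> U}"
      "V \<subseteq> whisker_points X a \<and>
        openin X {x \<in> topspace X. (x, 0) \<in> V} \<and> openin (top_of_set {0..1}) {t \<in> {0..1}. (a, t) \<in> V}"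
    then show "U \<inter> V \<subseteq> whisker_points X a" "openin X {x \<in> topspace X. (x, 0) \<in> U \<inter> V}"
      "openin (top_of_set {0..1}) {t \<in> {0..1}. (a, t) \<in> U \<inter> V}"
      unfolding eq by (auto intro: openin_Int)
  next
    fix \<U> :: "('a \<times> real) set set"
    have eq: "{x \<in> A. k x \<in> \<Union>\<U>} = (\<Union>U\<in>\<U>. {x \<in> A. k x \<in> U})" for A :: "'c set" and k
      by auto
    assume "\<forall>U\<in>\<U>. U \<subseteq> whisker_points X a \<and>
        openin X {x \<in> topspace X. (x, 0) \<in> U} \<and> openin (top_of_set {0..1}) {t \<in> {0..1}. (a, t) \<in> U}"
    then show "\<Union>\<U> \<subseteq> whisker_points X a" "openin X {x \<in> topspace X. (x, 0) \<in> \<Union>\<U>}"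
      "openin (top_of_set {0..1}) {t \<in> {0..1}. (a, t) \<in> \<Union>\<U>}"
      unfolding eq by (auto intro: openin_Union)
  qed
  then show ?thesis
    by (simp add: whisker_topology_def)
qed

lemma topspace_whisker:
  assumes "a \<in> topspace X"
  shows "topspace (whisker_topology X a) = whisker_points X a"
proof -
  have "{x \<in> topspace X. (x, 0) \<in> whisker_points X a} = topspace X"
    "{t \<in> {0..1}. (a, t) \<in> whisker_points X a} = {0..1}"
    by (auto simp: whisker_points_def)
  then have "openin (whisker_topology X a) (whisker_points X a)"
    using openin_topspace[of "top_of_set {0..1::real}"] by (simp add: openin_whisker)
  then show ?thesis
    by (metis openin_subset openin_topspace openin_whisker subset_antisym)
qed

lemma continuous_map_whisker:
  fixes X :: "'a topology"
  assumes a: "a \<in> topspace X"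
  shows "continuous_map X (whisker_topology X a) (\<lambda>x. (x, 0))"
    and "continuous_map (top_of_set {0..1}) (whisker_topology X a) (\<lambda>t. (a, t))"
    and "\<And>(Y :: 'c topology) (f :: 'a \<times> real \<Rightarrow> 'c). continuous_map X Y (\<lambda>x. f (x, 0)) \<Longrightarrow> continuous_map (top_of_set {0..1}) Y (\<lambda>t. f (a, t)) \<Longrightarrow>
      continuous_map (whisker_topology X a) Y f"
proof -
  show "continuous_map X (whisker_topology X a) (\<lambda>x. (x, 0))"
    by (auto simp: continuous_map_def openin_whisker topspace_whisker[OF a] whisker_points_def)
  show "continuous_map (top_of_set {0..1}) (whisker_topology X a) (\<lambda>t. (a, t))"
    unfolding continuous_map_def
    by (auto simp: openin_whisker topspace_whisker[OF a]) (auto simp: whisker_points_def)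
  fix Y :: "'c topology" and f :: "'a \<times> real \<Rightarrow> 'c" assume 1: "continuous_map X Y (\<lambda>x. f (x, 0))" and 2: "continuous_map (top_of_set {0..1}) Y (\<lambda>t. f (a, t))"
  have "openin (whisker_topology X a) {z \<in> whisker_points X a. f z \<in> U}" if U: "openin Y U" for U
  proof -
    have "{x \<in> topspace X. (x, 0) \<in> {z \<in> whisker_points X a. f z \<in> U}} = {x \<in> topspace X. f (x, 0) \<in> U}"
      "{t \<in> {0..1}. (a, t) \<in> {z \<in> whisker_points X a. f z \<in> U}} = {t \<in> topspace (top_of_set {0..1}). f (a, t) \<in> U}"
      by (auto simp: whisker_points_def)
    then show ?thesis
      unfolding openin_whisker
      using openin_continuous_map_preimage[OF 1 U] openin_continuous_map_preimage[OF 2 U] by auto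
  qed
  moreover have "f z \<in> topspace Y" if "z \<in> whisker_points X a" for z
    using that continuous_map_image_subset_topspace[OF 1] continuous_map_image_subset_topspace[OF 2]
    by (auto simp: whisker_points_def)
  ultimately show "continuous_map (whisker_topology X a) Y f"
    by (auto simp: continuous_map_def topspace_whisker[OF a])
qed

text \<open>Makes the whisker an admissible target in \<open>gcofibration\<close>. Its topology is
  glued from \<open>X\<close> and [0,1], so the k-space condition is checked on each; for [0,1] this
  uses that \<open>'z\<close> is infinite. G acts trivially along the whisker, consistently because
  the base point is fixed.\<close>

lemma gspace_whisker:
  assumes G: "group G" and inf: "infinite (UNIV :: 'z set)" and X: "gspace TYPE('z) G X \<phi>"
    and a: "a \<in> topspace X" "\<And>g. g \<in> carrier G \<Longrightarrow> \<phi> g a = a"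
  shows "gspace TYPE('z) G (whisker_topology X a) (\<lambda>g. \<lambda>z\<in>whisker_points X a. (\<phi> g (fst z), snd z))"
  unfolding gspace_def topspace_whisker[OF a(1)]
proof (intro conjI ballI)
  let ?Y = "whisker_topology X a"
  have act: "group_action G (topspace X) \<phi>" and kX: "k_space_over TYPE('z) X"
    and cont: "\<And>g. g \<in> carrier G \<Longrightarrow> continuous_map X X (\<phi> g)"
    using X by (auto simp: gspace_def)
  note incl = continuous_map_whisker(1,2)[OF a(1)]
  show "k_space_over TYPE('z) ?Y"
    unfolding k_space_over_def topspace_whisker[OF a(1)]
  proof (intro allI impI)
    fix W assume W: "W \<subseteq> whisker_points X a"
      and test: "\<forall>(Z :: 'z topology) f. compact_space Z \<longrightarrow> Hausdorff_space Z \<longrightarrow>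
        continuous_map Z ?Y f \<longrightarrow> closedin Z {t \<in> topspace Z. f t \<in> W}"
    have 1: "closedin X {x \<in> topspace X. (x, 0) \<in> W}"
      by (rule k_space_over_preimage[OF kX incl(1) test])
    have 2: "closedin (top_of_set {0..1}) {t \<in> topspace (top_of_set {0..1}). (a, t) \<in> W}"
      by (rule k_space_over_preimage[OF k_space_over_metric[OF inf] incl(2) test])
    have "{x \<in> topspace X. (x, 0) \<in> whisker_points X a - W} = topspace X - {x \<in> topspace X. (x, 0) \<in> W}"
      "{t \<in> {0..1}. (a, t) \<in> whisker_points X a - W} =
        topspace (top_of_set {0..1}) - {t \<in> topspace (top_of_set {0..1}). (a, t) \<in> W}"
      by (auto simp: whisker_points_def)
    then have "openin ?Y (whisker_points X a - W)"
      using openin_diff[OF openin_topspace 1] openin_diff[OF openin_topspace 2] by (simp add: openin_whisker)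
    then show "closedin ?Y W"
      using W by (simp add: closedin_def topspace_whisker[OF a(1)])
  qed
  have cl: "\<phi> g x \<in> topspace X" if "g \<in> carrier G" "x \<in> topspace X" for g x
    using group_action.element_image[OF act that] by blast
  show "group_action G (whisker_points X a) (\<lambda>g. \<lambda>z\<in>whisker_points X a. (\<phi> g (fst z), snd z))"
  proof (rule group_actionI[OF G])
    have "\<phi> \<one>\<^bsub>G\<^esub> x = x" if "x \<in> topspace X" for x
      using group_action.id_eq_one[OF act] that by (metis restrict_apply')
    then show "(\<lambda>z\<in>whisker_points X a. (\<phi> \<one>\<^bsub>G\<^esub> (fst z), snd z)) z = z" if "z \<in> whisker_points X a" for z
      using that a(1) by (auto simp: whisker_points_def)
  qed (use cl a group_action.composition_rule[OF act] in \<open>auto simp: whisker_points_def\<close>)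
  fix g assume g: "g \<in> carrier G"
  let ?\<psi> = "\<lambda>z\<in>whisker_points X a. (\<phi> g (fst z), snd z)"
  have "continuous_map X ?Y (\<lambda>x. (\<phi> g x, 0))"
    using continuous_map_compose[OF cont[OF g] incl(1)] by (simp add: comp_def)
  then have "continuous_map X ?Y (\<lambda>x. ?\<psi> (x, 0))"
    by (rule continuous_map_eq) (auto simp: whisker_points_def)
  moreover have "continuous_map (top_of_set {0..1}) ?Y (\<lambda>t. ?\<psi> (a, t))"
    by (rule continuous_map_eq[OF incl(2)]) (use a(2)[OF g] in \<open>auto simp: whisker_points_def\<close>)
  ultimately show "continuous_map ?Y ?Y ?\<psi>"
    by (rule continuous_map_whisker(3)[OF a(1)])
qed

text \<open>All that the argument uses of well-pointedness. A real function \<open>e\<close> marks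
  the collapsed neighbourhood, rather than an open set, because both {e > 0} and {e < 1} have to be
  open for the cover of the wedge.\<close>

definition contraction_data ::
    "('g, 'k) monoid_scheme \<Rightarrow> ('g, 'a) pgspace \<Rightarrow> ('a \<times> real \<Rightarrow> 'a) \<Rightarrow> ('a \<Rightarrow> real) \<Rightarrow> bool" where
  "contraction_data G X D e \<longleftrightarrow>
     continuous_map (prod_topology (spc X) (top_of_set {0..1})) (spc X) D \<and>
     (\<forall>x\<in>topspace (spc X). D (x, 0) = x) \<and> (\<forall>t\<in>{0..1}. D (spt X, t) = spt X) \<and>
     (\<forall>g\<in>carrier G. \<forall>x\<in>topspace (spc X). \<forall>t\<in>{0..1}. D (sact X g x, t) = sact X g (D (x, t))) \<and>
     continuous_map (spc X) euclideanreal e \<and> e (spt X) = 1 \<and>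
     (\<forall>x\<in>topspace (spc X). 0 < e x \<longrightarrow> D (x, 1) = spt X)"

text \<open>Extending the whisker over \<open>X\<close> pulls a neighbourhood of the base point into the whisker; the
  second coordinate at time \<open>1\<close> is \<open>e\<close>. If the type of test points is finite, then \<open>[0,1]\<close>
  need not be a k-space, but \<open>X\<close> is discrete.\<close>

lemma well_pointed_contraction:
  assumes G: "group G" and X: "well_pointed TYPE('z) G X"
  shows "\<exists>D e. contraction_data G X D e"
proof (cases "finite (UNIV :: 'z set)")
  case True
  have k: "k_space_over TYPE('z) (spc X)" and pt: "spt X \<in> topspace (spc X)"
    using X by (auto simp: well_pointed_def pointed_gspace_def gspace_def)
  \<comment> \<open>\<open>X\<close> is discrete, so the homotopy may be constant and the indicator
    function of the base point is continuous.\<close>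
  have "contraction_data G X fst (\<lambda>x. if x = spt X then 1 else 0)"
    unfolding contraction_data_def
    by (intro conjI continuous_map_fst)
      (use k_space_over_finite[OF True k] pt in \<open>auto simp: continuous_map_def\<close>)
  then show ?thesis
    by blast
next
  case False
  let ?a = "spt X" and ?T = "spc X"
  let ?Y = "whisker_topology ?T ?a"
  let ?\<psi> = "\<lambda>g. \<lambda>z\<in>whisker_points ?T ?a. (sact X g (fst z), snd z)"
  have gX: "gspace TYPE('z) G ?T (sact X)" and a: "?a \<in> topspace ?T" "\<And>g. g \<in> carrier G \<Longrightarrow> sact X g ?a = ?a"
    and cof: "gcofibration TYPE('z) G ?T (sact X) {?a}"
    using X by (auto simp: well_pointed_def pointed_gspace_def)
  have act: "group_action G (topspace ?T) (sact X)"
    using gX by (simp add: gspace_def)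
  note incl = continuous_map_whisker(1,2)[OF a(1)]
  have gm: "gmap G ?T (sact X) ?Y ?\<psi> (\<lambda>x. (x, 0))"
    using incl(1) by (auto simp: gmap_def whisker_points_def)
  have gh: "ghomotopy G (subtopology ?T {?a}) (sact X) ?Y ?\<psi> (\<lambda>z. z)"
    unfolding ghomotopy_def gmap_def
  proof (intro conjI ballI)
    have "continuous_map (prod_topology (subtopology ?T {?a}) (top_of_set {0..1::real})) ?Y ((\<lambda>t. (?a, t)) \<circ> snd)"
      by (rule continuous_map_compose[OF continuous_map_snd incl(2)])
    then show "continuous_map (prod_topology (subtopology ?T {?a}) (top_of_set {0..1::real})) ?Y (\<lambda>z. z)"
      by (rule continuous_map_eq) auto
  qed (use a in \<open>auto simp: whisker_points_def\<close>)
  \<comment> \<open>The extension problem: \<open>X\<close> itself at time 0 and, on the base point,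
    the path that runs along the whisker.\<close>
  have "\<exists>H. ghomotopy G ?T (sact X) ?Y ?\<psi> H \<and> (\<forall>x\<in>topspace ?T. H (x, 0) = (x, 0)) \<and>
      (\<forall>a\<in>{?a}. \<forall>t\<in>{0..1}. H (a, t) = (a, t))"
    by (rule cof[unfolded gcofibration_def, rule_format, OF gspace_whisker[OF G False gX a] gm gh]) auto
  then obtain H where H: "ghomotopy G ?T (sact X) ?Y ?\<psi> H"
    and H0: "\<And>x. x \<in> topspace ?T \<Longrightarrow> H (x, 0) = (x, 0)" and Ha: "\<And>t. t \<in> {0..1} \<Longrightarrow> H (?a, t) = (?a, t)"
    by blast
  have cont: "continuous_map (prod_topology ?T (top_of_set {0..1})) ?Y H"
    and equiv: "\<And>g x t. g \<in> carrier G \<Longrightarrow> x \<in> topspace ?T \<Longrightarrow> t \<in> {0..1} \<Longrightarrow> H (sact X g x, t) = ?\<psi> g (H (x, t))"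
    using H by (auto simp: ghomotopy_def gmap_def)
  have in_Y: "H (x, t) \<in> whisker_points ?T ?a" if "x \<in> topspace ?T" "t \<in> {0..1}" for x t
    using continuous_map_image_subset_topspace[OF cont] that by (auto simp: topspace_whisker[OF a(1)])
  have fst: "continuous_map ?Y ?T fst"
    using a(1) by (intro continuous_map_whisker(3)) auto
  have snd: "continuous_map ?Y euclideanreal snd"
    using a(1) by (intro continuous_map_whisker(3)) auto
  \<comment> \<open>The deformation is \<open>H\<close> with the whisker crushed to the base point,
    and \<open>e\<close> is the height reached at time 1. A positive height occurs only on the
    whisker, whose points have the base point as first coordinate.\<close>
  have "contraction_data G X (\<lambda>z. fst (H z)) (\<lambda>x. snd (H (x, 1)))"
    unfolding contraction_data_def
  proof (intro conjI ballI impI)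
    show "continuous_map (prod_topology ?T (top_of_set {0..1})) ?T (\<lambda>z. fst (H z))"
      using continuous_map_compose[OF cont fst] by (simp add: comp_def)
    show "continuous_map ?T euclideanreal (\<lambda>x. snd (H (x, 1)))"
      using continuous_map_compose[OF continuous_map_compose[OF continuous_map_end[of 1] cont] snd]
      by (simp add: comp_def)
    show "fst (H (x, 1)) = ?a" if "x \<in> topspace ?T" "0 < snd (H (x, 1))" for x
      using in_Y[OF that(1), of 1] that(2) by (auto simp: whisker_points_def)
    show "fst (H (sact X g x, t)) = sact X g (fst (H (x, t)))"
      if "g \<in> carrier G" "x \<in> topspace ?T" "t \<in> {0..1}" for g x t
      using equiv[OF that] in_Y[OF that(2,3)] by simp
  qed (use H0 Ha in auto)
  then show ?thesis
    by blast
qed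

section \<open>The wedge\<close>

definition wedge_retract :: "('i \<Rightarrow> ('g, 'a) pgspace) \<Rightarrow> 'i \<Rightarrow> ('i \<times> 'a) option \<Rightarrow> 'a" where
  "wedge_retract X \<alpha> p = (case p of None \<Rightarrow> spt (X \<alpha>) | Some (\<beta>, x) \<Rightarrow> if \<beta> = \<alpha> then x else spt (X \<alpha>))"

lemma wedge_retract_incl:
  "wedge_retract X \<beta> (wedge_incl X \<alpha> x) = (if \<beta> = \<alpha> then x else spt (X \<beta>))"
  by (auto simp: wedge_retract_def wedge_incl_def)

lemma wedge_incl_in_points: "\<alpha> \<in> I \<Longrightarrow> x \<in> topspace (spc (X \<alpha>)) \<Longrightarrow> wedge_incl X \<alpha> x \<in> wedge_points X I"
  by (auto simp: wedge_points_def)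

lemma wedge_points_cases:
  assumes "p \<in> wedge_points X I"
  obtains "p = None" | \<alpha> x where "\<alpha> \<in> I" "x \<in> topspace (spc (X \<alpha>))" "x \<noteq> spt (X \<alpha>)" "p = wedge_incl X \<alpha> x"
  using assms unfolding wedge_points_def wedge_incl_def by (auto split: if_splits)

lemma continuous_map_wedge_incl:
  assumes "\<alpha> \<in> I"
  shows "continuous_map (spc (X \<alpha>)) (wedge_topology X I) (wedge_incl X \<alpha>)"
  using assms by (auto simp: continuous_map_def openin_wedge_topology wedge_incl_in_points)

lemma continuous_map_from_wedge:
  assumes "\<And>\<alpha>. \<alpha> \<in> I \<Longrightarrow> continuous_map (spc (X \<alpha>)) Y (\<lambda>x. f (wedge_incl X \<alpha> x))" and "f None \<in> topspace Y"
  shows "continuous_map (wedge_topology X I) Y f"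
proof -
  have "f p \<in> topspace Y" if "p \<in> wedge_points X I" for p
    using that
  proof (cases p rule: wedge_points_cases)
    case (2 \<alpha> x)
    then show ?thesis
      using continuous_map_image_subset_topspace[OF assms(1)] by blast
  qed (use assms(2) in simp)
  moreover have "openin (wedge_topology X I) {p \<in> wedge_points X I. f p \<in> U}" if U: "openin Y U" for U
    unfolding openin_wedge_topology
  proof (intro conjI ballI)
    fix \<alpha> assume \<alpha>: "\<alpha> \<in> I"
    have "{x \<in> topspace (spc (X \<alpha>)). wedge_incl X \<alpha> x \<in> {p \<in> wedge_points X I. f p \<in> U}} =
        {x \<in> topspace (spc (X \<alpha>)). f (wedge_incl X \<alpha> x) \<in> U}"
      using wedge_incl_in_points[OF \<alpha>, where X = X] by auto
    then show "openin (spc (X \<alpha>)) {x \<in> topspace (spc (X \<alpha>)). wedge_incl X \<alpha> x \<in> {p \<in> wedge_points X I. f p \<in> U}}"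
      using openin_continuous_map_preimage[OF assms(1)[OF \<alpha>] U] by simp
  qed auto
  ultimately show ?thesis
    by (auto simp: continuous_map_def)
qed

text \<open>Each summand is open in the sum, so a neighbourhood found in the product of one summand
  with \<open>Z\<close> is a neighbourhood in the whole product.\<close>

lemma continuous_map_from_sum_prod:
  assumes "\<And>\<alpha>. \<alpha> \<in> I \<Longrightarrow> continuous_map (prod_topology (S \<alpha>) Z) Y (\<lambda>(x, t). f ((\<alpha>, x), t))"
  shows "continuous_map (prod_topology (sum_topology S I) Z) Y f"
proof -
  have "openin (prod_topology (sum_topology S I) Z) {q \<in> topspace (prod_topology (sum_topology S I) Z). f q \<in> U}"
    if U: "openin Y U" for U
    unfolding openin_prod_topology_alt
  proof (intro allI impI)
    fix p t assume pt: "(p, t) \<in> {q \<in> topspace (prod_topology (sum_topology S I) Z). f q \<in> U}"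
    then obtain \<alpha> x where p: "p = (\<alpha>, x)" "\<alpha> \<in> I" "x \<in> topspace (S \<alpha>)" and t: "t \<in> topspace Z" "f (p, t) \<in> U"
      by auto
    have "openin (prod_topology (S \<alpha>) Z) {q \<in> topspace (prod_topology (S \<alpha>) Z). (case q of (x, t) \<Rightarrow> f ((\<alpha>, x), t)) \<in> U}"
      (is "openin _ ?V")
      by (rule openin_continuous_map_preimage[OF assms[OF p(2)] U])
    then obtain A J where A: "openin (S \<alpha>) A" "openin Z J" "x \<in> A" "t \<in> J"
      and AJ: "A \<times> J \<subseteq> ?V"
    proof -
      have "(x, t) \<in> ?V"
        using p t by simp
      with \<open>openin _ ?V\<close> show ?thesis
        using that unfolding openin_prod_topology_alt[of "S \<alpha>"] by blast
    qed
    have "openin (sum_topology S I) ({\<alpha>} \<times> A)"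
    proof -
      have "{y. (\<beta>, y) \<in> {\<alpha>} \<times> A} = (if \<beta> = \<alpha> then A else {})" for \<beta>
        by auto
      then show ?thesis
        using A(1) p(2) openin_subset[OF A(1)] by (auto simp: openin_sum_topology)
    qed
    moreover have "({\<alpha>} \<times> A) \<times> J \<subseteq> {q \<in> topspace (prod_topology (sum_topology S I) Z). f q \<in> U}"
      using AJ p(2) by auto
    ultimately show "\<exists>V J. openin (sum_topology S I) V \<and> openin Z J \<and> p \<in> V \<and> t \<in> J \<and>
        V \<times> J \<subseteq> {q \<in> topspace (prod_topology (sum_topology S I) Z). f q \<in> U}"
      using A p(1) by blast
  qed
  moreover have "f ((\<alpha>, x), t) \<in> topspace Y" if "\<alpha> \<in> I" "x \<in> topspace (S \<alpha>)" "t \<in> topspace Z" for \<alpha> x t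
    using continuous_map_image_subset_topspace[OF assms[OF that(1)]] that by force
  ultimately show ?thesis
    by (auto simp: continuous_map_def)
qed

section \<open>The wedge as a pointed space with an action\<close>

context
  fixes G :: "('g, 'k) monoid_scheme" and X :: "'i \<Rightarrow> ('g, 'a) pgspace" and I :: "'i set"
  assumes G: "group G" and X: "\<And>\<alpha>. \<alpha> \<in> I \<Longrightarrow> pointed_action G (X \<alpha>)"
begin

lemma wedge_summand:
  assumes "\<alpha> \<in> I"
  shows "spt (X \<alpha>) \<in> topspace (spc (X \<alpha>))"
    and "\<And>g. g \<in> carrier G \<Longrightarrow> sact (X \<alpha>) g (spt (X \<alpha>)) = spt (X \<alpha>)"
    and "\<And>g. g \<in> carrier G \<Longrightarrow> continuous_map (spc (X \<alpha>)) (spc (X \<alpha>)) (sact (X \<alpha>) g)"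
    and "group_action G (topspace (spc (X \<alpha>))) (sact (X \<alpha>))"
  using X[OF assms] by (auto simp: pointed_action_def)

lemma summand_act_closed:
  "\<alpha> \<in> I \<Longrightarrow> g \<in> carrier G \<Longrightarrow> x \<in> topspace (spc (X \<alpha>)) \<Longrightarrow> sact (X \<alpha>) g x \<in> topspace (spc (X \<alpha>))"
  using group_action.element_image[OF wedge_summand(4)] by blast

text \<open>Needed because \<open>wedge_incl\<close> treats the base point by a case distinction,
  which the action has to respect.\<close>

lemma summand_act_base_iff:
  assumes "\<alpha> \<in> I" "g \<in> carrier G" "x \<in> topspace (spc (X \<alpha>))"
  shows "sact (X \<alpha>) g x = spt (X \<alpha>) \<longleftrightarrow> x = spt (X \<alpha>)"
  using group_action.inj_prop[OF wedge_summand(4)[OF assms(1)] assms(2)] wedge_summand(1,2)[OF assms(1)] assms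
  by (metis inj_onD)

lemma wedge_act_incl:
  assumes "\<alpha> \<in> I" "g \<in> carrier G" "x \<in> topspace (spc (X \<alpha>))"
  shows "sact (wedge X I) g (wedge_incl X \<alpha> x) = wedge_incl X \<alpha> (sact (X \<alpha>) g x)"
  using wedge_incl_in_points[of \<alpha> I x X] summand_act_base_iff[OF assms] assms
  by (auto simp: wedge_def wedge_incl_def)

lemma wedge_act_None: "sact (wedge X I) g None = None"
  by (simp add: wedge_def wedge_points_def)

lemma pointed_action_wedge: "pointed_action G (wedge X I)"
  unfolding pointed_action_def
proof (intro conjI ballI)
  have top: "topspace (spc (wedge X I)) = wedge_points X I"
    by (simp add: wedge_def)
  interpret group G by (rule G)
  have cl: "sact (wedge X I) g p \<in> wedge_points X I" if g: "g \<in> carrier G" and p: "p \<in> wedge_points X I" for g p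
    using p
  proof (cases p rule: wedge_points_cases)
    case (2 \<alpha> x)
    then show ?thesis
      using g by (simp add: wedge_act_incl wedge_incl_in_points summand_act_closed)
  qed (simp add: wedge_act_None wedge_points_def)
  show "group_action G (topspace (spc (wedge X I))) (sact (wedge X I))"
    unfolding top
  proof (rule group_actionI[OF G])
    show "sact (wedge X I) \<one>\<^bsub>G\<^esub> p = p" if "p \<in> wedge_points X I" for p
      using that
    proof (cases p rule: wedge_points_cases)
      case (2 \<alpha> x)
      then have "sact (X \<alpha>) \<one>\<^bsub>G\<^esub> x = x"
        using group_action.id_eq_one[OF wedge_summand(4)] by (metis restrict_apply')
      then show ?thesis
        using 2 by (simp add: wedge_act_incl)
    qed (simp add: wedge_act_None)
    show "sact (wedge X I) (g \<otimes>\<^bsub>G\<^esub> h) p = sact (wedge X I) g (sact (wedge X I) h p)"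
      if g: "g \<in> carrier G" and h: "h \<in> carrier G" and p: "p \<in> wedge_points X I" for g h p
      using p
    proof (cases p rule: wedge_points_cases)
      case (2 \<alpha> x)
      then show ?thesis
        using g h group_action.composition_rule[OF wedge_summand(4)[OF 2(1)] 2(2) g h]
        by (simp add: wedge_act_incl summand_act_closed)
    qed (simp add: wedge_act_None)
  qed (use cl in \<open>auto simp: wedge_def\<close>)
  show "continuous_map (spc (wedge X I)) (spc (wedge X I)) (sact (wedge X I) g)" if g: "g \<in> carrier G" for g
  proof -
    have "continuous_map (wedge_topology X I) (wedge_topology X I) (sact (wedge X I) g)"
    proof (rule continuous_map_from_wedge)
      fix \<alpha> assume \<alpha>: "\<alpha> \<in> I"
      have "continuous_map (spc (X \<alpha>)) (wedge_topology X I) (wedge_incl X \<alpha> \<circ> sact (X \<alpha>) g)"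
        by (rule continuous_map_compose[OF wedge_summand(3)[OF \<alpha> g] continuous_map_wedge_incl[OF \<alpha>, of X]])
      then show "continuous_map (spc (X \<alpha>)) (wedge_topology X I) (\<lambda>x. sact (wedge X I) g (wedge_incl X \<alpha> x))"
        by (rule continuous_map_eq) (simp add: wedge_act_incl[OF \<alpha> g])
    qed (simp add: wedge_act_None wedge_points_def)
    then show ?thesis
      by (simp add: wedge_def)
  qed
  show "spt (wedge X I) \<in> topspace (spc (wedge X I))"
    unfolding top by (simp add: wedge_def wedge_points_def)
  show "sact (wedge X I) g (spt (wedge X I)) = spt (wedge X I)" for g
    using wedge_act_None by (simp add: wedge_def)
qed

lemma pointed_gmap_wedge_incl:
  assumes \<alpha>: "\<alpha> \<in> I"
  shows "pointed_gmap G (X \<alpha>) (wedge X I) (wedge_incl X \<alpha>)"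
  using continuous_map_wedge_incl[OF \<alpha>, of X] wedge_act_incl[OF \<alpha>]
  by (simp add: pointed_gmap_def wedge_def wedge_incl_def)

lemma pointed_gmap_wedge_retract:
  assumes \<alpha>: "\<alpha> \<in> I"
  shows "pointed_gmap G (wedge X I) (X \<alpha>) (wedge_retract X \<alpha>)"
  unfolding pointed_gmap_def
proof (intro conjI ballI)
  have "continuous_map (wedge_topology X I) (spc (X \<alpha>)) (wedge_retract X \<alpha>)"
  proof (rule continuous_map_from_wedge)
    show "continuous_map (spc (X \<beta>)) (spc (X \<alpha>)) (\<lambda>x. wedge_retract X \<alpha> (wedge_incl X \<beta> x))" for \<beta>
      by (cases "\<beta> = \<alpha>") (simp_all add: wedge_retract_incl wedge_summand(1)[OF \<alpha>])
  qed (simp add: wedge_retract_def wedge_summand(1)[OF \<alpha>])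
  then show "continuous_map (spc (wedge X I)) (spc (X \<alpha>)) (wedge_retract X \<alpha>)"
    by (simp add: wedge_def)
  show "wedge_retract X \<alpha> (spt (wedge X I)) = spt (X \<alpha>)"
    by (simp add: wedge_def wedge_retract_def)
  fix g p assume g: "g \<in> carrier G" and "p \<in> topspace (spc (wedge X I))"
  then have "p \<in> wedge_points X I"
    by (simp add: wedge_def)
  then show "wedge_retract X \<alpha> (sact (wedge X I) g p) = sact (X \<alpha>) g (wedge_retract X \<alpha> p)"
  proof (cases p rule: wedge_points_cases)
    case 1
    then show ?thesis
      using wedge_summand(2)[OF \<alpha> g] by (simp add: wedge_act_None wedge_retract_def)
  next
    case (2 \<beta> x)
    then show ?thesis
      using g wedge_summand(2)[OF \<alpha> g] by (simp add: wedge_act_incl wedge_retract_incl)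
  qed
qed

text \<open>The open sets \<open>{eW < 1}\<close> of the summands and \<open>{eW > 0}\<close> cover the wedge, whether or not the
  base points are closed.\<close>

lemma wedge_contraction:
  assumes D: "\<And>\<alpha>. \<alpha> \<in> I \<Longrightarrow> contraction_data G (X \<alpha>) (D \<alpha>) (e \<alpha>)"
  defines "DW \<equiv> \<lambda>(p, t). case p of None \<Rightarrow> None | Some (\<alpha>, x) \<Rightarrow> wedge_incl X \<alpha> (D \<alpha> (x, t))"
    and "eW \<equiv> \<lambda>p. case p of None \<Rightarrow> 1 | Some (\<alpha>, x) \<Rightarrow> e \<alpha> x"
  shows "contraction_data G (wedge X I) DW eW"
    and "\<And>\<alpha> x. \<alpha> \<in> I \<Longrightarrow> x \<in> topspace (spc (X \<alpha>)) \<Longrightarrow>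
      DW (wedge_incl X \<alpha> x, 1) \<in> wedge_incl X \<alpha> ` topspace (spc (X \<alpha>))"
    and "\<And>\<alpha>. \<alpha> \<in> I \<Longrightarrow> openin (spc (wedge X I)) {p \<in> wedge_incl X \<alpha> ` topspace (spc (X \<alpha>)). eW p < 1}"
proof -
  have D': "continuous_map (prod_topology (spc (X \<alpha>)) (top_of_set {0..1})) (spc (X \<alpha>)) (D \<alpha>)"
    "\<And>x. x \<in> topspace (spc (X \<alpha>)) \<Longrightarrow> D \<alpha> (x, 0) = x"
    "\<And>t. t \<in> {0..1} \<Longrightarrow> D \<alpha> (spt (X \<alpha>), t) = spt (X \<alpha>)"
    "\<And>g x t. g \<in> carrier G \<Longrightarrow> x \<in> topspace (spc (X \<alpha>)) \<Longrightarrow> t \<in> {0..1} \<Longrightarrow>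
       D \<alpha> (sact (X \<alpha>) g x, t) = sact (X \<alpha>) g (D \<alpha> (x, t))"
    "continuous_map (spc (X \<alpha>)) euclideanreal (e \<alpha>)" "e \<alpha> (spt (X \<alpha>)) = 1"
    "\<And>x. x \<in> topspace (spc (X \<alpha>)) \<Longrightarrow> 0 < e \<alpha> x \<Longrightarrow> D \<alpha> (x, 1) = spt (X \<alpha>)" if "\<alpha> \<in> I" for \<alpha>
    using D[OF that] by (auto simp: contraction_data_def)
  have Dcl: "D \<alpha> (x, t) \<in> topspace (spc (X \<alpha>))"
    if "\<alpha> \<in> I" "x \<in> topspace (spc (X \<alpha>))" "t \<in> {0..1}" for \<alpha> x t
    using continuous_map_image_subset_topspace[OF D'(1)[OF that(1)]] that by auto
  have DW_incl: "DW (wedge_incl X \<alpha> x, t) = wedge_incl X \<alpha> (D \<alpha> (x, t))" if "\<alpha> \<in> I" "t \<in> {0..1}" for \<alpha> x t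
    using D'(3)[OF that] by (auto simp: DW_def wedge_incl_def)
  have DW_None: "DW (None, t) = None" for t
    by (simp add: DW_def)
  have eW_incl: "eW (wedge_incl X \<alpha> x) = e \<alpha> x" if "\<alpha> \<in> I" for \<alpha> x
    using D'(6)[OF that] by (auto simp: eW_def wedge_incl_def)
  have top: "topspace (spc (wedge X I)) = wedge_points X I" "spc (wedge X I) = wedge_topology X I" "spt (wedge X I) = None"
    by (simp_all add: wedge_def)
  have cont: "continuous_map (prod_topology (wedge_topology X I) (top_of_set {0..1})) (wedge_topology X I) DW"
  \<comment> \<open>The wedge of the empty family is a point and thus no quotient of the empty
    sum.\<close>
  proof (cases "I = {}")
    case True
    then have W: "wedge_points X I = {None}"
      by (simp add: wedge_points_def)
    have "continuous_map (prod_topology (wedge_topology X I) (top_of_set {0..1::real})) (wedge_topology X I) (\<lambda>_. None)"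
      by (simp add: W)
    then show ?thesis
      by (rule continuous_map_eq) (auto simp: W DW_None)
  next
    case False
    \<comment> \<open>The product of a quotient map with a locally compact Hausdorff space is again
      a quotient map, so the homotopy may be checked on each summand times [0,1].\<close>
    have "compact_space (top_of_set {0..1::real})" "Hausdorff_space (top_of_set {0..1::real})"
      by (auto simp: compact_space_subtopology Hausdorff_space_subtopology)
    then have "quotient_map (prod_topology (sum_topology (\<lambda>\<alpha>. spc (X \<alpha>)) I) (top_of_set {0..1::real}))
        (prod_topology (wedge_topology X I) (top_of_set {0..1})) (\<lambda>(y, t). ((\<lambda>(\<alpha>, x). wedge_incl X \<alpha> x) y, t))"
      by (intro quotient_map_prod_left compact_imp_locally_compact_space quotient_map_wedge[OF False] wedge_summand(1)) auto
    then show ?thesis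
    proof (rule continuous_compose_quotient_map)
      show "continuous_map (prod_topology (sum_topology (\<lambda>\<alpha>. spc (X \<alpha>)) I) (top_of_set {0..1::real})) (wedge_topology X I)
          (DW \<circ> (\<lambda>(y, t). ((\<lambda>(\<alpha>, x). wedge_incl X \<alpha> x) y, t)))"
      proof (rule continuous_map_from_sum_prod)
        fix \<alpha> assume \<alpha>: "\<alpha> \<in> I"
        show "continuous_map (prod_topology (spc (X \<alpha>)) (top_of_set {0..1})) (wedge_topology X I)
            (\<lambda>(x, t). (DW \<circ> (\<lambda>(y, t). ((\<lambda>(\<alpha>, x). wedge_incl X \<alpha> x) y, t))) ((\<alpha>, x), t))"
          by (rule continuous_map_eq[OF continuous_map_compose[OF D'(1)[OF \<alpha>] continuous_map_wedge_incl[OF \<alpha>, of X]]])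
            (auto simp: DW_incl[OF \<alpha>])
      qed
    qed
  qed
  have eW_cont: "continuous_map (wedge_topology X I) euclideanreal eW"
    using D'(5) by (intro continuous_map_from_wedge) (simp_all add: eW_incl)
  show "contraction_data G (wedge X I) DW eW"
    unfolding contraction_data_def top(1) unfolding top(2,3)
  proof (intro conjI ballI impI cont eW_cont)
    show "DW (p, 0) = p" if "p \<in> wedge_points X I" for p
      using that
    proof (cases p rule: wedge_points_cases)
      case (2 \<alpha> x)
      then show ?thesis
        by (simp add: DW_incl D'(2))
    qed (simp add: DW_None)
    show "DW (sact (wedge X I) g p, t) = sact (wedge X I) g (DW (p, t))"
      if g: "g \<in> carrier G" and p: "p \<in> wedge_points X I" and t: "t \<in> {0..1}" for g p t
      using p
    proof (cases p rule: wedge_points_cases)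
      case (2 \<alpha> x)
      then show ?thesis
        using g t by (simp add: DW_incl D'(4) wedge_act_incl Dcl)
    qed (simp add: DW_None wedge_act_None)
    show "DW (p, 1) = None" if "p \<in> wedge_points X I" "0 < eW p" for p
      using that(1)
    proof (cases p rule: wedge_points_cases)
      case (2 \<alpha> x)
      then show ?thesis
        using that(2) D'(7)[OF 2(1,2)] by (simp add: DW_incl eW_incl wedge_incl_def[of X \<alpha> "spt (X \<alpha>)"])
    qed (simp add: DW_None)
  qed (simp_all add: DW_None eW_def)
  show "DW (wedge_incl X \<alpha> x, 1) \<in> wedge_incl X \<alpha> ` topspace (spc (X \<alpha>))"
    if "\<alpha> \<in> I" "x \<in> topspace (spc (X \<alpha>))" for \<alpha> x
    using DW_incl[OF that(1), of 1 x] Dcl[OF that, of 1] by simp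
  show "openin (spc (wedge X I)) {p \<in> wedge_incl X \<alpha> ` topspace (spc (X \<alpha>)). eW p < 1}" if \<alpha>: "\<alpha> \<in> I" for \<alpha>
    unfolding top(2) openin_wedge_topology
  proof (intro conjI ballI)
    show "{p \<in> wedge_incl X \<alpha> ` topspace (spc (X \<alpha>)). eW p < 1} \<subseteq> wedge_points X I"
      using wedge_incl_in_points[OF \<alpha>, where X = X] by auto
    fix \<beta> assume \<beta>: "\<beta> \<in> I"
    \<comment> \<open>On a different summand only the base point could lie in the image of
      \<open>X \<alpha>\<close>, and it is excluded since \<open>eW\<close> is 1 there.\<close>
    have "{x \<in> topspace (spc (X \<beta>)). wedge_incl X \<beta> x \<in> {p \<in> wedge_incl X \<alpha> ` topspace (spc (X \<alpha>)). eW p < 1}} =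
        (if \<beta> = \<alpha> then {x \<in> topspace (spc (X \<alpha>)). e \<alpha> x \<in> {..<1}} else {})"
    proof (cases "\<beta> = \<alpha>")
      case True
      then show ?thesis
        by (auto simp: eW_incl[OF \<alpha>])
    next
      case False
      have "x = spt (X \<beta>)" if "wedge_incl X \<beta> x = wedge_incl X \<alpha> y" for x y
        using that False by (auto simp: wedge_incl_def split: if_splits)
      then show ?thesis
        using False eW_incl[OF \<beta>] D'(6)[OF \<beta>] by auto
    qed
    then show "openin (spc (X \<beta>)) {x \<in> topspace (spc (X \<beta>)). wedge_incl X \<beta> x \<in> {p \<in> wedge_incl X \<alpha> ` topspace (spc (X \<alpha>)). eW p < 1}}"
      using openin_continuous_map_preimage[OF D'(5)[OF \<alpha>], of "{..<1}"] by auto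
  qed
qed

end

section \<open>Homology of the wedge\<close>

lemma (in module) submodule_of_submodule:
  assumes Z: "submodule Z R M" and B: "submodule B R M" and "B \<subseteq> Z"
  shows "submodule B R (M\<lparr>carrier := Z\<rparr>)"
proof (rule module.submoduleI_smult[OF submodule.submodule_is_module[OF Z module_axioms]])
  show "B \<subseteq> carrier (M\<lparr>carrier := Z\<rparr>)" "\<zero>\<^bsub>M\<lparr>carrier := Z\<rparr>\<^esub> \<in> B"
    using \<open>B \<subseteq> Z\<close> subgroup.one_closed[OF submodule.axioms(1)[OF B]] by auto
qed (use submoduleE[OF B] in auto)

lemma mod_hom_kernel_submodule:
  assumes M: "module R M" and N: "module R N" and h: "h \<in> mod_hom R M N"
  shows "submodule {u \<in> carrier M. h u = \<zero>\<^bsub>N\<^esub>} R M"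
proof -
  interpret N: module R N by fact
  show ?thesis
    by (rule submodule_Collect[OF M module.carrier_is_submodule[OF M]])
      (auto simp: mod_hom_zero[OF M N h] mod_hom_add[OF h] mod_hom_smult[OF h])
qed

lemma mod_hom_image_submodule:
  assumes M: "module R M" and N: "module R N" and h: "h \<in> mod_hom R M N"
  shows "submodule (h ` carrier M) R N"
proof (rule module.submoduleI_smult[OF N])
  interpret M: module R M by fact
  show "h ` carrier M \<subseteq> carrier N"
    using mod_hom_closed[OF h] by blast
  show "\<zero>\<^bsub>N\<^esub> \<in> h ` carrier M"
    using mod_hom_zero[OF M N h] by (metis M.zero_closed image_eqI)
  show "a \<oplus>\<^bsub>N\<^esub> b \<in> h ` carrier M" if "a \<in> h ` carrier M" "b \<in> h ` carrier M" for a b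
    using that mod_hom_add[OF h] M.a_closed by (metis (no_types, lifting) image_iff)
  show "r \<odot>\<^bsub>N\<^esub> a \<in> h ` carrier M" if "r \<in> carrier R" "a \<in> h ` carrier M" for r a
    using that mod_hom_smult[OF h] M.smult_closed by (metis (no_types, lifting) image_iff)
qed

section \<open>The chain complex and its maps in terms of induced homomorphisms\<close>

context coefficients
begin

definition gchain_map ::
    "('g, 'a) pgspace \<Rightarrow> ('g, 'b) pgspace \<Rightarrow> ('a \<Rightarrow> 'b) \<Rightarrow> nat \<Rightarrow> (((nat \<Rightarrow> real) \<Rightarrow> 'a) \<Rightarrow> 'm) \<Rightarrow> ((nat \<Rightarrow> real) \<Rightarrow> 'b) \<Rightarrow> 'm"
  where "gchain_map X Y f q = induced (singular_gset q X) (singular_gset q Y) (\<lambda>\<sigma>. frag_of (simplex_map q f \<sigma>))"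

abbreviation boundary_map ::
    "('g, 'a) pgspace \<Rightarrow> nat \<Rightarrow> (((nat \<Rightarrow> real) \<Rightarrow> 'a) \<Rightarrow> 'm) \<Rightarrow> ((nat \<Rightarrow> real) \<Rightarrow> 'a) \<Rightarrow> 'm" where
  "boundary_map X q \<equiv> induced (singular_gset q X) (singular_gset (q - 1) X) (simplex_boundary q)"

lemma singular_gset_pointed: "pointed_action G X \<Longrightarrow> pointed_gset G (singular_gset q X)"
  by (rule pointed_gset_singular[OF is_group])

lemma module_gchains: "pointed_action G X \<Longrightarrow> module R (gchains G M X q)"
  unfolding gchains_def by (intro module_fixed_module singular_gset_pointed)

lemma boundary_map_hom:
  "pointed_action G X \<Longrightarrow> boundary_map X q \<in> mod_hom R (gchains G M X q) (gchains G M X (q - 1))"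
  unfolding gchains_def by (intro induced_hom singular_gset_pointed equivariant_chain_boundary)

lemma gchain_map_hom:
  assumes "pointed_action G X" "pointed_action G Y" "pointed_gmap G X Y f"
  shows "gchain_map X Y f q \<in> mod_hom R (gchains G M X q) (gchains G M Y q)"
  unfolding gchains_def gchain_map_def
  using assms by (intro induced_hom singular_gset_pointed equivariant_chain_gmap)

text \<open>By \<open>induced_comp\<close> the composite is induced by the family of double
  boundaries of simplices, which is zero on integral chains.\<close>

lemma boundary_map_boundary_map:
  assumes X: "pointed_action G X" and u: "u \<in> carrier (gchains G M X (Suc q))"
  shows "boundary_map X q (boundary_map X (Suc q) u) = \<zero>\<^bsub>gchains G M X (q - 1)\<^esub>"
proof -
  note S = singular_gset_pointed[OF X]
  note bd = equivariant_chain_boundary[OF X, of q] and bd' = equivariant_chain_boundary[OF X, of "Suc q", simplified]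
  have "boundary_map X q (boundary_map X (Suc q) u) =
      induced (singular_gset (Suc q) X) (singular_gset (q - 1) X) (\<lambda>\<sigma>. frag_extend (simplex_boundary q) (simplex_boundary (Suc q) \<sigma>)) u"
    using induced_comp[OF S S S bd' bd] u by (simp add: gchains_def)
  also have "\<dots> = \<zero>\<^bsub>fixed_module G M (singular_gset (q - 1) X)\<^esub>"
  proof (rule fixed_hom_eqI[OF S module_fixed_module[OF S] induced_hom[OF S S equivariant_chain_comp[OF S S S bd' bd]]])
    interpret N: module R "fixed_module G M (singular_gset (q - 1) X)"
      by (rule module_fixed_module[OF S])
    show "(\<lambda>u. \<zero>\<^bsub>fixed_module G M (singular_gset (q - 1) X)\<^esub>) \<in>
        mod_hom R (fixed_module G M (singular_gset (Suc q) X)) (fixed_module G M (singular_gset (q - 1) X))"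
      by (rule mod_homI) (simp_all del: One_nat_def)
    fix \<sigma> l assume \<sigma>: "\<sigma> \<in> points (singular_gset (Suc q) X)"
      and l: "l \<in> carrier (coeff_at G M (singular_gset (Suc q) X) \<sigma>)"
    have "singular_chain (Suc q) (spc X) (frag_of \<sigma>)"
      using \<sigma> by (simp add: singular_gset_def singular_chain_of)
    then have "frag_extend (simplex_boundary q) (simplex_boundary (Suc q) \<sigma>) = 0"
      unfolding frag_extend_simplex_boundary by (simp add: simplex_boundary_def chain_boundary_boundary_alt)
    then show "induced (singular_gset (Suc q) X) (singular_gset (q - 1) X)
        (\<lambda>\<sigma>. frag_extend (simplex_boundary q) (simplex_boundary (Suc q) \<sigma>)) (gamma G M (singular_gset (Suc q) X) \<sigma> l) =
        \<zero>\<^bsub>fixed_module G M (singular_gset (q - 1) X)\<^esub>"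
      unfolding induced_gamma[OF S S equivariant_chain_comp[OF S S S bd' bd] \<sigma> l]
      using chain_gamma_0[OF S isotropy_subgroup[OF S \<sigma>] l] by simp
  qed (use u in \<open>simp add: gchains_def\<close>)
  finally show ?thesis
    by (simp add: gchains_def)
qed

lemma boundary_gchain_map:
  assumes X: "pointed_action G X" and Y: "pointed_action G Y" and f: "pointed_gmap G X Y f"
    and u: "u \<in> carrier (gchains G M X q)"
  shows "boundary_map Y q (gchain_map X Y f q u) = gchain_map X Y f (q - 1) (boundary_map X q u)"
proof -
  note S = singular_gset_pointed[OF X] and T = singular_gset_pointed[OF Y]
  note bdX = equivariant_chain_boundary[OF X, of q] and bdY = equivariant_chain_boundary[OF Y, of q]
  note ef = equivariant_chain_gmap(1)[OF X Y f]
  have u': "u \<in> carrier (fixed_module G M (singular_gset q X))"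
    using u by (simp add: gchains_def)
  have "frag_extend (simplex_boundary q) (frag_of (simplex_map q f \<sigma>)) =
      frag_extend (\<lambda>\<sigma>. frag_of (simplex_map (q - 1) f \<sigma>)) (simplex_boundary q \<sigma>)"
    if "\<sigma> \<in> points (singular_gset q X)" for \<sigma>
  proof -
    have "singular_chain q (spc X) (frag_of \<sigma>)"
      using that by (simp add: singular_gset_def singular_chain_of)
    from chain_boundary_chain_map[OF this, of f] show ?thesis
      by (simp add: simplex_boundary_def chain_map_def comp_def)
  qed
  then show ?thesis
    unfolding gchain_map_def induced_comp[OF S T T ef bdY u'] induced_comp[OF S S T bdX ef u']
    by (rule induced_cong[OF S T equivariant_chain_comp[OF S T T ef bdY] equivariant_chain_comp[OF S S T bdX ef] _ u'])
qed

lemma gcycles_eq: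
  assumes "pointed_action G X"
  shows "gcycles G R M X q = {u \<in> carrier (gchains G M X q). boundary_map X q u = \<zero>\<^bsub>gchains G M X (q - 1)\<^esub>}"
  using gboundary_eq_induced[OF assms] by (auto simp: gcycles_def)

lemma gboundaries_eq:
  assumes "pointed_action G X"
  shows "gboundaries G R M X q = boundary_map X (Suc q) ` carrier (gchains G M X (Suc q))"
  using gboundary_eq_induced[OF assms, of _ "Suc q"] by (auto simp: gboundaries_def)

lemma gcycles_submodule:
  assumes "pointed_action G X"
  shows "submodule (gcycles G R M X q) R (gchains G M X q)"
  unfolding gcycles_eq[OF assms]
  by (intro mod_hom_kernel_submodule[OF module_gchains module_gchains boundary_map_hom] assms)

lemma gboundaries_submodule:
  assumes "pointed_action G X"
  shows "submodule (gboundaries G R M X q) R (gchains G M X q)"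
  unfolding gboundaries_eq[OF assms]
  using mod_hom_image_submodule[OF module_gchains module_gchains boundary_map_hom] assms
  by (metis diff_Suc_1)

lemma gboundaries_subset_gcycles:
  assumes "pointed_action G X"
  shows "gboundaries G R M X q \<subseteq> gcycles G R M X q"
  unfolding gcycles_eq[OF assms] gboundaries_eq[OF assms]
  using mod_hom_closed[OF boundary_map_hom[OF assms, of "Suc q"]] boundary_map_boundary_map[OF assms] by auto

lemma gchain_map_gcycles:
  assumes X: "pointed_action G X" and Y: "pointed_action G Y" and f: "pointed_gmap G X Y f"
    and u: "u \<in> gcycles G R M X q"
  shows "gchain_map X Y f q u \<in> gcycles G R M Y q"
  using u boundary_gchain_map[OF X Y f, of u q] mod_hom_closed[OF gchain_map_hom[OF X Y f]]
    mod_hom_zero[OF module_gchains[OF X] module_gchains[OF Y] gchain_map_hom[OF X Y f]]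
  by (auto simp: gcycles_eq[OF X] gcycles_eq[OF Y])

lemma gchain_map_gboundaries:
  assumes X: "pointed_action G X" and Y: "pointed_action G Y" and f: "pointed_gmap G X Y f"
  shows "gchain_map X Y f q ` gboundaries G R M X q \<subseteq> gboundaries G R M Y q"
proof
  fix v assume "v \<in> gchain_map X Y f q ` gboundaries G R M X q"
  then obtain u where u: "u \<in> carrier (gchains G M X (Suc q))" "v = gchain_map X Y f q (boundary_map X (Suc q) u)"
    by (auto simp: gboundaries_eq[OF X])
  then have "v = boundary_map Y (Suc q) (gchain_map X Y f (Suc q) u)"
    using boundary_gchain_map[OF X Y f u(1)] by simp
  then show "v \<in> gboundaries G R M Y q"
    using mod_hom_closed[OF gchain_map_hom[OF X Y f] u(1)] by (auto simp: gboundaries_eq[OF Y])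
qed

lemma gchain_map_comp_gamma:
  assumes X: "pointed_action G X" and Y: "pointed_action G Y" and Z: "pointed_action G Z"
    and f: "pointed_gmap G X Y f" and k: "pointed_gmap G Y Z k"
    and \<sigma>: "\<sigma> \<in> points (singular_gset q X)" and l: "l \<in> carrier (coeff_at G M (singular_gset q X) \<sigma>)"
  shows "gchain_map Y Z k q (gchain_map X Y f q (gamma G M (singular_gset q X) \<sigma> l)) =
    chain_gamma (singular_gset q Z) (isotropy G (singular_gset q X) \<sigma>) l (frag_of (simplex_map q k (simplex_map q f \<sigma>)))"
proof -
  note S = singular_gset_pointed[OF X] and T = singular_gset_pointed[OF Y] and U = singular_gset_pointed[OF Z]
  note ef = equivariant_chain_gmap(1)[OF X Y f] and ek = equivariant_chain_gmap(1)[OF Y Z k]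
  show ?thesis
    unfolding gchain_map_def induced_comp[OF S T U ef ek gamma_closed[OF S \<sigma> l]]
      induced_gamma[OF S U equivariant_chain_comp[OF S T U ef ek] \<sigma> l]
    by simp
qed

text \<open>The prism operators h on the universal chains satisfy \<phi> - id = dh + hd on integral
  chains, with d the boundary. The families being equivariant, the identity holds with coefficients
  in M, and on a cycle the term hd vanishes.\<close>

lemma subdivided_deformation:
  fixes q n :: nat
  assumes W: "pointed_action G W" and D: "contraction_data G W D e"
  defines "\<phi> \<equiv> \<lambda>\<sigma>. chain_map q (\<lambda>p. D (p, 1)) ((singular_subdivision q ^^ n) (frag_of \<sigma>))"
  shows "equivariant_chain (singular_gset q W) (singular_gset q W) \<phi>"
    and "\<And>z. z \<in> gcycles G R M W q \<Longrightarrow>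
      induced (singular_gset q W) (singular_gset q W) \<phi> z \<ominus>\<^bsub>gchains G M W q\<^esub> z \<in> gboundaries G R M W q"
proof -
  have Dcont: "continuous_map (prod_topology (spc W) (top_of_set {0..1})) (spc W) D"
    and D0: "\<And>x. x \<in> topspace (spc W) \<Longrightarrow> D (x, 0) = x"
    and Dpt: "\<And>t. t \<in> {0..1} \<Longrightarrow> D (spt W, t) = spt W"
    and Dact: "\<And>g x t. g \<in> carrier G \<Longrightarrow> x \<in> topspace (spc W) \<Longrightarrow> t \<in> {0..1} \<Longrightarrow> D (sact W g x, t) = sact W g (D (x, t))"
    using D by (auto simp: contraction_data_def)
  note S = singular_gset_pointed[OF W]
  have \<sigma>_in: "\<sigma> y \<in> topspace (spc W)" if "singular_simplex p (spc W) \<sigma>" "y \<in> standard_simplex p" for p \<sigma> y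
    using continuous_map_image_subset_topspace[OF singular_simplex_continuous[OF that(1)]] that(2) by auto
  obtain P where P: "\<And>p. prism_chain n p (P (p - 1)) (P p)"
    using prism_chains_exist by blast
  have P_chain: "singular_chain (Suc p) (prism_space p) (P p)" for p
    using P[of p] by (simp add: prism_chain_def)
  define h where "h p \<sigma> = prism (P p) D p (frag_of \<sigma>)" for p \<sigma>
  have h: "equivariant_chain (singular_gset p W) (singular_gset (Suc p) W) (h p)" for p
  proof -
    have "equivariant_chain (singular_gset p W) (singular_gset (Suc p) W)
        (\<lambda>\<sigma>. chain_map (Suc p) (\<lambda>(y, t). D (\<sigma> y, t)) (P p))"
      by (rule equivariant_chain_natural[OF W W P_chain continuous_map_prism[OF singular_simplex_continuous Dcont]])
        (auto simp: simplex_map_def Dact \<sigma>_in Dpt)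
    then show ?thesis
      by (simp add: h_def[abs_def] prism_def)
  qed
  show \<phi>: "equivariant_chain (singular_gset q W) (singular_gset q W) \<phi>"
  proof (rule equivariant_chain_cong[OF S])
    let ?c = "(singular_subdivision q ^^ n) (identity_simplex q)"
    have D1: "continuous_map (simplex_space q) (spc W) (\<lambda>y. D (\<sigma> y, 1))" if "singular_simplex q (spc W) \<sigma>" for \<sigma>
      using continuous_map_compose[OF continuous_map_end[of 1] continuous_map_prism[OF singular_simplex_continuous[OF that] Dcont]]
      by (simp add: comp_def)
    show "equivariant_chain (singular_gset q W) (singular_gset q W) (\<lambda>\<sigma>. chain_map q (\<lambda>y. D (\<sigma> y, 1)) ?c)"
      by (rule equivariant_chain_natural[OF W W singular_chain_iterated_subdivision[OF identity_simplex_chain] D1])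
        (auto simp: simplex_map_def Dact \<sigma>_in Dpt)
    show "chain_map q (\<lambda>y. D (\<sigma> y, 1)) ?c = \<phi> \<sigma>" if "\<sigma> \<in> points (singular_gset q W)" for \<sigma>
    proof -
      have \<sigma>: "singular_simplex q (spc W) \<sigma>"
        using that by (simp add: singular_gset_def)
      have "\<phi> \<sigma> = chain_map q (\<lambda>p. D (p, 1)) (chain_map q \<sigma> ?c)"
        using naturality_iterated_subdivision[OF identity_simplex_chain, of n q \<sigma>] singular_simplex_chain_map_id[OF \<sigma>]
        by (simp add: \<phi>_def)
      also have "\<dots> = chain_map q (\<lambda>y. D (\<sigma> y, 1)) ?c"
        unfolding chain_map_compose[THEN fun_cong, unfolded comp_apply, symmetric] by (simp add: comp_def)
      finally show ?thesis ..
    qed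
  qed
  have bd_h: "frag_extend (simplex_boundary (Suc q)) (h q \<sigma>) =
      \<phi> \<sigma> - frag_of \<sigma> - frag_extend (h (q - 1)) (simplex_boundary q \<sigma>)"
    if "\<sigma> \<in> points (singular_gset q W)" for \<sigma>
  proof -
    have \<sigma>: "singular_simplex q (spc W) \<sigma>"
      using that by (simp add: singular_gset_def)
    have id: "chain_map q (\<lambda>y. D (y, 0)) (frag_of \<sigma>) = frag_of \<sigma>"
      using simplex_map_id_gen[OF \<sigma> D0] by simp
    have "prism (P (q - 1)) D (q - 1) (chain_boundary q (frag_of \<sigma>)) = frag_extend (h (q - 1)) (simplex_boundary q \<sigma>)"
      by (simp add: h_def[abs_def] prism_def simplex_boundary_def)
    moreover have "singular_chain q (prism_space (q - 1)) (P (q - 1))" if "0 < q"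
      using P_chain[of "q - 1"] that by simp
    ultimately show ?thesis
      unfolding frag_extend_simplex_boundary
      using chain_boundary_prism[OF P _ Dcont, of q "frag_of \<sigma>"] \<sigma>
      by (simp add: h_def \<phi>_def id singular_chain_of del: chain_map_of)
  qed
  fix z assume z: "z \<in> gcycles G R M W q"
  let ?C = "gchains G M W q"
  interpret C: module R ?C
    by (rule module_gchains[OF W])
  have zC: "z \<in> carrier (fixed_module G M (singular_gset q W))"
    and bdz: "boundary_map W q z = \<zero>\<^bsub>gchains G M W (q - 1)\<^esub>"
    using z by (auto simp: gcycles_eq[OF W] gchains_def)
  note bd = equivariant_chain_boundary[OF W, of "Suc q", simplified]
  note id = equivariant_chain_identity
  let ?\<delta> = "\<lambda>\<sigma>. \<phi> \<sigma> - frag_of \<sigma>"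
  have \<delta>: "equivariant_chain (singular_gset q W) (singular_gset q W) ?\<delta>"
    by (rule equivariant_chain_diff[OF \<phi> id])
  have "induced (singular_gset q W) (singular_gset q W) ?\<delta> z = boundary_map W (Suc q) (induced (singular_gset q W) (singular_gset (Suc q) W) (h q) z)"
  \<comment> \<open>For q = 0 truncated subtraction would make \<open>h (q - 1)\<close> raise the
    degree to 1 instead of q, so the term hd, which is zero there, is removed before families are
    composed.\<close>
  proof (cases "q = 0")
    case True
    have "induced (singular_gset q W) (singular_gset q W) ?\<delta> z =
        induced (singular_gset q W) (singular_gset q W) (\<lambda>\<sigma>. frag_extend (simplex_boundary (Suc q)) (h q \<sigma>)) z"
      by (rule induced_cong[OF S S \<delta> equivariant_chain_comp[OF S S S h bd] _ zC])
        (use bd_h True in \<open>simp add: simplex_boundary_def[of 0] chain_boundary_def\<close>)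
    then show ?thesis
      using induced_comp[OF S S S h bd zC] by simp
  next
    case False
    then have q: "Suc (q - 1) = q"
      by simp
    note h' = h[of "q - 1", unfolded q]
    let ?k = "\<lambda>\<sigma>. frag_extend (h (q - 1)) (simplex_boundary q \<sigma>)"
    have bd': "equivariant_chain (singular_gset q W) (singular_gset (q - 1) W) (simplex_boundary q)"
      by (rule equivariant_chain_boundary[OF W])
    have k: "equivariant_chain (singular_gset q W) (singular_gset q W) ?k"
      by (rule equivariant_chain_comp[OF S S S bd' h'])
    have k0: "induced (singular_gset q W) (singular_gset q W) ?k z = \<zero>\<^bsub>?C\<^esub>"
      using induced_comp[OF S S S bd' h' zC] bdz
        mod_hom_zero[OF module_fixed_module[OF S] module_fixed_module[OF S] induced_hom[OF S S h']]
      by (simp add: gchains_def)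
    have \<delta>C: "induced (singular_gset q W) (singular_gset q W) ?\<delta> z \<in> carrier ?C"
      using mod_hom_closed[OF induced_hom[OF S S \<delta>] zC] by (simp add: gchains_def)
    have "boundary_map W (Suc q) (induced (singular_gset q W) (singular_gset (Suc q) W) (h q) z) =
        induced (singular_gset q W) (singular_gset q W) (\<lambda>\<sigma>. frag_extend (simplex_boundary (Suc q)) (h q \<sigma>)) z"
      using induced_comp[OF S S S h bd zC] by simp
    also have "\<dots> = induced (singular_gset q W) (singular_gset q W) (\<lambda>\<sigma>. ?\<delta> \<sigma> - ?k \<sigma>) z"
      by (rule induced_cong[OF S S equivariant_chain_comp[OF S S S h bd] equivariant_chain_diff[OF \<delta> k] bd_h zC])
    also have "\<dots> = induced (singular_gset q W) (singular_gset q W) ?\<delta> z \<ominus>\<^bsub>?C\<^esub> \<zero>\<^bsub>?C\<^esub>"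
      using induced_diff[OF S S \<delta> k zC] k0 by (simp add: gchains_def)
    finally show ?thesis
      using \<delta>C by (simp add: a_minus_def)
  qed
  moreover have "induced (singular_gset q W) (singular_gset (Suc q) W) (h q) z \<in> carrier (gchains G M W (Suc q))"
    using mod_hom_closed[OF induced_hom[OF S S h] zC] by (simp add: gchains_def)
  moreover have "induced (singular_gset q W) (singular_gset q W) ?\<delta> z =
      induced (singular_gset q W) (singular_gset q W) \<phi> z \<ominus>\<^bsub>?C\<^esub> z"
    using induced_diff[OF S S \<phi> id zC] induced_frag_of[OF S zC] by (simp add: gchains_def)
  ultimately show "induced (singular_gset q W) (singular_gset q W) \<phi> z \<ominus>\<^bsub>?C\<^esub> z \<in> gboundaries G R M W q"
    unfolding gboundaries_eq[OF W] by auto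
qed

lemma module_gcycles:
  "pointed_action G Y \<Longrightarrow> module R ((gchains G M Y q)\<lparr>carrier := gcycles G R M Y q\<rparr>)"
  by (intro submodule.submodule_is_module gcycles_submodule module_gchains)

lemma gboundaries_submodule_gcycles:
  "pointed_action G Y \<Longrightarrow>
    submodule (gboundaries G R M Y q) R ((gchains G M Y q)\<lparr>carrier := gcycles G R M Y q\<rparr>)"
  by (intro module.submodule_of_submodule module_gchains gcycles_submodule gboundaries_submodule
      gboundaries_subset_gcycles)

lemma gchain_map_gcycles_hom:
  assumes "pointed_action G Y" "pointed_action G Z" "pointed_gmap G Y Z f"
  shows "gchain_map Y Z f q \<in> mod_hom R ((gchains G M Y q)\<lparr>carrier := gcycles G R M Y q\<rparr>)
      ((gchains G M Z q)\<lparr>carrier := gcycles G R M Z q\<rparr>)"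
  using gchain_map_gcycles[OF assms] mod_hom_add[OF gchain_map_hom[OF assms]]
    mod_hom_smult[OF gchain_map_hom[OF assms]]
  by (intro mod_homI) (auto simp: gcycles_def)

section \<open>Splitting chains of the wedge over the summands\<close>

context
  fixes X :: "'i \<Rightarrow> ('g, 'a) pgspace" and I :: "'i set" and q :: nat
  assumes X: "\<And>\<alpha>. \<alpha> \<in> I \<Longrightarrow> pointed_action G (X \<alpha>)"
begin

abbreviation (input) "incl_chain \<equiv> \<lambda>\<alpha>. gchain_map (X \<alpha>) (wedge X I) (wedge_incl X \<alpha>) q"
abbreviation (input) "retract_chain \<equiv> \<lambda>\<alpha>. gchain_map (wedge X I) (X \<alpha>) (wedge_retract X \<alpha>) q"

lemma wedge_action: "pointed_action G (wedge X I)"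
  by (rule pointed_action_wedge[OF is_group]) (rule X)

lemma incl_gmap: "\<alpha> \<in> I \<Longrightarrow> pointed_gmap G (X \<alpha>) (wedge X I) (wedge_incl X \<alpha>)"
  by (rule pointed_gmap_wedge_incl[OF is_group]) (rule X)

lemma retract_gmap: "\<alpha> \<in> I \<Longrightarrow> pointed_gmap G (wedge X I) (X \<alpha>) (wedge_retract X \<alpha>)"
  by (rule pointed_gmap_wedge_retract[OF is_group]) (rule X)

lemma incl_hom:
  "\<alpha> \<in> I \<Longrightarrow> incl_chain \<alpha> \<in> mod_hom R (gchains G M (X \<alpha>) q) (gchains G M (wedge X I) q)"
  by (intro gchain_map_hom X wedge_action incl_gmap)

lemma retract_hom:
  "\<alpha> \<in> I \<Longrightarrow> retract_chain \<alpha> \<in> mod_hom R (gchains G M (wedge X I) q) (gchains G M (X \<alpha>) q)"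
  by (intro gchain_map_hom X wedge_action retract_gmap)

text \<open>Checked on generators: an inclusion followed by a retraction fixes a simplex, or sends
  it to the constant simplex at the base point, whose generator is zero.\<close>

lemma retract_incl_chain:
  assumes \<alpha>: "\<alpha> \<in> I" and \<beta>: "\<beta> \<in> I" and u: "u \<in> carrier (gchains G M (X \<alpha>) q)"
  shows "retract_chain \<beta> (incl_chain \<alpha> u) = (if \<beta> = \<alpha> then u else \<zero>\<^bsub>gchains G M (X \<beta>) q\<^esub>)"
proof -
  note S = singular_gset_pointed[OF X[OF \<alpha>], of q] and T = singular_gset_pointed[OF X[OF \<beta>], of q]
  let ?S = "singular_gset q (X \<alpha>)"
  interpret C: module R "gchains G M (X \<beta>) q"
    by (rule module_gchains[OF X[OF \<beta>]])
  have hom: "(\<lambda>u. retract_chain \<beta> (incl_chain \<alpha> u)) \<in> mod_hom R (fixed_module G M ?S) (gchains G M (X \<beta>) q)"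
    using mod_hom_comp[OF incl_hom retract_hom] \<alpha> \<beta> by (simp add: gchains_def)
  have simplex: "simplex_map q (wedge_retract X \<beta>) (simplex_map q (wedge_incl X \<alpha>) \<sigma>) =
      (if \<beta> = \<alpha> then \<sigma> else basept (singular_gset q (X \<beta>)))" if "\<sigma> \<in> points ?S" for \<sigma>
  proof -
    have "\<sigma> \<in> extensional (standard_simplex q)"
      using that by (simp add: singular_gset_def singular_simplex_def)
    then show ?thesis
      by (auto simp: simplex_map_def wedge_retract_incl singular_gset_def fun_eq_iff extensional_def)
  qed
  note comp = gchain_map_comp_gamma[OF X[OF \<alpha>] wedge_action X[OF \<beta>] incl_gmap[OF \<alpha>] retract_gmap[OF \<beta>]]
  show ?thesis
  proof (cases "\<beta> = \<alpha>")
    case True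
    have "retract_chain \<beta> (incl_chain \<alpha> u) = u"
    proof (rule fixed_hom_eqI[OF S C.module_axioms hom])
      show "(\<lambda>u. u) \<in> mod_hom R (fixed_module G M ?S) (gchains G M (X \<beta>) q)"
        using True by (intro mod_homI) (simp_all add: gchains_def)
      show "retract_chain \<beta> (incl_chain \<alpha> (gamma G M ?S \<sigma> l)) = gamma G M ?S \<sigma> l"
        if "\<sigma> \<in> points ?S" "l \<in> carrier (coeff_at G M ?S \<sigma>)" for \<sigma> l
        using comp[OF that] simplex[OF that(1)] chain_gamma_self[OF S that] True by simp
    qed (use u in \<open>simp add: gchains_def\<close>)
    then show ?thesis
      using True by simp
  next
    case False
    have "retract_chain \<beta> (incl_chain \<alpha> u) = \<zero>\<^bsub>gchains G M (X \<beta>) q\<^esub>"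
    proof (rule fixed_hom_eqI[OF S C.module_axioms hom])
      show "(\<lambda>u. \<zero>\<^bsub>gchains G M (X \<beta>) q\<^esub>) \<in> mod_hom R (fixed_module G M ?S) (gchains G M (X \<beta>) q)"
        by (intro mod_homI) simp_all
      show "retract_chain \<beta> (incl_chain \<alpha> (gamma G M ?S \<sigma> l)) = \<zero>\<^bsub>gchains G M (X \<beta>) q\<^esub>"
        if "\<sigma> \<in> points ?S" "l \<in> carrier (coeff_at G M ?S \<sigma>)" for \<sigma> l
        using comp[OF that] simplex[OF that(1)] False
          chain_gamma_base[OF T isotropy_subgroup[OF S that(1)] that(2), of "frag_of (basept (singular_gset q (X \<beta>)))"]
        by (simp add: gchains_def)
    qed (use u in \<open>simp add: gchains_def\<close>)
    then show ?thesis
      using False by simp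
  qed
qed

text \<open>The base simplex is added explicitly to cover the empty family; otherwise it is the
  image of the base simplex of any summand.\<close>

definition summand_simplices :: "((nat \<Rightarrow> real) \<Rightarrow> ('i \<times> 'a) option) set" where
  "summand_simplices = insert (basept (singular_gset q (wedge X I)))
     (\<Union>\<alpha>\<in>I. simplex_map q (wedge_incl X \<alpha>) ` points (singular_gset q (X \<alpha>)))"

definition partial_retract :: "'i set \<Rightarrow> (((nat \<Rightarrow> real) \<Rightarrow> ('i \<times> 'a) option) \<Rightarrow> 'm) \<Rightarrow> ((nat \<Rightarrow> real) \<Rightarrow> ('i \<times> 'a) option) \<Rightarrow> 'm" where
  "partial_retract J y = (\<Oplus>\<^bsub>gchains G M (wedge X I) q\<^esub>j\<in>J. incl_chain j (retract_chain j y))"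

text \<open>The chain is the sum of its retracts to finitely many summands. Asking for this with
  every larger finite index set allows two chains to be compared on the union of their index sets,
  so sums and differences split again.\<close>

definition split_chain :: "(((nat \<Rightarrow> real) \<Rightarrow> ('i \<times> 'a) option) \<Rightarrow> 'm) \<Rightarrow> bool" where
  "split_chain y \<longleftrightarrow> (\<exists>J. finite J \<and> J \<subseteq> I \<and>
     (\<forall>J'. finite J' \<longrightarrow> J \<subseteq> J' \<longrightarrow> J' \<subseteq> I \<longrightarrow> partial_retract J' y = y))"

lemma partial_retract_hom:
  "finite J \<Longrightarrow> J \<subseteq> I \<Longrightarrow>
    partial_retract J \<in> mod_hom R (gchains G M (wedge X I) q) (gchains G M (wedge X I) q)"
  unfolding partial_retract_def[abs_def]
  by (intro mod_hom_sum[OF module_gchains[OF wedge_action]] mod_hom_comp[OF retract_hom incl_hom]) auto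

lemma split_chain_0: "split_chain \<zero>\<^bsub>gchains G M (wedge X I) q\<^esub>"
  unfolding split_chain_def
  using mod_hom_zero[OF module_gchains[OF wedge_action] module_gchains[OF wedge_action] partial_retract_hom]
  by blast

lemma split_chain_diff:
  assumes y: "y \<in> carrier (gchains G M (wedge X I) q)" "split_chain y"
    and z: "z \<in> carrier (gchains G M (wedge X I) q)" "split_chain z"
  shows "split_chain (y \<ominus>\<^bsub>gchains G M (wedge X I) q\<^esub> z)"
proof -
  obtain J K where J: "finite J" "J \<subseteq> I" "\<And>J'. finite J' \<Longrightarrow> J \<subseteq> J' \<Longrightarrow> J' \<subseteq> I \<Longrightarrow> partial_retract J' y = y"
    and K: "finite K" "K \<subseteq> I" "\<And>J'. finite J' \<Longrightarrow> K \<subseteq> J' \<Longrightarrow> J' \<subseteq> I \<Longrightarrow> partial_retract J' z = z"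
    using y(2) z(2) unfolding split_chain_def by blast
  have "partial_retract J' (y \<ominus>\<^bsub>gchains G M (wedge X I) q\<^esub> z) = y \<ominus>\<^bsub>gchains G M (wedge X I) q\<^esub> z"
    if "finite J'" "J \<union> K \<subseteq> J'" "J' \<subseteq> I" for J'
    using mod_hom_minus[OF module_gchains[OF wedge_action] module_gchains[OF wedge_action]
        partial_retract_hom[OF that(1,3)] y(1) z(1)] J(3)[OF that(1) _ that(3)] K(3)[OF that(1) _ that(3)] that(2)
    by simp
  then show ?thesis
    unfolding split_chain_def using J(1,2) K(1,2) by (intro exI[of _ "J \<union> K"]) auto
qed

lemma split_chain_add:
  assumes y: "y \<in> carrier (gchains G M (wedge X I) q)" "split_chain y"
    and z: "z \<in> carrier (gchains G M (wedge X I) q)" "split_chain z"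
  shows "split_chain (y \<oplus>\<^bsub>gchains G M (wedge X I) q\<^esub> z)"
proof -
  interpret C: module R "gchains G M (wedge X I) q"
    by (rule module_gchains[OF wedge_action])
  have "split_chain (y \<ominus>\<^bsub>gchains G M (wedge X I) q\<^esub> (\<zero>\<^bsub>gchains G M (wedge X I) q\<^esub> \<ominus>\<^bsub>gchains G M (wedge X I) q\<^esub> z))"
    using y z split_chain_0 by (intro split_chain_diff) auto
  then show ?thesis
    using y(1) z(1) by (simp add: a_minus_def)
qed

text \<open>A simplex in the summand \<alpha> is recovered by the retraction to \<alpha> and sent to
  the base simplex by every other one, so exactly one term of \<open>partial_retract\<close>
  survives.\<close>

lemma split_chain_gamma:
  assumes \<rho>: "\<rho> \<in> points (singular_gset q (wedge X I))" "\<rho> \<in> summand_simplices"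
    and l: "l \<in> carrier (coeff_at G M (singular_gset q (wedge X I)) \<rho>)"
  shows "split_chain (gamma G M (singular_gset q (wedge X I)) \<rho> l)"
proof -
  let ?W = "wedge X I"
  let ?S = "singular_gset q ?W"
  note S = singular_gset_pointed[OF wedge_action, of q]
  interpret C: module R "gchains G M ?W q"
    by (rule module_gchains[OF wedge_action])
  show ?thesis
  proof (cases "\<rho> = basept ?S")
    case True
    then show ?thesis
      using gamma_base[OF S] l split_chain_0 by (simp add: gchains_def)
  next
    case False
    then obtain \<alpha> \<tau> where \<alpha>: "\<alpha> \<in> I" and \<tau>: "\<tau> \<in> points (singular_gset q (X \<alpha>))"
      and \<rho>\<tau>: "\<rho> = simplex_map q (wedge_incl X \<alpha>) \<tau>"
      using \<rho>(2) by (auto simp: summand_simplices_def)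
    let ?g = "gamma G M ?S \<rho> l"
    have g: "?g \<in> carrier (gchains G M ?W q)"
      using gamma_closed[OF S \<rho>(1) l] by (simp add: gchains_def)
    have \<tau>e: "\<tau> \<in> extensional (standard_simplex q)"
      using \<tau> by (simp add: singular_gset_def singular_simplex_def)
    have summand: "incl_chain j (retract_chain j ?g) = (if \<alpha> = j then ?g else \<zero>\<^bsub>gchains G M ?W q\<^esub>)" if j: "j \<in> I" for j
    proof -
      have "simplex_map q (wedge_incl X j) (simplex_map q (wedge_retract X j) \<rho>) = (if \<alpha> = j then \<rho> else basept ?S)"
        using \<tau>e by (auto simp: \<rho>\<tau> simplex_map_def wedge_retract_incl singular_gset_def fun_eq_iff
            wedge_incl_def[of X j "spt (X j)"] wedge_def)
      then show ?thesis
        using gchain_map_comp_gamma[OF wedge_action X[OF j] wedge_action retract_gmap[OF j] incl_gmap[OF j] \<rho>(1) l]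
          chain_gamma_self[OF S \<rho>(1) l] chain_gamma_base[OF S isotropy_subgroup[OF S \<rho>(1)] l, of "frag_of (basept ?S)"]
        by (simp add: gchains_def)
    qed
    have "partial_retract J' ?g = ?g" if J': "finite J'" "{\<alpha>} \<subseteq> J'" "J' \<subseteq> I" for J'
    proof -
      have "partial_retract J' ?g = (\<Oplus>\<^bsub>gchains G M ?W q\<^esub>j\<in>J'. if \<alpha> = j then ?g else \<zero>\<^bsub>gchains G M ?W q\<^esub>)"
        unfolding partial_retract_def using J' g summand by (intro C.finsum_cong') auto
      also have "\<dots> = ?g"
        using J' g by (intro C.finsum_singleton) auto
      finally show ?thesis .
    qed
    then show ?thesis
      unfolding split_chain_def using \<alpha> by (intro exI[of _ "{\<alpha>}"]) auto
  qed
qed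

lemma split_chain_chain_gamma:
  assumes H: "subgroup H G" and l: "l \<in> carrier (mod_at M H)"
    and c: "Poly_Mapping.keys c \<subseteq> fixed_points (singular_gset q (wedge X I)) H \<inter> summand_simplices"
  shows "split_chain (chain_gamma (singular_gset q (wedge X I)) H l c)"
proof -
  let ?S = "singular_gset q (wedge X I)"
  note S = singular_gset_pointed[OF wedge_action, of q]
  show ?thesis
    using c
  proof (induction c rule: free_Abelian_group_induct[consumes 1, case_names zero diff of])
    case zero
    show ?case
      using split_chain_0 by (simp add: chain_gamma_0[OF S H l] gchains_def)
  next
    case (diff a b)
    then have "Poly_Mapping.keys a \<subseteq> fixed_points ?S H" "Poly_Mapping.keys b \<subseteq> fixed_points ?S H"
      by auto
    then show ?case
      using split_chain_diff diff(3,4) chain_gamma_closed[OF S H l]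
      by (simp add: chain_gamma_diff[OF S H l] gchains_def)
  next
    case (of \<rho>)
    then show ?case
      using split_chain_gamma[of \<rho>] mod_hom_closed[OF projection_hom[OF S H] l] fixed_pointsD(1)[OF S H]
      by (simp add: chain_gamma_of[OF S H l])
  qed
qed

text \<open>The cover consists of {eW > 0} and of the parts {eW < 1} of the summands. A simplex
  inside {eW > 0} is collapsed to the base point at time 1; a simplex inside a summand stays in it,
  as the deformation preserves summands. Iterated subdivision makes every simplex small with respect
  to this cover.\<close>

lemma deformed_simplices_split:
  assumes D: "\<And>\<alpha>. \<alpha> \<in> I \<Longrightarrow> contraction_data G (X \<alpha>) (D \<alpha>) (e \<alpha>)"
  defines "DW \<equiv> \<lambda>(p, t). case p of None \<Rightarrow> None | Some (\<alpha>, x) \<Rightarrow> wedge_incl X \<alpha> (D \<alpha> (x, t))"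
  assumes \<sigma>: "\<sigma> \<in> points (singular_gset q (wedge X I))"
  shows "\<exists>N. \<forall>n\<ge>N. Poly_Mapping.keys
      (chain_map q (\<lambda>p. DW (p, 1)) ((singular_subdivision q ^^ n) (frag_of \<sigma>))) \<subseteq> summand_simplices"
proof -
  let ?W = "wedge X I"
  define eW where "eW p = (case p of None \<Rightarrow> 1 | Some (\<alpha>, x) \<Rightarrow> e \<alpha> x)" for p
  have DW: "contraction_data G ?W DW eW"
    and DW_incl: "\<And>\<alpha> x. \<alpha> \<in> I \<Longrightarrow> x \<in> topspace (spc (X \<alpha>)) \<Longrightarrow>
      DW (wedge_incl X \<alpha> x, 1) \<in> wedge_incl X \<alpha> ` topspace (spc (X \<alpha>))"
    and open_A: "\<And>\<alpha>. \<alpha> \<in> I \<Longrightarrow> openin (spc ?W) {p \<in> wedge_incl X \<alpha> ` topspace (spc (X \<alpha>)). eW p < 1}"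
    unfolding DW_def eW_def[abs_def]
    by (rule wedge_contraction[OF is_group X D]; assumption?)+
  have top: "topspace (spc ?W) = wedge_points X I" "spt ?W = None"
    by (simp_all add: wedge_def)
  have cont: "continuous_map (spc ?W) (spc ?W) (\<lambda>p. DW (p, 1))"
    using DW continuous_map_compose[OF continuous_map_end[of 1 "spc ?W"], of "spc ?W" DW]
    by (simp add: contraction_data_def comp_def)
  define V where "V = {p \<in> topspace (spc ?W). eW p \<in> {0<..}}"
  define \<C> where "\<C> = insert V ((\<lambda>\<alpha>. {p \<in> wedge_incl X \<alpha> ` topspace (spc (X \<alpha>)). eW p < 1}) ` I)"
  have "openin (spc ?W) V"
    unfolding V_def using DW by (intro openin_continuous_map_preimage[of _ euclideanreal]) (auto simp: contraction_data_def)
  then have \<C>: "openin (spc ?W) U" if "U \<in> \<C>" for U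
    using that open_A by (auto simp: \<C>_def)
  have cover: "topspace (spc ?W) \<subseteq> \<Union>\<C>"
  proof
    fix p assume p: "p \<in> topspace (spc ?W)"
    show "p \<in> \<Union>\<C>"
      using p[unfolded top(1)]
    proof (cases p rule: wedge_points_cases)
      case 1
      then show ?thesis
        using p by (simp add: \<C>_def V_def eW_def)
    next
      case (2 \<alpha> x)
      then show ?thesis
        using p by (cases "0 < eW p") (auto simp: \<C>_def V_def)
    qed
  qed
  have chain: "singular_chain q (spc ?W) (frag_of \<sigma>)"
    using \<sigma> by (simp add: singular_gset_def singular_chain_of)
  obtain N where N: "\<And>n f. N \<le> n \<Longrightarrow> f \<in> Poly_Mapping.keys ((singular_subdivision q ^^ n) (frag_of \<sigma>)) \<Longrightarrow>
      \<exists>U\<in>\<C>. f \<in> standard_simplex q \<rightarrow> U"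
  proof (rule sufficient_iterated_singular_subdivision_exists[OF \<C> cover chain])
    fix N assume "\<And>n f. N \<le> n \<Longrightarrow> f \<in> Poly_Mapping.keys ((singular_subdivision q ^^ n) (frag_of \<sigma>)) \<Longrightarrow>
      \<exists>U\<in>\<C>. f \<in> standard_simplex q \<rightarrow> U"
    then show thesis
      by (rule that)
  qed
  have small: "simplex_map q (\<lambda>p. DW (p, 1)) f \<in> summand_simplices"
    if f: "singular_simplex q (spc ?W) f" and U: "U \<in> \<C>" "f \<in> standard_simplex q \<rightarrow> U" for f U
  proof (cases "U = V")
    case True
    have "DW (f y, 1) = None" if "y \<in> standard_simplex q" for y
      using that U(2) DW True by (auto simp: V_def contraction_data_def top(2))
    then have "simplex_map q (\<lambda>p. DW (p, 1)) f = basept (singular_gset q ?W)"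
      by (auto simp: simplex_map_def singular_gset_def top(2) fun_eq_iff)
    then show ?thesis
      by (simp add: summand_simplices_def)
  next
    case False
    then obtain \<alpha> where \<alpha>: "\<alpha> \<in> I" and f\<alpha>: "\<And>y. y \<in> standard_simplex q \<Longrightarrow> f y \<in> wedge_incl X \<alpha> ` topspace (spc (X \<alpha>))"
      using U by (auto simp: \<C>_def Pi_iff)
    let ?\<rho> = "simplex_map q (\<lambda>p. DW (p, 1)) f"
    have \<rho>: "singular_simplex q (spc ?W) ?\<rho>"
      by (rule singular_simplex_simplex_map[OF f cont])
    \<comment> \<open>The lift to \<open>X \<alpha>\<close> is taken through the retraction, which
      makes it continuous without any argument that the inclusion is an embedding.\<close>
    have "singular_simplex q (spc (X \<alpha>)) (simplex_map q (wedge_retract X \<alpha>) ?\<rho>)"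
      using retract_gmap[OF \<alpha>] by (intro singular_simplex_simplex_map[OF \<rho>]) (simp add: pointed_gmap_def)
    moreover have "simplex_map q (wedge_incl X \<alpha>) (simplex_map q (wedge_retract X \<alpha>) ?\<rho>) = ?\<rho>"
    proof -
      have "wedge_incl X \<alpha> (wedge_retract X \<alpha> (DW (f y, 1))) = DW (f y, 1)" if y: "y \<in> standard_simplex q" for y
      proof -
        obtain x where "x \<in> topspace (spc (X \<alpha>))" "f y = wedge_incl X \<alpha> x"
          using f\<alpha>[OF y] by blast
        then obtain x' where "DW (f y, 1) = wedge_incl X \<alpha> x'"
          using DW_incl[OF \<alpha>] by auto
        then show ?thesis
          by (simp add: wedge_retract_incl)
      qed
      then show ?thesis
        by (auto simp: simplex_map_def fun_eq_iff)
    qed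
    ultimately show ?thesis
      using \<alpha> unfolding summand_simplices_def singular_gset_def by (force simp: image_iff)
  qed
  have in_W: "singular_simplex q (spc ?W) f" if "f \<in> Poly_Mapping.keys ((singular_subdivision q ^^ n) (frag_of \<sigma>))" for f n
    using singular_chain_iterated_subdivision[OF chain, of n] that by (auto simp: singular_chain_def)
  have "Poly_Mapping.keys (chain_map q (\<lambda>p. DW (p, 1)) ((singular_subdivision q ^^ n) (frag_of \<sigma>))) \<subseteq> summand_simplices"
    if "N \<le> n" for n
  proof
    fix \<rho> assume "\<rho> \<in> Poly_Mapping.keys (chain_map q (\<lambda>p. DW (p, 1)) ((singular_subdivision q ^^ n) (frag_of \<sigma>)))"
    then obtain f where f: "f \<in> Poly_Mapping.keys ((singular_subdivision q ^^ n) (frag_of \<sigma>))"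
      and "\<rho> = simplex_map q (\<lambda>p. DW (p, 1)) f"
      using keys_frag_extend[of "frag_of \<circ> simplex_map q (\<lambda>p. DW (p, 1))" "(singular_subdivision q ^^ n) (frag_of \<sigma>)"]
      by (auto simp: chain_map_def)
    then show "\<rho> \<in> summand_simplices"
      using small[OF in_W[OF f]] N[OF that f] by blast
  qed
  then show ?thesis
    by blast
qed

text \<open>Each generator needs its own number of subdivisions. As the previous bound is good for
  all larger n as well, the maximum over the finitely many generators of z serves the whole
  chain.\<close>

lemma deformed_chain_split:
  assumes D: "\<And>\<alpha>. \<alpha> \<in> I \<Longrightarrow> contraction_data G (X \<alpha>) (D \<alpha>) (e \<alpha>)"
  defines "DW \<equiv> \<lambda>(p, t). case p of None \<Rightarrow> None | Some (\<alpha>, x) \<Rightarrow> wedge_incl X \<alpha> (D \<alpha> (x, t))"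
  defines "\<phi> \<equiv> \<lambda>n \<sigma>. chain_map q (\<lambda>p. DW (p, 1)) ((singular_subdivision q ^^ n) (frag_of \<sigma>))"
  assumes \<phi>: "\<And>n. equivariant_chain (singular_gset q (wedge X I)) (singular_gset q (wedge X I)) (\<phi> n)"
    and z: "z \<in> carrier (gchains G M (wedge X I) q)"
  shows "\<exists>N. \<forall>n\<ge>N. split_chain (induced (singular_gset q (wedge X I)) (singular_gset q (wedge X I)) (\<phi> n) z)"
proof -
  let ?S = "singular_gset q (wedge X I)"
  let ?C = "gchains G M (wedge X I) q"
  note S = singular_gset_pointed[OF wedge_action, of q]
  have hom: "induced ?S ?S (\<phi> n) \<in> mod_hom R ?C ?C" for n
    using induced_hom[OF S S \<phi>] by (simp add: gchains_def)
  have z': "z \<in> carrier (fixed_module G M ?S)"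
    using z by (simp add: gchains_def)
  then show ?thesis
  proof (induction z rule: fixed_induct[OF S, consumes 1, case_names zero gamma])
    case zero
    show ?case
      using mod_hom_zero[OF module_gchains[OF wedge_action] module_gchains[OF wedge_action] hom] split_chain_0
      by (simp add: gchains_def)
  next
    case (gamma \<sigma> l v)
    obtain N where N: "\<And>n. N \<le> n \<Longrightarrow> split_chain (induced ?S ?S (\<phi> n) v)"
      using gamma(4) by blast
    obtain N' where N': "\<And>n. N' \<le> n \<Longrightarrow> Poly_Mapping.keys (\<phi> n \<sigma>) \<subseteq> summand_simplices"
      using deformed_simplices_split[OF D gamma(1)] unfolding \<phi>_def DW_def by blast
    have gc: "gamma G M ?S \<sigma> l \<in> carrier ?C" and vc: "v \<in> carrier ?C"
      using gamma_closed[OF S gamma(1,2)] gamma(3) by (simp_all add: gchains_def)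
    have "split_chain (induced ?S ?S (\<phi> n) (gamma G M ?S \<sigma> l \<oplus>\<^bsub>?C\<^esub> v))" if n: "max N N' \<le> n" for n
    proof -
      have "split_chain (induced ?S ?S (\<phi> n) (gamma G M ?S \<sigma> l))"
        unfolding induced_gamma[OF S S \<phi> gamma(1,2)]
        using N'[of n] n equivariant_chain_keys[OF \<phi> gamma(1)]
        by (intro split_chain_chain_gamma isotropy_subgroup[OF S] gamma(1,2)) auto
      then show ?thesis
        using N[of n] n mod_hom_closed[OF hom gc] mod_hom_closed[OF hom vc]
        by (simp add: mod_hom_add[OF hom gc vc] split_chain_add)
    qed
    then show ?case
      unfolding gchains_def by blast
  qed
qed

text \<open>The subdivided deformation replaces z by a homologous chain y that splits. The
  components are the retracts of y; chain maps preserve cycles, so they are cycles as soon as y is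
  one.\<close>

lemma cycle_homologous_to_sum:
  assumes D: "\<And>\<alpha>. \<alpha> \<in> I \<Longrightarrow> contraction_data G (X \<alpha>) (D \<alpha>) (e \<alpha>)"
    and z: "z \<in> gcycles G R M (wedge X I) q"
  shows "\<exists>J v. finite J \<and> J \<subseteq> I \<and> (\<forall>j\<in>J. v j \<in> gcycles G R M (X j) q) \<and>
    z \<ominus>\<^bsub>gchains G M (wedge X I) q\<^esub> (\<Oplus>\<^bsub>gchains G M (wedge X I) q\<^esub>j\<in>J. incl_chain j (v j))
      \<in> gboundaries G R M (wedge X I) q"
proof -
  let ?W = "wedge X I"
  let ?S = "singular_gset q ?W"
  let ?C = "gchains G M ?W q"
  let ?DW = "\<lambda>(p, t). case p of None \<Rightarrow> None | Some (\<alpha>, x) \<Rightarrow> wedge_incl X \<alpha> (D \<alpha> (x, t))"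
  let ?\<phi> = "\<lambda>n \<sigma>. chain_map q (\<lambda>p. ?DW (p, 1)) ((singular_subdivision q ^^ n) (frag_of \<sigma>))"
  interpret C: module R ?C
    by (rule module_gchains[OF wedge_action])
  have DW: "contraction_data G ?W ?DW (\<lambda>p. case p of None \<Rightarrow> 1 | Some (\<alpha>, x) \<Rightarrow> e \<alpha> x)"
    by (rule wedge_contraction(1)[OF is_group X D])
  note \<phi> = subdivided_deformation[OF wedge_action DW, where q = q]
  have zC: "z \<in> carrier ?C"
    using z by (simp add: gcycles_def)
  obtain n where split: "split_chain (induced ?S ?S (?\<phi> n) z)"
    using deformed_chain_split[OF D \<phi>(1) zC] by blast
  define y where "y = induced ?S ?S (?\<phi> n) z"
  obtain J where J: "finite J" "J \<subseteq> I" "partial_retract J y = y"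
    using split unfolding y_def split_chain_def by blast
  have yC: "y \<in> carrier ?C"
    using mod_hom_closed[OF induced_hom[OF singular_gset_pointed[OF wedge_action] singular_gset_pointed[OF wedge_action] \<phi>(1)]] zC
    by (simp add: y_def gchains_def)
  have yz: "y \<ominus>\<^bsub>?C\<^esub> z \<in> gboundaries G R M ?W q"
    unfolding y_def by (rule \<phi>(2)[OF z])
  note Z = C.submoduleE[OF gcycles_submodule[OF wedge_action]]
  note B = C.submoduleE[OF gboundaries_submodule[OF wedge_action]]
  have "y = (y \<ominus>\<^bsub>?C\<^esub> z) \<oplus>\<^bsub>?C\<^esub> z"
    using yC zC by (simp add: a_minus_def C.a_assoc C.l_neg)
  \<comment> \<open>y is a cycle because it differs from the cycle z by a boundary.\<close>
  then have y: "y \<in> gcycles G R M ?W q"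
    using Z(5)[OF _ z] yz gboundaries_subset_gcycles[OF wedge_action] by fastforce
  have "z \<ominus>\<^bsub>?C\<^esub> y = \<ominus>\<^bsub>?C\<^esub> (y \<ominus>\<^bsub>?C\<^esub> z)"
    using yC zC by (simp add: a_minus_def C.minus_add C.a_comm)
  then have "z \<ominus>\<^bsub>?C\<^esub> y \<in> gboundaries G R M ?W q"
    using B(3)[OF yz] by simp
  moreover have "y = (\<Oplus>\<^bsub>?C\<^esub>j\<in>J. incl_chain j (retract_chain j y))"
    using J(3) by (simp add: partial_retract_def)
  moreover have "retract_chain j y \<in> gcycles G R M (X j) q" if "j \<in> J" for j
    using that J(2) by (intro gchain_map_gcycles[OF wedge_action X retract_gmap y]) auto
  ultimately show ?thesis
    using J(1,2) by (intro exI[of _ J] exI[of _ "\<lambda>j. retract_chain j y"]) auto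
qed

end

end

section \<open>The isomorphism on homology\<close>

lemma pointed_action_well_pointed: "well_pointed z G X \<Longrightarrow> pointed_action G X"
  by (simp add: well_pointed_def pointed_gspace_def gspace_def pointed_action_def)

theorem theorem5p13:
  fixes G :: "'g monoid"
    and R :: "'r ring"
    and M :: "('g, 'r, 'm) coeff_system"
    and X :: "'i \<Rightarrow> ('g, 'a) pgspace"
    and I :: "'i set"
    and q :: nat
  assumes "group G" and "finite (carrier G)"
    and "cring R"
    and "covariant_coeff_system G R M"
    and "\<And>\<alpha>. \<alpha> \<in> I \<Longrightarrow> well_pointed TYPE('z) G (X \<alpha>)"
  shows "\<exists>\<Phi> \<in> mod_iso R
            (direct_sum_module I (\<lambda>\<alpha>. bredon_illman_homology G R M q (X \<alpha>)))
            (bredon_illman_homology G R M q (wedge X I)).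
          \<forall>\<alpha>\<in>I. \<forall>c\<in>carrier (bredon_illman_homology G R M q (X \<alpha>)).
            \<Phi> (direct_sum_incl I (\<lambda>\<alpha>. bredon_illman_homology G R M q (X \<alpha>)) \<alpha> c) =
            homology_map G R M q (X \<alpha>) (wedge X I) (wedge_incl X \<alpha>) c"
proof -
  interpret coefficients G R M
    using assms(1-4) by (simp add: coefficients_def coefficients_axioms_def)
  have X: "\<And>\<alpha>. \<alpha> \<in> I \<Longrightarrow> pointed_action G (X \<alpha>)"
    using assms(5) pointed_action_well_pointed by blast
  obtain D e where D: "\<And>\<alpha>. \<alpha> \<in> I \<Longrightarrow> contraction_data G (X \<alpha>) (D \<alpha>) (e \<alpha>)"
    using well_pointed_contraction[OF assms(1) assms(5)] by metis
  let ?W = "wedge X I"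
  let ?inc = "\<lambda>\<alpha>. gchain_map (X \<alpha>) ?W (wedge_incl X \<alpha>) q"
  let ?ret = "\<lambda>\<alpha>. gchain_map ?W (X \<alpha>) (wedge_retract X \<alpha>) q"
  let ?cycX = "\<lambda>\<alpha>. (gchains G M (X \<alpha>) q)\<lparr>carrier := gcycles G R M (X \<alpha>) q\<rparr>"
  let ?cycW = "(gchains G M ?W q)\<lparr>carrier := gcycles G R M ?W q\<rparr>"
  have W: "pointed_action G ?W"
    by (rule wedge_action) (rule X)
  have incl: "pointed_gmap G (X \<alpha>) ?W (wedge_incl X \<alpha>)" and retract: "pointed_gmap G ?W (X \<alpha>) (wedge_retract X \<alpha>)"
    if "\<alpha> \<in> I" for \<alpha>
    by (rule incl_gmap retract_gmap, use X that in auto)+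
  \<comment> \<open>Cosets depend on the addition only, so those in the module of cycles, used in
    the quotient, are those in the module of chains, used in \<open>homology_map\<close>.\<close>
  have coset: "C +>\<^bsub>N\<lparr>carrier := Z\<rparr>\<^esub> x = C +>\<^bsub>N\<^esub> x" for C Z x and N :: "('r, 'n) module"
    by (simp add: a_r_coset_def')
  have "\<exists>\<Phi>\<in>mod_iso R (direct_sum_module I (\<lambda>\<alpha>. bredon_illman_homology G R M q (X \<alpha>)))
             (bredon_illman_homology G R M q ?W).
           \<forall>\<alpha>\<in>I. \<forall>c\<in>carrier (bredon_illman_homology G R M q (X \<alpha>)).
             \<Phi> (direct_sum_incl I (\<lambda>\<alpha>. bredon_illman_homology G R M q (X \<alpha>)) \<alpha> c) =
               (\<Union>u\<in>c. gboundaries G R M ?W q +>\<^bsub>?cycW\<^esub> ?inc \<alpha> u)"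
    unfolding bredon_illman_homology_def
  proof (rule quotient_direct_sum_iso[where r = ?ret])
    show "cring R" by fact
    show "module R ?cycW"
      by (rule module_gcycles[OF W])
    show "submodule (gboundaries G R M ?W q) R ?cycW"
      by (rule gboundaries_submodule_gcycles[OF W])
    fix \<alpha> assume \<alpha>: "\<alpha> \<in> I"
    note f = X[OF \<alpha>] W incl[OF \<alpha>] and r = W X[OF \<alpha>] retract[OF \<alpha>]
    show "module R (?cycX \<alpha>)"
      by (rule module_gcycles[OF X[OF \<alpha>]])
    show "submodule (gboundaries G R M (X \<alpha>) q) R (?cycX \<alpha>)"
      by (rule gboundaries_submodule_gcycles[OF X[OF \<alpha>]])
    show "?inc \<alpha> \<in> mod_hom R (?cycX \<alpha>) ?cycW" "?ret \<alpha> \<in> mod_hom R ?cycW (?cycX \<alpha>)"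
      using gchain_map_gcycles_hom[OF f] gchain_map_gcycles_hom[OF r] by auto
    show "?inc \<alpha> ` gboundaries G R M (X \<alpha>) q \<subseteq> gboundaries G R M ?W q"
      "?ret \<alpha> ` gboundaries G R M ?W q \<subseteq> gboundaries G R M (X \<alpha>) q"
      using gchain_map_gboundaries[OF f] gchain_map_gboundaries[OF r] by auto
    fix u assume "u \<in> carrier (?cycX \<alpha>)"
    then have u: "u \<in> carrier (gchains G M (X \<alpha>) q)"
      by (simp add: gcycles_def)
    show "?ret \<alpha> (?inc \<alpha> u) = u"
      using retract_incl_chain[of I X, OF X \<alpha> \<alpha> u] by simp
    show "?ret \<beta> (?inc \<alpha> u) = \<zero>\<^bsub>?cycX \<beta>\<^esub>" if "\<beta> \<in> I" "\<alpha> \<noteq> \<beta>" for \<beta>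
      using retract_incl_chain[of I X, OF X \<alpha> that(1) u] that(2) by simp
  next
    fix z assume "z \<in> carrier ?cycW"
    then have z: "z \<in> gcycles G R M ?W q"
      by simp
    obtain J v where J: "finite J" "J \<subseteq> I" "\<forall>j\<in>J. v j \<in> gcycles G R M (X j) q"
      and zv: "z \<ominus>\<^bsub>gchains G M ?W q\<^esub> (\<Oplus>\<^bsub>gchains G M ?W q\<^esub>j\<in>J. ?inc j (v j)) \<in> gboundaries G R M ?W q"
      using cycle_homologous_to_sum[of I X, OF X D z] by blast
    interpret C: module R "gchains G M ?W q"
      by (rule module_gchains[OF W])
    interpret Z: module R ?cycW
      by (rule module_gcycles[OF W])
    \<comment> \<open>As a homomorphism the inclusion of cycles into chains transfers finite sums
      and differences from one record to the other.\<close>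
    have id: "(\<lambda>u. u) \<in> mod_hom R ?cycW (gchains G M ?W q)"
      by (rule mod_homI) (auto simp: gcycles_def)
    have inc_v: "?inc j (v j) \<in> gcycles G R M ?W q" if "j \<in> J" for j
      using that J gchain_map_gcycles[OF X W incl, of j "v j"] by blast
    then have inc_v': "(\<lambda>j. ?inc j (v j)) \<in> J \<rightarrow> carrier ?cycW"
      by simp
    have sum: "(\<Oplus>\<^bsub>?cycW\<^esub>j\<in>J. ?inc j (v j)) = (\<Oplus>\<^bsub>gchains G M ?W q\<^esub>j\<in>J. ?inc j (v j))"
      using mod_hom_finsum[OF Z.module_axioms C.module_axioms id J(1) inc_v'] .
    have "z \<ominus>\<^bsub>?cycW\<^esub> (\<Oplus>\<^bsub>?cycW\<^esub>j\<in>J. ?inc j (v j)) =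
        z \<ominus>\<^bsub>gchains G M ?W q\<^esub> (\<Oplus>\<^bsub>gchains G M ?W q\<^esub>j\<in>J. ?inc j (v j))"
      using mod_hom_minus[OF Z.module_axioms C.module_axioms id, of z] z Z.finsum_closed[OF inc_v'] sum by simp
    then show "\<exists>J v. finite J \<and> J \<subseteq> I \<and> (\<forall>j\<in>J. v j \<in> carrier (?cycX j)) \<and>
        z \<ominus>\<^bsub>?cycW\<^esub> (\<Oplus>\<^bsub>?cycW\<^esub>j\<in>J. ?inc j (v j)) \<in> gboundaries G R M ?W q"
      using J zv by (intro exI[of _ J] exI[of _ v]) simp
  qed
  \<comment> \<open>\<open>homology_map\<close> is defined through \<open>fixed_map\<close>, which
    agrees with the induced homomorphism on chains; the members of a homology class are cycles,
    hence chains.\<close>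
  moreover have "(\<Union>u\<in>c. gboundaries G R M ?W q +>\<^bsub>?cycW\<^esub> ?inc \<alpha> u) = homology_map G R M q (X \<alpha>) ?W (wedge_incl X \<alpha>) c"
    if \<alpha>: "\<alpha> \<in> I" and c: "c \<in> carrier (bredon_illman_homology G R M q (X \<alpha>))" for \<alpha> c
  proof -
    interpret Z: module R "?cycX \<alpha>"
      by (rule module_gcycles[OF X[OF \<alpha>]])
    interpret B: abelian_subgroup "gboundaries G R M (X \<alpha>) q" "?cycX \<alpha>"
      by (rule Z.submodule_abelian_subgroup[OF gboundaries_submodule_gcycles[OF X[OF \<alpha>]]])
    obtain x where x: "x \<in> carrier (?cycX \<alpha>)" "c = gboundaries G R M (X \<alpha>) q +>\<^bsub>?cycX \<alpha>\<^esub> x"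
      using c unfolding bredon_illman_homology_def by (rule quotient_carrierE)
    have "fixed_map G R M (singular_gset q (X \<alpha>)) (singular_gset q ?W) (simplex_map q (wedge_incl X \<alpha>)) u = ?inc \<alpha> u"
      if "u \<in> c" for u
    proof -
      have "u \<in> carrier (?cycX \<alpha>)"
        using B.a_elemrcos_carrier[OF x(1)] that x(2) by blast
      then show ?thesis
        using fixed_map_gmap[OF X[OF \<alpha>] W incl[OF \<alpha>]] by (simp add: gchain_map_def gcycles_def)
    qed
    then show ?thesis
      by (simp add: homology_map_def coset)
  qed
  ultimately show ?thesis
    by (metis (no_types, lifting))
qed

end
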